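(* There is no graph $G$ with $11/3 < \chi_c'(G) < 4$.
   Context: Graphs are finite, may have parallel edges, but have no loops. For positive integers $p \geq q$, a $(p,q)$-coloring of a graph $G=(V,E)$ is a mapping $f: V \to \{0,1,\ldots,p-1\}$ such that for every edge $xy$ of $G$, $q \leq |f(x)-f(y)| \leq p-q$. The circular chromatic number of $G$ is $\chi_c(G) = \inf\{p/q : G \text{ has a } (p,q)\text{-coloring}\}$. The line graph $L(G)$ of $G$ has vertex set $E$, two distinct elements $e_1,e_2 \in E$ being adjacent if they have an end vertex in common (in particular, parallel edges are distinct adjacent vertices of $L(G)$). The circular chromatic index of $G$ is $\chi_c'(G) = \chi_c(L(G))$. *)

theory Defs
  imports Complex_Main
begin

text \<open>Undirected multigraphs: edges are named objects, so that parallel edges are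
  different edges with the same set of ends.\<close>

record ('v, 'e) multigraph =
  verts :: "'v set"
  edges :: "'e set"
  ends :: "'e \<Rightarrow> 'v set"

text \<open>Two ends per edge: this excludes loops.\<close>

definition finite_loopless :: "('v, 'e) multigraph \<Rightarrow> bool" where
  "finite_loopless G \<longleftrightarrow> finite (verts G) \<and> finite (edges G) \<and>
     (\<forall>e\<in>edges G. ends G e \<subseteq> verts G \<and> card (ends G e) = 2)"

text \<open>Colour differences are taken in the integers, since subtraction on the
  natural numbers truncates. Values of the colouring outside the vertex set are
  irrelevant.\<close>

definition pq_coloring :: "nat \<Rightarrow> nat \<Rightarrow> ('v, 'e) multigraph \<Rightarrow> ('v \<Rightarrow> nat) \<Rightarrow> bool" where
  "pq_coloring p q G f \<longleftrightarrow>
     (\<forall>x\<in>verts G. f x \<in> {0..<p}) \<and>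
     (\<forall>e\<in>edges G. \<forall>x y. ends G e = {x, y} \<longrightarrow>
        int q \<le> \<bar>int (f x) - int (f y)\<bar> \<and> \<bar>int (f x) - int (f y)\<bar> \<le> int p - int q)"

definition circular_chromatic_number :: "('v, 'e) multigraph \<Rightarrow> real" where
  "circular_chromatic_number G =
     Inf {real p / real q | p q. 0 < q \<and> q \<le> p \<and> (\<exists>f. pq_coloring p q G f)}"

text \<open>The line graph is simple: its edges are the two-element sets of distinct
  edges with a common end, and each of them is its own set of ends.\<close>

definition line_graph :: "('v, 'e) multigraph \<Rightarrow> ('e, 'e set) multigraph" where
  "line_graph G =
     \<lparr>verts = edges G,
      edges = {{e1, e2} | e1 e2. e1 \<in> edges G \<and> e2 \<in> edges G \<and> e1 \<noteq> e2 \<and>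
                 ends G e1 \<inter> ends G e2 \<noteq> {}},
      ends = (\<lambda>d. d)\<rparr>"

definition circular_chromatic_index :: "('v, 'e) multigraph \<Rightarrow> real" where
  "circular_chromatic_index G = circular_chromatic_number (line_graph G)"

lemma finite_loopless_line_graph:
  assumes "finite_loopless G"
  shows "finite_loopless (line_graph G)"
proof -
  have "edges (line_graph G) \<subseteq> Pow (edges G)"
    by (auto simp: line_graph_def)
  moreover have "finite (Pow (edges G))"
    using assms by (simp add: finite_loopless_def)
  ultimately have "finite (edges (line_graph G))"
    by (rule finite_subset)
  then show ?thesis
    using assms by (auto simp: finite_loopless_def line_graph_def)
qed

text \<open>The infimum is taken over a nonempty set that is bounded below, hence it is
  the true one.\<close>

lemma circular_chromatic_number_set:
  assumes "finite_loopless G"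
  defines "S \<equiv> {real p / real q | p q. 0 < q \<and> q \<le> p \<and> (\<exists>f. pq_coloring p q G f)}"
  shows "S \<noteq> {}" and "bdd_below S"
proof -
  obtain f :: "'a \<Rightarrow> nat" where f: "bij_betw f (verts G) {0..<card (verts G)}"
    using assms(1) ex_bij_betw_finite_nat finite_loopless_def by blast
  let ?p = "Suc (card (verts G))"
  have range: "f x < card (verts G)" if "x \<in> verts G" for x
    using bij_betwE[OF f] that by auto
  have "int 1 \<le> \<bar>int (f x) - int (f y)\<bar> \<and> \<bar>int (f x) - int (f y)\<bar> \<le> int ?p - int 1"
    if "e \<in> edges G" "ends G e = {x, y}" for e x y
  proof -
    have xy: "x \<in> verts G" "y \<in> verts G" "x \<noteq> y"
      using assms(1) that by (auto simp: finite_loopless_def)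
    then have "f x \<noteq> f y"
      using f by (meson bij_betw_def inj_onD)
    with range[OF xy(1)] range[OF xy(2)] show ?thesis by auto
  qed
  then have "pq_coloring ?p 1 G f"
    unfolding pq_coloring_def using range by (auto simp: less_SucI)
  then have "real ?p / real 1 \<in> S"
    unfolding S_def by (intro CollectI exI[of _ ?p] exI[of _ 1]) auto
  then show "S \<noteq> {}" by blast
  show "bdd_below S"
    unfolding S_def by (rule bdd_belowI[of _ 0]) auto
qed

end

theory Submission
  imports Defs
begin

text \<open>
  Four pairwise adjacent edges, and likewise a \<open>K\<^sub>4\<close> with one subdivided edge, force \<open>4 * q \<le> p\<close> in every
  \<open>(p, q)\<close>-colouring of the line graph. It remains to give a \<open>(11, 3)\<close>-colouring of the edges when neither
  occurs; then all degrees are at most 3.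

  A minimal uncolourable edge set \<open>F\<close> has no cut consisting of a single edge, since colourings of the two
  sides can be rotated so as to agree on that edge. Gallai's lemma on maximum matchings, applied to the
  graph whose nodes are the isolated triangles and the remaining vertices, then provides a matching \<open>M\<close>
  covering all vertices of degree 3 and containing an edge of each triangle. The edges outside \<open>M\<close> form
  paths and cycles, and the odd cycles have length at least 5.

  Colour \<open>M\<close> with \<open>- 1\<close>, \<open>0\<close>, \<open>1\<close> and the paths and even cycles alternately with 4 and 7. An odd cycle
  can be coloured compatibly if four consecutive vertices of it carry \<open>M\<close>-colours \<open>s\<close>, \<open>s\<close>, \<open>\<noteq> s\<close>, \<open>\<noteq> s\<close>
  with \<open>s = \<plusminus> 1\<close>. Colours of \<open>M\<close> with such a window on every odd cycle are found by choosing the windows so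
  as to minimise an energy that penalises conflicting demands on the edges of \<open>M\<close>.
\<close>

section \<open>Windows on odd cycles\<close>

text \<open>Colours are residues modulo 11, and adjacent edges need circular distance at least 3.
  The choice of colours rests on one observation: 4 and 7 are compatible with each other and with
  all of -1, 0, 1, so a path or an even cycle puts no constraint on the matching. The whole
  difficulty lies in the odd cycles, where further colours such as 9 or 3 appear and exclude some of
  -1, 0, 1 at nearby vertices. A matching edge may join two odd cycles, so their demands interact
  and no cycle can be treated on its own; hence a global minimum. A window needs four distinct
  vertices and no contradiction coming from a chord. This shapes the preparations: a triangle is too
  short, and a pentagon with two crossing chords in the matching, where the search for an unblocked
  window may fail, contains the subdivided K4. Single-edge cuts are the one obstacle to the parity
  count in the matching step: an odd cut that is not a single edge has at least three edges.\<close>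

text \<open>A window puts strong demands \<open>\<plusminus> 2\<close> on its first two vertices (the colour must have this sign) and weak
  demands \<open>\<plusminus> 1\<close> on the last two (the colour must not be this sign). Opposite strong, equal strong and weak,
  and opposite weak demands at the two ends of an edge are penalised; the last kind is still harmless.\<close>

definition clash :: "int \<Rightarrow> int \<Rightarrow> nat" where
  "clash x y = (if x * y = - 4 then 3 else if x * y = 2 then 2 else if x * y = - 1 then 1 else 0)"

lemma clash_commute: "clash x y = clash y x"
  by (simp add: clash_def mult.commute)

lemma clash_zero [simp]: "clash x 0 = 0" "clash 0 x = 0"
  by (simp_all add: clash_def)

definition cost :: "(int \<Rightarrow> int) \<Rightarrow> int \<Rightarrow> int \<Rightarrow> int \<Rightarrow> nat" where
  "cost x p d s = clash (2 * s) (x p) + clash (2 * s) (x (p + d)) +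
     clash s (x (p + 2 * d)) + clash s (x (p + 3 * d))"

text \<open>Within a budget of 2 a strong clash can only be a weak demand of value \<open>s\<close>
  opposite a strong \<open>2 * s\<close>, and nothing else clashes. Reversing and negating the
  window makes that vertex weak, where opposite weak demands cost 1, and every other position stays
  free.\<close>

lemma clash_reverse:
  "\<forall>a\<in>{- 2, - 1, 0, 1, 2}. \<forall>b\<in>{- 2, - 1, 0, 1, 2}. \<forall>c\<in>{- 2, - 1, 0, 1, 2}.
   \<forall>e\<in>{- 2, - 1, 0, 1, 2}. \<forall>s\<in>{- 1, 1}.
     clash (2 * s) a + clash (2 * s) b + clash s c + clash s e \<le> 2 \<longrightarrow>
     0 < clash (2 * s) a + clash (2 * s) b \<longrightarrow>
     clash (- 2 * s) e + clash (- 2 * s) c + clash (- s) b + clash (- s) a \<le> 1"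
  by (simp add: clash_def)

text \<open>Say that a demand favours the sign \<open>r\<close> if it is \<open>2 * r\<close>,
  \<open>- r\<close> or 0: strong \<open>r\<close> and weak \<open>- r\<close> cost nothing against
  it, and a weak demand never costs more than 2. If \<open>a\<close> and \<open>b\<close> favour a
  common sign, the forward window with that sign can clash only at \<open>c\<close>. Otherwise the
  reversed window with a sign favoured by \<open>c\<close> clashes with just one of
  \<open>a\<close>, \<open>b\<close>.\<close>

lemma clash_free:
  "\<forall>a\<in>{- 2, - 1, 0, 1, 2}. \<forall>b\<in>{- 2, - 1, 0, 1, 2}. \<forall>c\<in>{- 2, - 1, 0, 1, 2}.
   (\<exists>s\<in>{- 1, 1}. clash (2 * s) a + clash (2 * s) b + clash s 0 + clash s c \<le> 2) \<or>
   (\<exists>s\<in>{- 1, 1}. clash (2 * s) c + clash (2 * s) 0 + clash s b + clash s a \<le> 2)"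
  by (simp add: clash_def)

text \<open>Here \<open>a\<close> and \<open>b\<close> favour \<open>s\<close> while
  \<open>c\<close> favours \<open>- s\<close>, so only the last weak demand can cost anything, and
  it costs at most 2.\<close>

lemma clash_run_end:
  "\<forall>a\<in>{- 2, - 1, 0, 1, 2}. \<forall>b\<in>{- 2, - 1, 0, 1, 2}. \<forall>c\<in>{- 2, - 1, 0, 1, 2}.
   \<forall>e\<in>{- 2, - 1, 0, 1, 2}. \<forall>s\<in>{- 1, 1}.
     (a = 2 * s \<or> a = - s) \<longrightarrow> (b = 2 * s \<or> b = - s) \<longrightarrow> (c = - 2 * s \<or> c = s) \<longrightarrow>
     clash (2 * s) a + clash (2 * s) b + clash s c + clash s e \<le> 2"
  by (simp add: clash_def)

text \<open>All demands favour the same sign \<open>s\<close>. A strong \<open>- s\<close> is then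
  as expensive as possible, while a window of sign \<open>s\<close> pays only at its two weak
  positions; the bound keeps the last one exact so that windows of both signs can be
  compared.\<close>

lemma clash_uniform:
  "\<forall>s\<in>{- 1, 1}. \<forall>a\<in>{2 * s, - s}. \<forall>b\<in>{2 * s, - s}. \<forall>c\<in>{2 * s, - s}. \<forall>e\<in>{2 * s, - s}.
     clash (2 * s) a = 0 \<and> clash (- 2 * s) a = (if a = 2 * s then 3 else 2) \<and> clash (- s) a = 0 \<and>
     clash (2 * s) a + clash (2 * s) b + clash s c + clash s e \<le> 2 + (if e = 2 * s then 2 else 1)"
  by (simp add: clash_def)

section \<open>Optimal windows on a single odd cycle\<close>

lemma odd_cycle_equal_neighbours:
  fixes f :: "int \<Rightarrow> bool"
  assumes "odd n" "0 < n" and per: "\<And>i. f (i + n) = f i"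
  obtains i where "f i = f (i + 1)"
proof -
  have False if neq: "\<And>i. f i \<noteq> f (i + 1)"
  proof -
    have step: "f (int k) = (f 0 = even k)" for k
    proof (induction k)
      case (Suc k)
      have "f (int k) \<noteq> f (int k + 1)" by (rule neq)
      moreover have "int (Suc k) = int k + 1" by simp
      ultimately show ?case using Suc.IH by (auto simp: add.commute)
    qed simp
    have n: "n = int (nat n)" using assms(2) by simp
    have "f n = f 0" using per[of 0] by simp
    moreover have "odd (nat n)" using assms(1,2) by (simp add: even_nat_iff)
    ultimately show False using step[of "nat n"] n by simp
  qed
  then show ?thesis using that by blast
qed

lemma periodic_multiple:
  fixes x :: "int \<Rightarrow> 'a"
  assumes "\<And>i. x (i + n) = x i"
  shows "x (i + n * int k) = x i"
proof (induction k)
  case (Suc k)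
  have "x (i + n * int (Suc k)) = x (i + n * int k + n)" by (simp add: algebra_simps)
  then show ?case using assms Suc.IH by simp
qed simp

text \<open>\<open>x i\<close> is the demand that reaches position \<open>i\<close> through the
  matching, and \<open>ok\<close> says that a window is unblocked. A strong clash cannot survive in
  a cheapest window: at cost at most 2 the reversal is cheaper, so the cost is at least 3 and any
  window of cost at most 2 gives a contradiction. A position without demand provides one. If every
  position has a demand, the end of a run of equal favoured signs does; if there is no such end, a
  comparison of windows of the two signs decides.\<close>

lemma best_option_no_strong_clash:
  fixes x :: "int \<Rightarrow> int" and ok :: "int \<Rightarrow> int \<Rightarrow> bool"
  assumes "odd n" "0 < n" and range: "\<And>i. x i \<in> {- 2, - 1, 0, 1, 2}" and per: "\<And>i. x (i + n) = x i"
    and ok_rev: "\<And>q e. ok q e \<Longrightarrow> ok (q + 3 * e) (- e)"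
    and zero: "\<And>i. x i = 0 \<Longrightarrow> \<exists>u e. (e = 1 \<or> e = - 1) \<and> x u = 0 \<and> ok (u - 2 * e) e"
    and nonzero: "\<And>q e. (\<And>i. x i \<noteq> 0) \<Longrightarrow> ok q e"
    and opt: "ok p d" "d = 1 \<or> d = - 1" "s = 1 \<or> s = - 1"
    and best: "\<And>q e t. ok q e \<Longrightarrow> e = 1 \<or> e = - 1 \<Longrightarrow> t = 1 \<or> t = - 1 \<Longrightarrow> cost x p d s \<le> cost x q e t"
  shows "clash (2 * s) (x p) = 0 \<and> clash (2 * s) (x (p + d)) = 0"
proof (rule ccontr)
  assume strong: "\<not> ?thesis"
  have not_small: False if "cost x p d s \<le> 2"
  proof -
    have s: "s \<in> {- 1, 1}" using opt(3) by auto
    have "clash (- 2 * s) (x (p + 3 * d)) + clash (- 2 * s) (x (p + 2 * d))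
        + clash (- s) (x (p + d)) + clash (- s) (x p) \<le> 1"
      using clash_reverse[rule_format, OF range[of p] range[of "p + d"] range[of "p + 2 * d"]
          range[of "p + 3 * d"] s] that strong
      by (auto simp: cost_def)
    then have small: "cost x (p + 3 * d) (- d) (- s) \<le> 1"
      by (simp add: cost_def algebra_simps)
    have "2 \<le> cost x p d s"
      using strong range[of p] range[of "p + d"] s by (auto simp: cost_def clash_def split: if_splits)
    moreover have "cost x p d s \<le> cost x (p + 3 * d) (- d) (- s)"
      using opt by (intro best ok_rev) auto
    ultimately show False using small by simp
  qed
  show False
  proof (cases "\<exists>i. x i = 0")
    case True
    then obtain u e where e: "e = 1 \<or> e = - 1" and u: "x u = 0" "ok (u - 2 * e) e"
      using zero by blast
    from clash_free[rule_format, OF range[of "u - 2 * e"] range[of "u - e"] range[of "u + e"]]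
    show False
    proof
      assume "\<exists>s\<in>{- 1, 1}. clash (2 * s) (x (u - 2 * e)) + clash (2 * s) (x (u - e)) + clash s 0 + clash s (x (u + e)) \<le> 2"
      then obtain t where t: "t = 1 \<or> t = - 1"
        "clash (2 * t) (x (u - 2 * e)) + clash (2 * t) (x (u - e)) + clash t 0 + clash t (x (u + e)) \<le> 2"
        by blast
      have "cost x (u - 2 * e) e t \<le> 2"
        using t(2) u by (simp add: cost_def algebra_simps)
      then show False using best[OF u(2) e t(1)] not_small by simp
    next
      assume "\<exists>s\<in>{- 1, 1}. clash (2 * s) (x (u + e)) + clash (2 * s) 0 + clash s (x (u - e)) + clash s (x (u - 2 * e)) \<le> 2"
      then obtain t where t: "t = 1 \<or> t = - 1"
        "clash (2 * t) (x (u + e)) + clash (2 * t) 0 + clash t (x (u - e)) + clash t (x (u - 2 * e)) \<le> 2"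
        by blast
      have "cost x (u - 2 * e + 3 * e) (- e) t \<le> 2"
        using t(2) u by (simp add: cost_def algebra_simps)
      moreover have "cost x p d s \<le> cost x (u - 2 * e + 3 * e) (- e) t"
        using e t(1) by (intro best ok_rev u) auto
      ultimately show False using not_small by simp
    qed
  next
    case False
    then have ok: "ok q e" for q e using nonzero by blast
    have vals: "x i \<in> {- 2, - 1, 1, 2}" for i using range[of i] False by auto
    \<comment> \<open>\<open>r i\<close> is the favoured sign: strong \<open>r i\<close> and weak
      \<open>- r i\<close> are free at position \<open>i\<close>. Oddness of the cycle yields two
      neighbours with the same favoured sign.\<close>
    define r where "r i = (if x i = 2 \<or> x i = - 1 then 1 else - 1 :: int)" for i
    have r: "r i = 1 \<or> r i = - 1" for i by (simp add: r_def)
    have xr: "x i = 2 * r i \<or> x i = - r i" for i using vals[of i] by (auto simp: r_def)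
    obtain j where j: "(r j = 1) = (r (j + 1) = 1)"
      using odd_cycle_equal_neighbours[of n "\<lambda>i. r i = 1"] assms(1,2) per by (auto simp: r_def)
    show False
    proof (cases "\<exists>i. r i = r (i + 1) \<and> r (i + 1) \<noteq> r (i + 2)")
      case True
      then obtain i where i: "r i = r (i + 1)" "r (i + 1) \<noteq> r (i + 2)" by blast
      have s: "r i \<in> {- 1, 1}" using r[of i] by auto
      have "r (i + 2) = - r i" using i r[of i] r[of "i + 2"] by auto
      then have "x (i + 2) = - 2 * r i \<or> x (i + 2) = r i" using xr[of "i + 2"] by auto
      moreover have "x (i + 1) = 2 * r i \<or> x (i + 1) = - r i" using xr[of "i + 1"] i(1) by auto
      ultimately have "cost x i 1 (r i) \<le> 2"
        using clash_run_end[rule_format, OF range[of i] range[of "i + 1"] range[of "i + 2"]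
            range[of "i + 3"] s] xr[of i]
        by (simp add: cost_def)
      then show False using best[OF ok, of 1 "r i" i] r[of i] not_small by fastforce
    next
      case False
      define t where "t = r j"
      have t: "t = 1 \<or> t = - 1" using r by (simp add: t_def)
      have up: "r (j + int k) = t \<and> r (j + int k + 1) = t" for k
      proof (induction k)
        case 0
        have "r (j + 1) = r j" using j r[of j] r[of "j + 1"] by auto
        then show ?case by (simp add: t_def)
      next
        case (Suc k)
        have e: "j + int (Suc k) = j + int k + 1" "j + int (Suc k) + 1 = j + int k + 2" by simp_all
        have "r (j + int k + 1) = r (j + int k + 2)" using False Suc.IH by metis
        then show ?case using Suc.IH by (simp only: e) (simp add: algebra_simps)
      qed
      \<comment> \<open>Propagation goes only upwards from \<open>j\<close>; adding a multiple of
        the period reaches the positions below \<open>j\<close>.\<close>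
      have "r i = t" for i
      proof -
        have "1 * \<bar>j - i\<bar> \<le> n * \<bar>j - i\<bar>" using assms(2) by (intro mult_right_mono) auto
        then have ge: "j \<le> i + n * int (nat \<bar>j - i\<bar>)" by simp
        have "r (i + n * int (nat \<bar>j - i\<bar>)) = t"
          using up[of "nat (i + n * int (nat \<bar>j - i\<bar>) - j)"] ge by simp
        moreover have "x (i + n * int (nat \<bar>j - i\<bar>)) = x i" by (rule periodic_multiple) (rule per)
        ultimately show ?thesis by (simp add: r_def)
      qed
      then have xt: "x i = 2 * t \<or> x i = - t" for i using xr[of i] by simp
      have t': "t \<in> {- 1, 1}" using t by auto
      have xt': "x i \<in> {2 * t, - t}" for i using xt by simp
      note u = clash_uniform[rule_format, OF t' xt' xt' xt' xt']
      have "s = - t" using strong opt(3) t u by auto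
      then have ge: "cost x p d s = (if x p = 2 * t then 3 else 2) + (if x (p + d) = 2 * t then 3 else 2)"
        using u by (simp add: cost_def)
      \<comment> \<open>The window of sign \<open>t\<close> is placed so that position
        \<open>i\<close> is its last weak vertex. Taking for \<open>i\<close> either strong vertex
        of the current window yields a strictly cheaper one.\<close>
      have "cost x p d s \<le> cost x (i - 3) 1 t" for i
        using t by (intro best ok) auto
      moreover have "cost x (i - 3) 1 t \<le> 2 + (if x i = 2 * t then 2 else 1)" for i
        using u[of "i - 3" "i - 2" "i - 1" i] by (simp add: cost_def)
      ultimately have "cost x p d s \<le> 2 + (if x i = 2 * t then 2 else 1)" for i
        using le_trans by blast
      from this[of p] this[of "p + d"] show False using ge by (auto split: if_splits)
    qed
  qed
qed

text \<open>\<open>\<nu>\<close> enumerates the vertices of the cycle and \<open>\<mu>\<close> is the matching: a window is blocked if an edge of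
  the matching joins its strong half to its weak half.\<close>

definition blocked :: "(int \<Rightarrow> 'v) \<Rightarrow> ('v \<Rightarrow> 'v) \<Rightarrow> int \<Rightarrow> int \<Rightarrow> bool" where
  "blocked \<nu> \<mu> p d \<longleftrightarrow> \<mu> (\<nu> p) \<in> {\<nu> (p + 2 * d), \<nu> (p + 3 * d)} \<or>
     \<mu> (\<nu> (p + d)) \<in> {\<nu> (p + 2 * d), \<nu> (p + 3 * d)}"

section \<open>Chords of an odd cycle and blocked windows\<close>

lemma blocked_reverse:
  assumes "\<And>v. \<mu> (\<mu> v) = v" "\<not> blocked \<nu> \<mu> q e"
  shows "\<not> blocked \<nu> \<mu> (q + 3 * e) (- e)"
proof -
  have "\<mu> v = w \<longleftrightarrow> \<mu> w = v" for v w using assms(1) by metis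
  then show ?thesis using assms(2) unfolding blocked_def by (auto simp: algebra_simps)
qed

lemma no_small_multiple:
  fixes n :: int
  assumes "odd n" "5 \<le> n"
  shows "\<not> n dvd 1" "\<not> n dvd 2" "\<not> n dvd 3" "\<not> n dvd 4" "\<not> n dvd 6" "n dvd 5 \<Longrightarrow> n = 5"
proof -
  show "\<not> n dvd 1" "\<not> n dvd 2" "\<not> n dvd 3" "\<not> n dvd 4"
    using assms(2) by (auto dest: zdvd_imp_le)
  show "\<not> n dvd 6"
  proof
    assume a: "n dvd 6"
    then have "n = 5 \<or> n = 6" using zdvd_imp_le[OF a] assms(2) by auto
    then show False using a assms(1) by auto
  qed
  show "n = 5" if "n dvd 5" using zdvd_imp_le[OF that] assms(2) by auto
qed

text \<open>Third place is wanted because a chord end receives no outside demand, which is the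
  situation of \<open>clash_free\<close>. If at every chord end \<open>u\<close> both windows with
  \<open>u\<close> in third place are blocked, then chords spanning 1 or 2 steps are impossible, so
  each blocking chord spans exactly 3. Following these from one chord leads to a vertex matched both
  3 steps backwards and 3 steps forwards, whence \<open>n dvd 6\<close>. Chords spanning 2 are where
  the pentagon with two chords has to be excluded by \<open>noH\<close>.\<close>

lemma unblocked_window:
  fixes n :: int and \<nu> :: "int \<Rightarrow> 'v"
  assumes n: "odd n" "5 \<le> n" and \<nu>: "\<And>i j. \<nu> i = \<nu> j \<longleftrightarrow> n dvd i - j"
    and \<mu>: "\<And>v. \<mu> (\<mu> v) = v"
    and noH: "\<And>u. n = 5 \<Longrightarrow> \<mu> (\<nu> u) = \<nu> (u + 2) \<Longrightarrow>
       \<mu> (\<nu> (u + 1)) \<noteq> \<nu> (u + 3) \<and> \<mu> (\<nu> (u + 1)) \<noteq> \<nu> (u + 4)"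
    and chord: "\<mu> (\<nu> i) = \<nu> j" "\<nu> i \<noteq> \<nu> j"
  shows "\<exists>u e. (e = 1 \<or> e = - 1) \<and> \<mu> (\<nu> u) \<in> range \<nu> \<and> \<not> blocked \<nu> \<mu> (u - 2 * e) e"
proof (rule ccontr)
  define m where "m a b \<longleftrightarrow> \<mu> (\<nu> a) = \<nu> b" for a b
  have sym: "m a b \<longleftrightarrow> m b a" for a b using \<mu> unfolding m_def by metis
  have uniq: "n dvd b - c" if "m a b" "m a c" for a b c
    using that \<nu> unfolding m_def by metis
  note nd = no_small_multiple[OF n]
  assume contr: "\<not> ?thesis"
  have fwd: "m (u - 2) u \<or> m (u - 2) (u + 1) \<or> m (u - 1) u \<or> m (u - 1) (u + 1)" if "m u v" for u v
  proof -
    have "blocked \<nu> \<mu> (u - 2 * 1) 1" using contr that unfolding m_def by blast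
    then show ?thesis unfolding blocked_def by (simp add: m_def algebra_simps)
  qed
  have bwd: "m (u + 2) u \<or> m (u + 2) (u - 1) \<or> m (u + 1) u \<or> m (u + 1) (u - 1)" if "m u v" for u v
  proof -
    have "blocked \<nu> \<mu> (u - 2 * - 1) (- 1)" using contr that unfolding m_def by blast
    then show ?thesis unfolding blocked_def by (simp add: m_def algebra_simps)
  qed
  have no1: "\<not> m a (a + 1)" for a
  proof
    assume a: "m a (a + 1)"
    then have b: "m (a + 1) a" using sym by blast
    from fwd[OF a] consider "m a (a - 2)" | "m (a + 1) (a - 2)" | "m a (a - 1)" | "m (a + 1) (a - 1)"
      using sym by blast
    then show False
      by cases (use uniq[OF a] uniq[OF b] nd in force)+
  qed
  have no2: "\<not> m a (a + 2)" for a
  proof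
    assume a: "m a (a + 2)"
    then have b: "m (a + 2) a" using sym by blast
    have "m (a + 1) (a - 2) \<or> m (a + 1) (a - 1)"
    proof -
      from fwd[OF a] consider "m a (a - 2)" | "m (a + 1) (a - 2)" | "m a (a - 1)" | "m (a + 1) (a - 1)"
        using sym by blast
      then show ?thesis by cases (use uniq[OF a] nd in force)+
    qed
    moreover have "m (a + 1) (a + 4) \<or> m (a + 1) (a + 3)"
    proof -
      have "m (a + 2 + 2) (a + 2) \<or> m (a + 2 + 2) (a + 2 - 1) \<or> m (a + 2 + 1) (a + 2) \<or> m (a + 2 + 1) (a + 2 - 1)"
        by (rule bwd[OF b])
      then have "m (a + 2) (a + 4) \<or> m (a + 1) (a + 4) \<or> m (a + 2) (a + 3) \<or> m (a + 1) (a + 3)"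
        using sym by (auto simp: algebra_simps)
      then consider "m (a + 2) (a + 4)" | "m (a + 1) (a + 4)" | "m (a + 2) (a + 3)" | "m (a + 1) (a + 3)"
        by blast
      then show ?thesis by cases (use uniq[OF b] nd in force)+
    qed
    \<comment> \<open>The vertex \<open>a + 1\<close> has one partner among \<open>a - 2\<close>,
      \<open>a - 1\<close> and one among \<open>a + 3\<close>, \<open>a + 4\<close>; these coincide
      modulo \<open>n\<close>.\<close>
    ultimately have "n dvd 6 \<or> n dvd 5 \<or> n dvd 4"
      using uniq[of "a + 1"] by force
    then have "n = 5" using nd by blast
    with noH[of a] a show False using \<open>m (a + 1) (a + 4) \<or> m (a + 1) (a + 3)\<close> unfolding m_def by blast
  qed
  have no1': "\<not> m (a + 1) a" "\<not> m (a + 2) a" for a using no1 no2 sym by blast+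
  have "m i j" using chord by (simp add: m_def)
  from fwd[OF this] have w0: "m (i - 2) (i - 2 + 3)"
    using no1[of "i - 1"] no2[of "i - 2"] no2[of "i - 1"] by (auto simp: algebra_simps)
  define w where "w = i - 2"
  have w: "m w (w + 3)" using w0 by (simp add: w_def)
  have f: "m (w + 1) (w - 2)"
    using fwd[OF w] no1[of "w - 1"] no2[of "w - 2"] no2[of "w - 1"] sym by (auto simp: algebra_simps)
  have g: "m (w + 2) (w - 1)"
    using bwd[OF w] no1'(1)[of "w"] no1'(2)[of "w"] no1'(2)[of "w - 1"] by (auto simp: algebra_simps)
  have "m (w + 2 + 2) (w + 2) \<or> m (w + 2 + 2) (w + 2 - 1) \<or> m (w + 2 + 1) (w + 2) \<or> m (w + 2 + 1) (w + 2 - 1)"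
    by (rule bwd[OF g])
  then have "m (w + 1) (w + 4)"
    using no1'(2)[of "w + 2"] no1'(2)[of "w + 1"] no1'(1)[of "w + 2"] sym by (auto simp: algebra_simps)
  then have "n dvd 6" using uniq[OF f] by force
  then show False using nd by blast
qed

section \<open>Choosing the windows on all odd cycles together\<close>

definition role :: "(int \<Rightarrow> 'v) \<Rightarrow> int \<times> int \<times> int \<Rightarrow> 'v \<Rightarrow> int" where
  "role \<nu> = (\<lambda>(p, d, s) v. if v = \<nu> p \<or> v = \<nu> (p + d) then 2 * s
      else if v = \<nu> (p + 2 * d) \<or> v = \<nu> (p + 3 * d) then s else 0)"

definition options :: "(int \<Rightarrow> 'v) \<Rightarrow> ('v \<Rightarrow> 'v) \<Rightarrow> (int \<times> int \<times> int) set" where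
  "options \<nu> \<mu> = {(p, d, s). (d = 1 \<or> d = - 1) \<and> (s = 1 \<or> s = - 1) \<and> \<not> blocked \<nu> \<mu> p d}"

lemma role_range: "q \<in> options \<nu> \<mu> \<Longrightarrow> role \<nu> q v \<in> {- 2, - 1, 0, 1, 2}"
  by (cases q) (simp add: options_def role_def, metis)

text \<open>An unblocked window has no matching edge between its strong and its weak half, so a
  chord between two window vertices carries equal demands, which never clash.\<close>

lemma role_chord:
  assumes "q \<in> options \<nu> \<mu>" "\<And>v. \<mu> (\<mu> v) = v"
  shows "clash (role \<nu> q v) (role \<nu> q (\<mu> v)) = 0"
proof -
  obtain p d s where q: "q = (p, d, s)" by (cases q) auto
  have s: "s = 1 \<or> s = - 1" and nb: "\<not> blocked \<nu> \<mu> p d" using assms(1) by (auto simp: options_def q)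
  have inv: "\<mu> a = b \<longleftrightarrow> \<mu> b = a" for a b using assms(2) by metis
  show ?thesis
  proof (cases "role \<nu> q v = 0 \<or> role \<nu> q (\<mu> v) = 0")
    case False
    define S where "S = {\<nu> p, \<nu> (p + d)}"
    define W where "W = {\<nu> (p + 2 * d), \<nu> (p + 3 * d)}"
    have r: "role \<nu> q a = (if a \<in> S then 2 * s else if a \<in> W then s else 0)" for a
      by (simp add: role_def q S_def W_def)
    have "\<mu> a \<notin> W" if "a \<in> S" for a
      using nb that unfolding blocked_def S_def W_def by auto
    then have "v \<in> S \<longleftrightarrow> \<mu> v \<in> S" using False inv by (metis r)
    then have "role \<nu> q v = role \<nu> q (\<mu> v)" using False r by metis
    then show ?thesis using s r by (auto simp: clash_def)
  qed auto
qed

lemma sum_role: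
  fixes y :: "'v \<Rightarrow> int" and n :: int
  assumes n: "odd n" "5 \<le> n" and \<nu>: "\<And>i j. \<nu> i = \<nu> j \<longleftrightarrow> n dvd i - j"
    and q: "(p, d, s) \<in> options \<nu> \<mu>" and V: "finite V" "range \<nu> = V"
  shows "(\<Sum>v\<in>V. clash (role \<nu> (p, d, s) v) (y v)) = cost (\<lambda>i. y (\<nu> i)) p d s"
proof -
  note nd = no_small_multiple[OF n]
  have d: "d = 1 \<or> d = - 1" using q by (auto simp: options_def)
  have dist: "\<nu> p \<noteq> \<nu> (p + d)" "\<nu> p \<noteq> \<nu> (p + 2 * d)" "\<nu> p \<noteq> \<nu> (p + 3 * d)"
    "\<nu> (p + d) \<noteq> \<nu> (p + 2 * d)" "\<nu> (p + d) \<noteq> \<nu> (p + 3 * d)" "\<nu> (p + 2 * d) \<noteq> \<nu> (p + 3 * d)"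
    using d nd by (auto simp: \<nu>)
  have "(\<Sum>v\<in>V. clash (role \<nu> (p, d, s) v) (y v)) =
      (\<Sum>v\<in>{\<nu> p, \<nu> (p + d), \<nu> (p + 2 * d), \<nu> (p + 3 * d)}. clash (role \<nu> (p, d, s) v) (y v))"
    using V by (intro sum.mono_neutral_right) (auto simp: role_def)
  also have "\<dots> = cost (\<lambda>i. y (\<nu> i)) p d s"
    using dist by (simp add: role_def cost_def)
  finally show ?thesis .
qed

text \<open>\<open>I\<close> indexes the odd cycles, \<open>\<nu> k\<close> lists the vertices of
  one of them, and \<open>lab\<close> becomes the colour of the matching edge at a vertex. In a
  choice of windows of least energy each window is cheapest against the demands of the others, so
  \<open>best_option_no_strong_clash\<close> applies to every cycle separately. All strong demands
  can then be granted without violating a weak one, and where none is present the label 0 satisfies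
  the weak ones.\<close>

lemma cycle_labelling:
  fixes I :: "'k set" and n :: "'k \<Rightarrow> int" and \<nu> :: "'k \<Rightarrow> int \<Rightarrow> 'v" and \<mu> :: "'v \<Rightarrow> 'v"
  assumes fin: "finite I" and n: "\<And>k. k \<in> I \<Longrightarrow> odd (n k) \<and> 5 \<le> n k"
    and \<nu>: "\<And>k i j. k \<in> I \<Longrightarrow> \<nu> k i = \<nu> k j \<longleftrightarrow> n k dvd i - j"
    and disj: "\<And>k l i j. k \<in> I \<Longrightarrow> l \<in> I \<Longrightarrow> \<nu> k i = \<nu> l j \<Longrightarrow> k = l"
    and \<mu>: "\<And>v. \<mu> (\<mu> v) = v"
    and noH: "\<And>k u. k \<in> I \<Longrightarrow> n k = 5 \<Longrightarrow> \<mu> (\<nu> k u) = \<nu> k (u + 2) \<Longrightarrow>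
       \<mu> (\<nu> k (u + 1)) \<noteq> \<nu> k (u + 3) \<and> \<mu> (\<nu> k (u + 1)) \<noteq> \<nu> k (u + 4)"
  obtains lab where "\<And>v. lab v \<in> {- 1, 0, 1 :: int}" "\<And>v. lab (\<mu> v) = lab v"
    "\<And>k. k \<in> I \<Longrightarrow> \<exists>p d s. (d = 1 \<or> d = - 1) \<and> (s = 1 \<or> s = - 1) \<and>
       lab (\<nu> k p) = s \<and> lab (\<nu> k (p + d)) = s \<and>
       lab (\<nu> k (p + 2 * d)) \<noteq> s \<and> lab (\<nu> k (p + 3 * d)) \<noteq> s"
proof -
  define V where "V k = range (\<nu> k)" for k
  define W where "W = (\<Union>k\<in>I. V k)"
  define Opt where "Opt k = options (\<nu> k) \<mu>" for k
  have V_eq: "V k = \<nu> k ` {0..<n k}" if "k \<in> I" for k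
  proof -
    have "\<nu> k i = \<nu> k (i mod n k)" for i
      using \<nu>[OF that] by (simp add: minus_mod_eq_mult_div)
    moreover have "i mod n k \<in> {0..<n k}" for i using n[OF that] by simp
    ultimately show ?thesis unfolding V_def by blast
  qed
  have finV: "finite (V k)" if "k \<in> I" for k using V_eq[OF that] by simp
  have finW: "finite W" using fin finV by (simp add: W_def)
  have V_disj: "k = l" if "v \<in> V k" "v \<in> V l" "k \<in> I" "l \<in> I" for v k l
    using that disj unfolding V_def by blast
  define \<kappa> where "\<kappa> v = (THE k. k \<in> I \<and> v \<in> V k)" for v
  have \<kappa>: "\<kappa> v = k" if "v \<in> V k" "k \<in> I" for v k
    unfolding \<kappa>_def using that V_disj by blast
  define \<rho> where "\<rho> c v = (if v \<in> W then role (\<nu> (\<kappa> v)) (c (\<kappa> v)) v else 0)" for c v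
  have \<rho>_in: "\<rho> c v = role (\<nu> k) (c k) v" if "v \<in> V k" "k \<in> I" for c v k
    using that \<kappa>[OF that] by (auto simp: \<rho>_def W_def)
  have \<rho>_out: "\<rho> (c(k := q)) v = \<rho> c v" if "v \<notin> V k" "k \<in> I" for c v k q
  proof (cases "v \<in> W")
    case True
    then obtain l where l: "l \<in> I" "v \<in> V l" by (auto simp: W_def)
    then have "l \<noteq> k" using that by blast
    then show ?thesis using l by (simp add: \<rho>_in)
  qed (simp add: \<rho>_def)
  define E where "E c = (\<Sum>v\<in>W. clash (\<rho> c v) (\<rho> c (\<mu> v)))" for c
  define y where "y c k v = (if \<mu> v \<in> V k then 0 else \<rho> c (\<mu> v))" for c k v
  have inv: "\<mu> a = b \<longleftrightarrow> \<mu> b = a" for a b using \<mu> by metis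
  \<comment> \<open>Only the part of the energy seen from cycle \<open>k\<close> varies with its
    window. Matching edges to other cycles are counted from both ends, hence the factor 2, while
    \<open>y\<close> may be set to 0 on chords because an unblocked window has no clash
    there.\<close>
  have energy: "E (c(k := q)) = (\<Sum>v\<in>{v \<in> W - V k. \<mu> v \<notin> V k}. clash (\<rho> c v) (\<rho> c (\<mu> v)))
      + 2 * (\<Sum>v\<in>V k. clash (role (\<nu> k) q v) (y c k v))"
    if k: "k \<in> I" and q: "q \<in> Opt k" for c k q
  proof -
    define c' where "c' = c(k := q)"
    define f where "f v = clash (\<rho> c' v) (\<rho> c' (\<mu> v))" for v
    define g where "g v = clash (role (\<nu> k) q v) (y c k v)" for v
    have VW: "V k \<subseteq> W" using k by (auto simp: W_def)
    have fV: "f v = g v" if v: "v \<in> V k" for v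
    proof (cases "\<mu> v \<in> V k")
      case True
      then show ?thesis
        using q role_chord[of q "\<nu> k" \<mu> v] \<mu> v k by (simp add: f_def g_def y_def c'_def \<rho>_in Opt_def)
    next
      case False
      then show ?thesis using v k by (simp add: f_def g_def y_def c'_def \<rho>_in \<rho>_out)
    qed
    have fC: "f v = clash (\<rho> c v) (\<rho> c (\<mu> v))" if "v \<notin> V k" "\<mu> v \<notin> V k" for v
      using that k by (simp add: f_def c'_def \<rho>_out)
    have "(\<Sum>v\<in>{v \<in> W - V k. \<mu> v \<in> V k}. f v) = (\<Sum>v\<in>{v \<in> V k. \<mu> v \<in> W - V k}. g v)"
    proof (rule sum.reindex_bij_witness[where i = \<mu> and j = \<mu>])
      fix v assume "v \<in> {v \<in> W - V k. \<mu> v \<in> V k}"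
      then show "g (\<mu> v) = f v"
        using k \<rho>_in[of "\<mu> v" k c'] by (simp add: f_def g_def y_def c'_def \<rho>_out \<mu> clash_commute)
    qed (auto simp: \<mu>)
    \<comment> \<open>The remaining vertices of the cycle have their partners on the cycle itself or
      off all cycles; neither kind contributes a demand to \<open>y\<close>.\<close>
    also have "\<dots> = (\<Sum>v\<in>V k. g v)"
      by (rule sum.mono_neutral_left) (use finV[OF k] in \<open>auto simp: g_def y_def \<rho>_def\<close>)
    finally have B: "(\<Sum>v\<in>{v \<in> W - V k. \<mu> v \<in> V k}. f v) = (\<Sum>v\<in>V k. g v)" .
    have "W = V k \<union> ({v \<in> W - V k. \<mu> v \<in> V k} \<union> {v \<in> W - V k. \<mu> v \<notin> V k})" using VW by auto
    then have "E c' = (\<Sum>v\<in>V k \<union> ({v \<in> W - V k. \<mu> v \<in> V k} \<union> {v \<in> W - V k. \<mu> v \<notin> V k}). f v)"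
      unfolding E_def f_def by simp
    also have "\<dots> = (\<Sum>v\<in>V k. f v) + ((\<Sum>v\<in>{v \<in> W - V k. \<mu> v \<in> V k}. f v)
        + (\<Sum>v\<in>{v \<in> W - V k. \<mu> v \<notin> V k}. f v))"
    proof -
      have "(\<Sum>v\<in>{v \<in> W - V k. \<mu> v \<in> V k} \<union> {v \<in> W - V k. \<mu> v \<notin> V k}. f v)
        = (\<Sum>v\<in>{v \<in> W - V k. \<mu> v \<in> V k}. f v) + (\<Sum>v\<in>{v \<in> W - V k. \<mu> v \<notin> V k}. f v)"
        by (rule sum.union_disjoint) (use finW in auto)
      moreover have "(\<Sum>v\<in>V k \<union> ({v \<in> W - V k. \<mu> v \<in> V k} \<union> {v \<in> W - V k. \<mu> v \<notin> V k}). f v)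
        = (\<Sum>v\<in>V k. f v) + (\<Sum>v\<in>{v \<in> W - V k. \<mu> v \<in> V k} \<union> {v \<in> W - V k. \<mu> v \<notin> V k}. f v)"
        by (rule sum.union_disjoint) (use finW finV[OF k] in auto)
      ultimately show ?thesis by simp
    qed
    also have "(\<Sum>v\<in>V k. f v) = (\<Sum>v\<in>V k. g v)" by (rule sum.cong) (auto simp: fV)
    also have "(\<Sum>v\<in>{v \<in> W - V k. \<mu> v \<notin> V k}. f v)
        = (\<Sum>v\<in>{v \<in> W - V k. \<mu> v \<notin> V k}. clash (\<rho> c v) (\<rho> c (\<mu> v)))"
      by (rule sum.cong) (auto simp: fC)
    finally show ?thesis unfolding B g_def c'_def[symmetric] by simp
  qed
  have window: "\<exists>u e. (e = 1 \<or> e = - 1) \<and> \<mu> (\<nu> k u) \<in> V k \<and> \<not> blocked (\<nu> k) \<mu> (u - 2 * e) e"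
    if k: "k \<in> I" and ij: "\<mu> (\<nu> k i) = \<nu> k j" "\<nu> k i \<noteq> \<nu> k j" for k i j
    unfolding V_def
    by (rule unblocked_window[of "n k" "\<nu> k" \<mu>, OF _ _ \<nu>[OF k] \<mu> noH[OF k] ij])
      (use n[OF k] in auto)
  have block_chord: "\<exists>i j. \<mu> (\<nu> k i) = \<nu> k j \<and> \<nu> k i \<noteq> \<nu> k j"
    if k: "k \<in> I" and b: "blocked (\<nu> k) \<mu> p d" and d: "d = 1 \<or> d = - 1" for k p d
  proof -
    note nd = no_small_multiple[OF conjunct1[OF n[OF k]] conjunct2[OF n[OF k]]]
    have "\<nu> k p \<noteq> \<nu> k (p + 2 * d)" "\<nu> k p \<noteq> \<nu> k (p + 3 * d)"
      "\<nu> k (p + d) \<noteq> \<nu> k (p + 2 * d)" "\<nu> k (p + d) \<noteq> \<nu> k (p + 3 * d)"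
      using d nd by (auto simp: \<nu>[OF k])
    then show ?thesis using b unfolding blocked_def by blast
  qed
  have ex: "\<exists>q. q \<in> Opt k" if k: "k \<in> I" for k
  proof (cases "blocked (\<nu> k) \<mu> 0 1")
    case True
    then obtain i j where "\<mu> (\<nu> k i) = \<nu> k j" "\<nu> k i \<noteq> \<nu> k j"
      using block_chord[OF k, of 0 1] by auto
    from window[OF k this] obtain u e where "e = 1 \<or> e = - 1" "\<not> blocked (\<nu> k) \<mu> (u - 2 * e) e"
      by blast
    then have "(u - 2 * e, e, 1) \<in> Opt k" by (auto simp: Opt_def options_def)
    then show ?thesis by blast
  next
    case False
    then have "(0, 1, 1) \<in> Opt k" by (auto simp: Opt_def options_def)
    then show ?thesis by blast
  qed
  then have "\<exists>c. \<forall>k\<in>I. c k \<in> Opt k" by metis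
  then obtain c where c: "\<forall>k\<in>I. c k \<in> Opt k" and cmin: "\<And>c'. \<forall>k\<in>I. c' k \<in> Opt k \<Longrightarrow> E c \<le> E c'"
    using ex_has_least_nat[of "\<lambda>c. \<forall>k\<in>I. c k \<in> Opt k" _ E] by blast
  have no_clash: "clash (\<rho> c v) (\<rho> c (\<mu> v)) = 0" if k: "k \<in> I" and v: "v \<in> V k" and a: "\<bar>\<rho> c v\<bar> = 2" for k v
  proof (cases "\<mu> v \<in> V k")
    case True
    then show ?thesis using role_chord[of "c k" "\<nu> k" \<mu> v] c k v \<mu> by (simp add: \<rho>_in Opt_def)
  next
    case False
    obtain p d s where q: "c k = (p, d, s)" by (cases "c k") auto
    have opt: "(p, d, s) \<in> Opt k" using c k q by force
    then have pds: "d = 1 \<or> d = - 1" "s = 1 \<or> s = - 1" "\<not> blocked (\<nu> k) \<mu> p d"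
      by (auto simp: Opt_def options_def)
    define x where "x i = y c k (\<nu> k i)" for i
    note nk = conjunct1[OF n[OF k]] conjunct2[OF n[OF k]]
    have cost: "(\<Sum>v\<in>V k. clash (role (\<nu> k) (p', d', s') v) (y c k v)) = cost x p' d' s'"
      if "(p', d', s') \<in> Opt k" for p' d' s'
      unfolding x_def
      by (rule sum_role[OF nk \<nu>[OF k]]) (use that finV[OF k] in \<open>auto simp: Opt_def V_def\<close>)
    have "c = c(k := (p, d, s))" using q by auto
    have best: "cost x p d s \<le> cost x p' d' s'" if t: "(p', d', s') \<in> Opt k" for p' d' s'
    proof -
      have "E c \<le> E (c(k := (p', d', s')))" by (rule cmin) (use c t in auto)
      moreover have "E c = E (c(k := (p, d, s)))" using \<open>c = c(k := (p, d, s))\<close> by simp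
      ultimately show ?thesis using energy[OF k opt, of c] energy[OF k t, of c] cost[OF opt] cost[OF t] by simp
    qed
    have "clash (2 * s) (x p) = 0 \<and> clash (2 * s) (x (p + d)) = 0"
    proof (rule best_option_no_strong_clash[where n = "n k" and ok = "\<lambda>q e. \<not> blocked (\<nu> k) \<mu> q e"])
      show "odd (n k)" "0 < n k" using nk by auto
      show "x i \<in> {- 2, - 1, 0, 1, 2}" for i
      proof (cases "\<exists>l\<in>I. \<mu> (\<nu> k i) \<in> V l")
        case True
        then obtain l where "l \<in> I" "\<mu> (\<nu> k i) \<in> V l" by blast
        then show ?thesis using c role_range[of "c l" "\<nu> l" \<mu>] by (auto simp: x_def y_def \<rho>_in Opt_def)
      next
        case False
        then show ?thesis by (auto simp: x_def y_def \<rho>_def W_def)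
      qed
      show "x (i + n k) = x i" for i
        using \<nu>[OF k, of "i + n k" i] by (simp add: x_def)
      show "\<not> blocked (\<nu> k) \<mu> (q + 3 * e) (- e)" if "\<not> blocked (\<nu> k) \<mu> q e" for q e
        using blocked_reverse[OF \<mu> that] .
      show "\<exists>u e. (e = 1 \<or> e = - 1) \<and> x u = 0 \<and> \<not> blocked (\<nu> k) \<mu> (u - 2 * e) e" if "x i = 0" for i
      proof (cases "blocked (\<nu> k) \<mu> (i - 2 * 1) 1")
        case True
        then obtain i j where "\<mu> (\<nu> k i) = \<nu> k j" "\<nu> k i \<noteq> \<nu> k j"
          using block_chord[OF k, of "i - 2 * 1" 1] by auto
        from window[OF k this] obtain u e where
          "e = 1 \<or> e = - 1" "\<mu> (\<nu> k u) \<in> V k" "\<not> blocked (\<nu> k) \<mu> (u - 2 * e) e"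
          by blast
        then show ?thesis by (auto simp: x_def y_def)
      next
        case False
        then show ?thesis using that by blast
      qed
      show "\<not> blocked (\<nu> k) \<mu> q e" if "\<And>i. x i \<noteq> 0" for q e
      proof
        assume "blocked (\<nu> k) \<mu> q e"
        then have "\<mu> (\<nu> k q) \<in> V k \<or> \<mu> (\<nu> k (q + e)) \<in> V k"
          unfolding blocked_def V_def by auto
        then show False using that[of q] that[of "q + e"] by (auto simp: x_def y_def)
      qed
      show "cost x p d s \<le> cost x q e t"
        if "\<not> blocked (\<nu> k) \<mu> q e" "e = 1 \<or> e = - 1" "t = 1 \<or> t = - 1" for q e t
        using that by (intro best) (auto simp: Opt_def options_def)
    qed (use pds in auto)
    moreover have "\<rho> c v = role (\<nu> k) (p, d, s) v" using v k q by (simp add: \<rho>_in)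
    with a pds(2) have "v = \<nu> k p \<or> v = \<nu> k (p + d)" "\<rho> c v = 2 * s"
      by (auto simp: role_def split: if_splits)
    ultimately show ?thesis using False by (auto simp: x_def y_def)
  qed
  have val: "\<rho> c v \<in> {- 2, - 1, 0, 1, 2}" for v
  proof (cases "v \<in> W")
    case True
    then obtain l where "l \<in> I" "v \<in> V l" by (auto simp: W_def)
    then show ?thesis using c role_range[of "c l" "\<nu> l" \<mu>] by (auto simp: \<rho>_in Opt_def)
  qed (simp add: \<rho>_def)
  have key: "clash (\<rho> c v) (\<rho> c (\<mu> v)) = 0" if "\<bar>\<rho> c v\<bar> = 2" for v
  proof -
    have "v \<in> W" using that by (auto simp: \<rho>_def split: if_splits)
    then show ?thesis using no_clash that by (auto simp: W_def)
  qed
  \<comment> \<open>Strong demands decide. By \<open>key\<close> two strong demands at the ends of a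
    matching edge agree, so both ends yield the same label, and a strong demand never faces a weak
    one of the same sign.\<close>
  define lab where "lab v = (if \<bar>\<rho> c v\<bar> = 2 then \<rho> c v div 2
      else if \<bar>\<rho> c (\<mu> v)\<bar> = 2 then \<rho> c (\<mu> v) div 2 else 0)" for v
  show thesis
  proof
    show "lab v \<in> {- 1, 0, 1}" for v
      using val[of v] val[of "\<mu> v"] by (auto simp: lab_def)
    show "lab (\<mu> v) = lab v" for v
      using val[of v] val[of "\<mu> v"] key[of v] by (auto simp: lab_def \<mu> clash_def)
    show "\<exists>p d s. (d = 1 \<or> d = - 1) \<and> (s = 1 \<or> s = - 1) \<and>
       lab (\<nu> k p) = s \<and> lab (\<nu> k (p + d)) = s \<and>
       lab (\<nu> k (p + 2 * d)) \<noteq> s \<and> lab (\<nu> k (p + 3 * d)) \<noteq> s" if k: "k \<in> I" for k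
    proof -
      obtain p d s where q: "c k = (p, d, s)" by (cases "c k") auto
      have "(p, d, s) \<in> Opt k" using c k q by force
      then have pds: "d = 1 \<or> d = - 1" "s = 1 \<or> s = - 1" by (auto simp: Opt_def options_def)
      note nd = no_small_multiple[OF conjunct1[OF n[OF k]] conjunct2[OF n[OF k]]]
      have \<rho>k: "\<rho> c (\<nu> k i) = role (\<nu> k) (p, d, s) (\<nu> k i)" for i
        using \<rho>_in[of "\<nu> k i" k c] k q by (simp add: V_def)
      have st: "\<rho> c (\<nu> k p) = 2 * s" "\<rho> c (\<nu> k (p + d)) = 2 * s"
        by (auto simp: \<rho>k role_def)
      have wk: "\<rho> c (\<nu> k (p + 2 * d)) = s" "\<rho> c (\<nu> k (p + 3 * d)) = s"
        using pds nd by (auto simp: \<rho>k role_def \<nu>[OF k])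
      have "lab v \<noteq> s" if "\<rho> c v = s" for v
        using that pds(2) key[of "\<mu> v"] val[of "\<mu> v"] by (auto simp: lab_def \<mu> clash_def)
      then have "lab (\<nu> k (p + 2 * d)) \<noteq> s" "lab (\<nu> k (p + 3 * d)) \<noteq> s" using wk by auto
      moreover have "lab (\<nu> k p) = s" "lab (\<nu> k (p + d)) = s" using st pds(2) by (auto simp: lab_def)
      ultimately show ?thesis using pds by blast
    qed
  qed
qed

section \<open>Colourings of line graphs\<close>

definition adjacent :: "('e \<Rightarrow> 'v set) \<Rightarrow> 'e \<Rightarrow> 'e \<Rightarrow> bool" where
  "adjacent en e f \<longleftrightarrow> e \<noteq> f \<and> en e \<inter> en f \<noteq> {}"

lemma adjacent_commute: "adjacent en e f \<longleftrightarrow> adjacent en f e"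
  by (auto simp: adjacent_def)

lemma pq_coloring_line_graph:
  "pq_coloring p q (line_graph G) f \<longleftrightarrow> (\<forall>e\<in>edges G. f e < p) \<and>
     (\<forall>e\<in>edges G. \<forall>e'\<in>edges G. adjacent (ends G) e e' \<longrightarrow>
        int q \<le> \<bar>int (f e) - int (f e')\<bar> \<and> \<bar>int (f e) - int (f e')\<bar> \<le> int p - int q)"
    (is "?L \<longleftrightarrow> ?R")
proof
  assume L: ?L
  show ?R
  proof (intro conjI ballI impI)
    fix e e' assume *: "e \<in> edges G" "e' \<in> edges G" "adjacent (ends G) e e'"
    then have "{e, e'} \<in> edges (line_graph G)" unfolding line_graph_def adjacent_def by auto
    then show "int q \<le> \<bar>int (f e) - int (f e')\<bar>" "\<bar>int (f e) - int (f e')\<bar> \<le> int p - int q"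
      using L unfolding pq_coloring_def by (auto simp: line_graph_def)
  qed (use L in \<open>auto simp: pq_coloring_def line_graph_def\<close>)
next
  assume R: ?R
  show ?L unfolding pq_coloring_def
  proof (intro conjI ballI allI impI)
    fix d x y assume d: "d \<in> edges (line_graph G)" "ends (line_graph G) d = {x, y}"
    then have "x \<in> edges G" "y \<in> edges G" "adjacent (ends G) x y"
      by (auto simp: line_graph_def adjacent_def doubleton_eq_iff)
    then show "int q \<le> \<bar>int (f x) - int (f y)\<bar>" "\<bar>int (f x) - int (f y)\<bar> \<le> int p - int q"
      using R by auto
  qed (use R in \<open>auto simp: line_graph_def\<close>)
qed

section \<open>Lower bounds from separated colours\<close>

lemma four_separated:
  fixes a b c d p q :: int
  assumes "q \<le> \<bar>a - b\<bar>" "\<bar>a - b\<bar> \<le> p - q" "q \<le> \<bar>a - c\<bar>" "\<bar>a - c\<bar> \<le> p - q"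
    "q \<le> \<bar>a - d\<bar>" "\<bar>a - d\<bar> \<le> p - q" "q \<le> \<bar>b - c\<bar>" "\<bar>b - c\<bar> \<le> p - q"
    "q \<le> \<bar>b - d\<bar>" "\<bar>b - d\<bar> \<le> p - q" "q \<le> \<bar>c - d\<bar>" "\<bar>c - d\<bar> \<le> p - q"
  shows "4 * q \<le> p"
  using assms by (auto simp: abs_if split: if_splits)

text \<open>The difference of the residues is \<open>x - y + p * k\<close> with \<open>k\<close> in
  -1, 0, 1, and a nonzero \<open>k\<close> merely replaces the distance by its complement in
  \<open>p\<close>, which the two bounds treat alike.\<close>

lemma separated_shift:
  fixes x y t p q :: int
  assumes "0 \<le> x" "x < p" "0 \<le> y" "y < p" "q \<le> \<bar>x - y\<bar>" "\<bar>x - y\<bar> \<le> p - q"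
  shows "q \<le> \<bar>(x - t) mod p - (y - t) mod p\<bar> \<and> \<bar>(x - t) mod p - (y - t) mod p\<bar> \<le> p - q"
proof -
  define a where "a = (x - t) mod p"
  define b where "b = (y - t) mod p"
  have ab: "0 \<le> a" "a < p" "0 \<le> b" "b < p" using assms by (auto simp: a_def b_def)
  have "a - b = x - y + p * ((y - t) div p - (x - t) div p)"
    by (simp add: a_def b_def minus_div_mult_eq_mod[symmetric] algebra_simps)
  then obtain k where k: "a - b = x - y + p * k" by blast
  have "k < 2"
  proof (rule ccontr)
    assume "\<not> k < 2"
    then have "p * 2 \<le> p * k" using ab by (intro mult_left_mono) auto
    then show False using k ab assms by linarith
  qed
  moreover have "- 2 < k"
  proof (rule ccontr)
    assume "\<not> - 2 < k"
    then have "p * k \<le> p * (- 2)" using ab by (intro mult_left_mono) auto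
    then show False using k ab assms by linarith
  qed
  ultimately have "k = - 1 \<or> k = 0 \<or> k = 1" by auto
  then show ?thesis unfolding a_def[symmetric] b_def[symmetric]
    using k ab assms by (auto simp: abs_if split: if_splits)
qed

text \<open>Rotate so that \<open>cd\<close> gets colour 0: then the four edges between \<open>{a, b}\<close> and \<open>{c, d}\<close> lie in an
  interval shorter than \<open>2 * q\<close> and alternate between its lower and its upper part.\<close>

lemma subdivided_K4_separated:
  fixes xa xb ac ad bc bd cd p q :: int
  assumes range: "\<forall>x\<in>{xa, xb, ac, ad, bc, bd, cd}. 0 \<le> x \<and> x < p"
    and sep: "\<forall>(x, y)\<in>{(xa, xb), (xa, ac), (xa, ad), (ac, ad), (xb, bc), (xb, bd), (bc, bd), (ac, bc),
      (ac, cd), (bc, cd), (ad, bd), (ad, cd), (bd, cd)}. q \<le> \<bar>x - y\<bar> \<and> \<bar>x - y\<bar> \<le> p - q"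
  shows "4 * q \<le> p"
proof (rule ccontr)
  assume less: "\<not> 4 * q \<le> p"
  define g where "g x = (x - cd) mod p" for x
  have p: "0 < p" using range by force
  have g: "0 \<le> g x" "g x < p" for x using p by (auto simp: g_def)
  have gsep: "q \<le> \<bar>g x - g y\<bar> \<and> \<bar>g x - g y\<bar> \<le> p - q"
    if "q \<le> \<bar>x - y\<bar>" "\<bar>x - y\<bar> \<le> p - q" "0 \<le> x" "x < p" "0 \<le> y" "y < p" for x y
    unfolding g_def using that by (intro separated_shift)
  have g0: "g cd = 0" by (simp add: g_def)
  have q: "0 < q"
  proof (rule ccontr)
    assume "\<not> 0 < q"
    then show False using less p by simp
  qed
  have mid: "q \<le> g x \<and> g x \<le> p - q" if "x \<in> {ac, ad, bc, bd}" for x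
    using that gsep[of x cd] range sep g0 g[of x] by auto
  have alt: "g x \<le> p - 2 * q \<and> 2 * q \<le> g y \<and> q \<le> g y - g x \<or> g y \<le> p - 2 * q \<and> 2 * q \<le> g x \<and> q \<le> g x - g y"
    if "x \<in> {ac, ad, bc, bd}" "y \<in> {ac, ad, bc, bd}" "q \<le> \<bar>g x - g y\<bar>" for x y
    using mid[OF that(1)] mid[OF that(2)] that(3) by (auto simp: abs_if split: if_splits)
  have "q \<le> \<bar>g ac - g ad\<bar>" "q \<le> \<bar>g bc - g bd\<bar>" "q \<le> \<bar>g ac - g bc\<bar>" "q \<le> \<bar>g ad - g bd\<bar>"
    using range sep by (auto intro!: gsep[THEN conjunct1])
  then have alts: "g ac \<le> p - 2 * q \<and> 2 * q \<le> g ad \<and> q \<le> g ad - g ac \<or> g ad \<le> p - 2 * q \<and> 2 * q \<le> g ac \<and> q \<le> g ac - g ad"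
    "g bc \<le> p - 2 * q \<and> 2 * q \<le> g bd \<and> q \<le> g bd - g bc \<or> g bd \<le> p - 2 * q \<and> 2 * q \<le> g bc \<and> q \<le> g bc - g bd"
    "g ac \<le> p - 2 * q \<and> 2 * q \<le> g bc \<and> q \<le> g bc - g ac \<or> g bc \<le> p - 2 * q \<and> 2 * q \<le> g ac \<and> q \<le> g ac - g bc"
    "g ad \<le> p - 2 * q \<and> 2 * q \<le> g bd \<and> q \<le> g bd - g ad \<or> g bd \<le> p - 2 * q \<and> 2 * q \<le> g ad \<and> q \<le> g ad - g bd"
    by (intro alt; simp)+
  \<comment> \<open>Here \<open>l\<close>, \<open>h\<close> are the lower and upper colour at
    \<open>a\<close>, and \<open>l'\<close>, \<open>h'\<close> those at \<open>b\<close>. As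
    \<open>h - l\<close> is below \<open>2 * q\<close>, the colour \<open>x\<close> cannot fit
    between them and lies below \<open>l\<close> or above \<open>h\<close> by at least
    \<open>q\<close>; likewise \<open>y\<close>. On the same side \<open>x\<close> and
    \<open>y\<close> are closer than \<open>q\<close>; on opposite sides they are at least
    \<open>3 * q\<close> apart, which exceeds \<open>p - q\<close>.\<close>
  have contr: False
    if "q \<le> h - l" "q \<le> h' - l" "q \<le> h - l'" "q \<le> h' - l'" "l \<le> p - 2 * q" "l' \<le> p - 2 * q"
      "2 * q \<le> h" "2 * q \<le> h'" "h \<le> p - q" "h' \<le> p - q" "q \<le> l" "q \<le> l'"
      "0 \<le> x" "x < p" "0 \<le> y" "y < p" "q \<le> \<bar>x - y\<bar>" "\<bar>x - y\<bar> \<le> p - q"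
      "q \<le> \<bar>x - l\<bar>" "q \<le> \<bar>x - h\<bar>" "q \<le> \<bar>y - l'\<bar>" "q \<le> \<bar>y - h'\<bar>" for l l' h h' x y
  proof -
    have "x \<le> l - q \<or> h + q \<le> x" "y \<le> l' - q \<or> h' + q \<le> y"
      using that less by (auto simp: abs_if split: if_splits)
    moreover have "y - x \<le> p - q" "x - y \<le> p - q" "q \<le> x - y \<or> q \<le> y - x"
      using that(17,18) by arith+
    ultimately show False using that(1-16) less q by linarith
  qed
  have xs: "q \<le> \<bar>g xa - g xb\<bar>" "q \<le> \<bar>g xa - g ac\<bar>" "q \<le> \<bar>g xa - g ad\<bar>"
    "q \<le> \<bar>g xb - g bc\<bar>" "q \<le> \<bar>g xb - g bd\<bar>" "\<bar>g xa - g xb\<bar> \<le> p - q"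
    using range sep by (auto intro!: gsep[THEN conjunct1] gsep[THEN conjunct2])
  have m: "q \<le> g ac" "g ac \<le> p - q" "q \<le> g ad" "g ad \<le> p - q" "q \<le> g bc" "g bc \<le> p - q"
    "q \<le> g bd" "g bd \<le> p - q"
    using mid by auto
  have "g ac \<le> p - 2 * q \<or> g ad \<le> p - 2 * q" using alts(1) by auto
  then show False
  proof
    assume "g ac \<le> p - 2 * q"
    then have "g bc \<ge> 2 * q" "g ad \<ge> 2 * q" "g bd \<le> p - 2 * q"
      "q \<le> g ad - g ac" "q \<le> g bc - g ac" "q \<le> g ad - g bd" "q \<le> g bc - g bd"
      using alts less by linarith+
    then show False using xs m g \<open>g ac \<le> p - 2 * q\<close>
      by (intro contr[of "g ad" "g ac" "g bc" "g bd" "g xa" "g xb"]) auto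
  next
    assume "g ad \<le> p - 2 * q"
    then have "g bc \<le> p - 2 * q" "g ac \<ge> 2 * q" "g bd \<ge> 2 * q"
      "q \<le> g ac - g ad" "q \<le> g bd - g ad" "q \<le> g ac - g bc" "q \<le> g bd - g bc"
      using alts less by linarith+
    then show False using xs m g \<open>g ad \<le> p - 2 * q\<close>
      by (intro contr[of "g ac" "g ad" "g bd" "g bc" "g xa" "g xb"]) auto
  qed
qed

text \<open>Circular distance at least 3 between residues modulo 11. Colours are arbitrary integers,
  so that they can be translated and negated freely; residues are taken only at the end.\<close>

definition far :: "int \<Rightarrow> int \<Rightarrow> bool" where
  "far x y \<longleftrightarrow> (x - y) mod 11 \<in> {3..8}"

lemma far_commute: "far x y \<longleftrightarrow> far y x"
proof -
  have "(y - x) mod 11 = (if (x - y) mod 11 = 0 then 0 else 11 - (x - y) mod 11)"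
    using zmod_zminus1_eq_if[of "x - y" 11] by simp
  then show ?thesis by (auto simp: far_def)
qed

lemma far_shift: "far (x + t) (y + t) \<longleftrightarrow> far x y"
  by (simp add: far_def)

lemma far_residues:
  assumes "far x y"
  shows "3 \<le> \<bar>x mod 11 - y mod 11\<bar> \<and> \<bar>x mod 11 - y mod 11\<bar> \<le> 8"
proof -
  define a where "a = x mod 11"
  define b where "b = y mod 11"
  have ab: "0 \<le> a" "a < 11" "0 \<le> b" "b < 11" by (auto simp: a_def b_def)
  have "(x - y) mod 11 = (a - b) mod 11" by (simp add: a_def b_def mod_diff_eq)
  also have "\<dots> = (if b \<le> a then a - b else a - b + 11)"
  proof (cases "b \<le> a")
    case True
    then show ?thesis using ab by (simp add: mod_pos_pos_trivial)
  next
    case False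
    have "(a - b) mod 11 = (a - b + 11) mod 11" by simp
    also have "\<dots> = a - b + 11" using ab False by (intro mod_pos_pos_trivial) auto
    finally show ?thesis using False by simp
  qed
  finally show ?thesis using assms by (auto simp: far_def a_def[symmetric] b_def[symmetric] split: if_splits)
qed

text \<open>Each of \<open>x\<close>, \<open>y\<close> rules out five residues, those at distance at
  most 2, so at least one of the eleven remains.\<close>

lemma far_from_two: "\<exists>z. far z x \<and> far z y"
proof -
  define d where "d = (x - y) mod 11"
  have d: "0 \<le> d" "d < 11" by (auto simp: d_def)
  have e: "(x + t - y) mod 11 = (t + d) mod 11" for t
    by (simp add: d_def mod_add_right_eq algebra_simps)
  show ?thesis
  proof (cases "d \<le> 5")
    case True
    then have "far (x + 3) y" using d by (simp add: far_def e)
    then show ?thesis by (intro exI[of _ "x + 3"]) (simp add: far_def)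
  next
    case False
    have "(8 + d) mod 11 = (d - 3) mod 11" using mod_add_self2[of "d - 3" 11] by (simp add: algebra_simps)
    then have "far (x + 8) y" using False d by (simp add: far_def e)
    then show ?thesis by (intro exI[of _ "x + 8"]) (simp add: far_def)
  qed
qed

section \<open>Maximum matchings\<close>

lemma even_card_involution:
  assumes "finite S" "\<And>x. x \<in> S \<Longrightarrow> \<pi> x \<in> S \<and> \<pi> (\<pi> x) = x \<and> \<pi> x \<noteq> x"
  shows "even (card S)"
  using assms
proof (induction "card S" arbitrary: S rule: less_induct)
  case less
  show ?case
  proof (cases "S = {}")
    case False
    then obtain x where x: "x \<in> S" by blast
    have px: "\<pi> x \<in> S" "\<pi> x \<noteq> x" using less.prems(2)[OF x] by auto
    define S' where "S' = S - {x, \<pi> x}"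
    have c: "card S = card S' + 2"
    proof -
      have "card {x, \<pi> x} = 2" using px by auto
      moreover have "card S' = card S - card {x, \<pi> x}"
        unfolding S'_def using x px by (intro card_Diff_subset) auto
      moreover have "card {x, \<pi> x} \<le> card S" using x px less.prems(1) by (intro card_mono) auto
      ultimately show ?thesis by simp
    qed
    have "even (card S')"
    proof (rule less.hyps)
      show "card S' < card S" using c by simp
      show "finite S'" using less.prems(1) by (simp add: S'_def)
      show "\<pi> y \<in> S' \<and> \<pi> (\<pi> y) = y \<and> \<pi> y \<noteq> y" if "y \<in> S'" for y
        using that less.prems(2)[of y] less.prems(2)[OF x] by (auto simp: S'_def)
    qed
    then show ?thesis using c by simp
  qed simp
qed

text \<open>A matching is represented by an involution; its fixed points are the unmatched vertices.\<close>

definition pairing :: "('a \<Rightarrow> 'a \<Rightarrow> bool) \<Rightarrow> 'a set \<Rightarrow> ('a \<Rightarrow> 'a) \<Rightarrow> bool" where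
  "pairing adj X \<pi> \<longleftrightarrow> (\<forall>x\<in>X. \<pi> x \<in> X \<and> \<pi> (\<pi> x) = x \<and> (\<pi> x \<noteq> x \<longrightarrow> adj x (\<pi> x)))"

definition unmatched :: "'a set \<Rightarrow> ('a \<Rightarrow> 'a) \<Rightarrow> 'a set" where
  "unmatched X \<pi> = {x \<in> X. \<pi> x = x}"

definition deficiency :: "('a \<Rightarrow> 'a \<Rightarrow> bool) \<Rightarrow> 'a set \<Rightarrow> nat" where
  "deficiency adj X = (LEAST k. \<exists>\<pi>. pairing adj X \<pi> \<and> card (unmatched X \<pi>) = k)"

definition maximum_pairing :: "('a \<Rightarrow> 'a \<Rightarrow> bool) \<Rightarrow> 'a set \<Rightarrow> ('a \<Rightarrow> 'a) \<Rightarrow> bool" where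
  "maximum_pairing adj X \<pi> \<longleftrightarrow> pairing adj X \<pi> \<and> card (unmatched X \<pi>) = deficiency adj X"

lemma maximum_pairing_exists: "\<exists>\<pi>. maximum_pairing adj X \<pi>"
proof -
  have "pairing adj X id" by (simp add: pairing_def)
  then have "\<exists>k. \<exists>\<pi>. pairing adj X \<pi> \<and> card (unmatched X \<pi>) = k" by blast
  then show ?thesis unfolding maximum_pairing_def deficiency_def by (rule LeastI_ex)
qed

lemma deficiency_le: "pairing adj X \<pi> \<Longrightarrow> deficiency adj X \<le> card (unmatched X \<pi>)"
  unfolding deficiency_def by (rule Least_le) blast

lemma pairing_parity:
  assumes "finite X" "pairing adj X \<pi>"
  shows "even (card X) \<longleftrightarrow> even (card (unmatched X \<pi>))"
proof -
  have "even (card (X - unmatched X \<pi>))"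
    by (rule even_card_involution[where \<pi> = \<pi>]) (use assms in \<open>auto simp: pairing_def unmatched_def\<close>)
  moreover have "card X = card (X - unmatched X \<pi>) + card (unmatched X \<pi>)"
    using assms(1) card_mono[of X "unmatched X \<pi>"] by (simp add: card_Diff_subset unmatched_def)
  ultimately show ?thesis by simp
qed

lemma pairing_deficiency_parity:
  assumes "finite X"
  shows "even (card X) \<longleftrightarrow> even (deficiency adj X)"
proof -
  obtain \<pi> where "maximum_pairing adj X \<pi>" using maximum_pairing_exists by blast
  then show ?thesis using pairing_parity[OF assms, of adj \<pi>] by (simp add: maximum_pairing_def)
qed

lemma maximum_pairing_no_edge:
  assumes "finite X" "\<And>x y. adj x y \<Longrightarrow> adj y x" "maximum_pairing adj X \<pi>"
    and xy: "x \<in> X" "y \<in> X" "x \<noteq> y" "adj x y" "\<pi> x = x" "\<pi> y = y"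
  shows False
proof -
  let ?\<sigma> = "\<pi>(x := y, y := x)"
  have p: "pairing adj X \<pi>" using assms(3) by (simp add: maximum_pairing_def)
  have ne: "\<pi> w \<noteq> x \<and> \<pi> w \<noteq> y" if "w \<in> X" "w \<noteq> x" "w \<noteq> y" for w
    using p that xy unfolding pairing_def by metis
  have "pairing adj X ?\<sigma>"
    using p xy assms(2) ne unfolding pairing_def by (simp add: fun_upd_def)
  then have "deficiency adj X \<le> card (unmatched X ?\<sigma>)" by (rule deficiency_le)
  also have "unmatched X ?\<sigma> = unmatched X \<pi> - {x, y}"
    using xy by (auto simp: unmatched_def)
  also have "card \<dots> < card (unmatched X \<pi>)"
    using xy assms(1) by (intro psubset_card_mono) (auto simp: unmatched_def)
  finally show False using assms(3) by (simp add: maximum_pairing_def)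
qed

text \<open>Gallai's lemma. Among the maximum matchings missing \<open>t\<close>, take one that agrees as much as
  possible with a maximum matching missing \<open>u\<close> and \<open>v\<close>.\<close>

lemma gallai:
  assumes fin: "finite X" and sym: "\<And>x y. adj x y \<Longrightarrow> adj y x"
    and uvt: "u \<in> X" "v \<in> X" "t \<in> X" "u \<noteq> v"
    and t: "maximum_pairing adj X \<sigma>0" "\<sigma>0 t = t"
    and ut: "\<And>\<pi>. maximum_pairing adj X \<pi> \<Longrightarrow> \<not> (\<pi> u = u \<and> \<pi> t = t)"
    and tv: "\<And>\<pi>. maximum_pairing adj X \<pi> \<Longrightarrow> \<not> (\<pi> t = t \<and> \<pi> v = v)"
    and \<pi>: "maximum_pairing adj X \<pi>"
  shows "\<not> (\<pi> u = u \<and> \<pi> v = v)"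
proof
  assume fixed: "\<pi> u = u \<and> \<pi> v = v"
  define ov where "ov \<sigma> = card {w \<in> X. \<pi> w = \<sigma> w \<and> \<pi> w \<noteq> w}" for \<sigma>
  have "ov \<sigma> \<le> card X" for \<sigma> unfolding ov_def using fin by (intro card_mono) auto
  then obtain \<sigma> where \<sigma>: "maximum_pairing adj X \<sigma>" "\<sigma> t = t"
    and max: "\<And>\<tau>. maximum_pairing adj X \<tau> \<Longrightarrow> \<tau> t = t \<Longrightarrow> ov \<tau> \<le> ov \<sigma>"
    using ex_has_greatest_nat[of "\<lambda>\<sigma>. maximum_pairing adj X \<sigma> \<and> \<sigma> t = t" \<sigma>0 ov "Suc (card X)"] t
    by (auto simp: less_Suc_eq_le)
  have p: "pairing adj X \<pi>" "pairing adj X \<sigma>" using \<pi> \<sigma> by (auto simp: maximum_pairing_def)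
  have tnot: "\<pi> t \<noteq> t" "\<sigma> u \<noteq> u" "\<sigma> v \<noteq> v" using ut tv fixed \<pi> \<sigma> by blast+
  define A where "A = unmatched X \<pi>"
  define B where "B = unmatched X \<sigma>"
  have finAB: "finite A" "finite B" using fin by (auto simp: A_def B_def unmatched_def)
  have AB: "card A = card B" using \<pi> \<sigma> by (simp add: A_def B_def maximum_pairing_def)
  have "{u, v} \<subseteq> A - B" using fixed tnot uvt by (auto simp: A_def B_def unmatched_def)
  \<comment> \<open>Both matchings miss equally many vertices, so \<open>B - A\<close> has at least
    two elements as well, and one of them differs from \<open>t\<close>.\<close>
  then have "2 \<le> card (A - B)"
    using card_mono[of "A - B" "{u, v}"] finAB uvt by simp
  moreover have "card (A - B) = card (B - A)"
    using AB finAB by (simp add: card_Diff_subset_Int Int_commute)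
  ultimately have "\<not> B - A \<subseteq> {t}"
    using card_mono[of "{t}" "B - A"] by auto
  then obtain x where x: "x \<in> X" "\<sigma> x = x" "\<pi> x \<noteq> x" "x \<noteq> t"
    by (auto simp: A_def B_def unmatched_def)
  define y where "y = \<pi> x"
  have y: "y \<in> X" "\<pi> y = x" "y \<noteq> x" "adj x y"
    using p(1) x by (auto simp: y_def pairing_def)
  have \<sigma>y: "\<sigma> y \<noteq> y"
    using maximum_pairing_no_edge[OF fin sym \<sigma>(1) x(1) y(1) y(3)[symmetric] y(4) x(2)] by blast
  define z where "z = \<sigma> y"
  have z: "z \<in> X" "\<sigma> z = y" "z \<noteq> y" "z \<noteq> x" using p(2) y \<sigma>y x by (auto simp: z_def pairing_def)
  \<comment> \<open>The edge \<open>yz\<close> of \<open>\<sigma>\<close> is exchanged for the edge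
    \<open>xy\<close> of \<open>\<pi>\<close>. The matching stays maximum and still misses
    \<open>t\<close>, while its overlap with \<open>\<pi>\<close> gains \<open>xy\<close> and loses
    nothing, as \<open>yz\<close> is not an edge of \<open>\<pi>\<close>.\<close>
  define \<tau> where "\<tau> = \<sigma>(x := y, y := x, z := z)"
  have others: "\<sigma> w \<noteq> x \<and> \<sigma> w \<noteq> y \<and> \<sigma> w \<noteq> z" if "w \<in> X" "w \<noteq> x" "w \<noteq> y" "w \<noteq> z" for w
  proof -
    have "\<sigma> (\<sigma> w) = w" using p(2) that by (simp add: pairing_def)
    then show ?thesis using that x z z_def by metis
  qed
  have "pairing adj X \<tau>"
    unfolding pairing_def
  proof
    fix w assume w: "w \<in> X"
    consider "w = x" | "w = y" | "w = z" | "w \<noteq> x" "w \<noteq> y" "w \<noteq> z" by blast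
    then show "\<tau> w \<in> X \<and> \<tau> (\<tau> w) = w \<and> (\<tau> w \<noteq> w \<longrightarrow> adj w (\<tau> w))"
    proof cases
      case 4
      then show ?thesis using others[OF w] p(2) w by (simp add: \<tau>_def pairing_def)
    qed (use x y z sym in \<open>auto simp: \<tau>_def\<close>)
  qed
  moreover have "unmatched X \<tau> = insert z (B - {x})"
    using x y z \<sigma>y by (auto simp: \<tau>_def B_def unmatched_def)
  then have "card (unmatched X \<tau>) = card B"
  proof -
    have "x \<in> B" "z \<notin> B" using x z by (auto simp: B_def unmatched_def)
    then show ?thesis
      using \<open>unmatched X \<tau> = insert z (B - {x})\<close> finAB card_Suc_Diff1[of B x] by simp
  qed
  ultimately have "maximum_pairing adj X \<tau>" using \<sigma> by (simp add: maximum_pairing_def B_def)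
  moreover have "t \<noteq> y" "t \<noteq> z" using \<sigma>y \<sigma>(2) z by auto
  then have "\<tau> t = t" using x \<sigma> by (simp add: \<tau>_def)
  ultimately have "ov \<tau> \<le> ov \<sigma>" by (rule max)
  moreover have "ov \<sigma> < ov \<tau>"
    unfolding ov_def
  proof (rule psubset_card_mono)
    show "finite {w \<in> X. \<pi> w = \<tau> w \<and> \<pi> w \<noteq> w}" using fin by simp
    have "\<pi> z \<noteq> y" using z p(1) y by (metis pairing_def)
    then have "{w \<in> X. \<pi> w = \<sigma> w \<and> \<pi> w \<noteq> w} \<subseteq> {w \<in> X. \<pi> w = \<tau> w \<and> \<pi> w \<noteq> w}"
      using x y z by (auto simp: \<tau>_def y_def z_def)
    moreover have "x \<in> {w \<in> X. \<pi> w = \<tau> w \<and> \<pi> w \<noteq> w}" "x \<notin> {w \<in> X. \<pi> w = \<sigma> w \<and> \<pi> w \<noteq> w}"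
      using x y z by (auto simp: \<tau>_def y_def)
    ultimately show "{w \<in> X. \<pi> w = \<sigma> w \<and> \<pi> w \<noteq> w} \<subset> {w \<in> X. \<pi> w = \<tau> w \<and> \<pi> w \<noteq> w}" by blast
  qed
  ultimately show False by simp
qed

text \<open>A relation, so that the components of the graph on \<open>Y\<close> are the images of
  points under its reflexive transitive closure.\<close>

definition edges_off :: "('a \<Rightarrow> 'a \<Rightarrow> bool) \<Rightarrow> 'a set \<Rightarrow> ('a \<times> 'a) set" where
  "edges_off adj Y = {(a, b). a \<in> Y \<and> b \<in> Y \<and> adj a b}"

text \<open>Gallai's lemma carries the property of never being missed together through a middle
  vertex that some maximum matching misses. Adjacent vertices start the chain, since an edge between
  two missed vertices would enlarge the matching.\<close>

lemma connected_never_both_unmatched: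
  assumes fin: "finite Y" and sym: "\<And>x y. adj x y \<Longrightarrow> adj y x"
    and inessential: "\<And>t. t \<in> Y \<Longrightarrow> \<exists>\<sigma>. maximum_pairing adj Y \<sigma> \<and> \<sigma> t = t"
    and u: "u \<in> Y" and uw: "(u, w) \<in> (edges_off adj Y)\<^sup>*"
  shows "u = w \<or> (\<forall>\<sigma>. maximum_pairing adj Y \<sigma> \<longrightarrow> \<not> (\<sigma> u = u \<and> \<sigma> w = w))"
  using uw
proof (induction rule: rtrancl_induct)
  case (step w z)
  have wz: "w \<in> Y" "z \<in> Y" "adj w z" using step(2) by (auto simp: edges_off_def)
  have edge: "\<not> (\<sigma> w = w \<and> \<sigma> z = z)" if "maximum_pairing adj Y \<sigma>" "w \<noteq> z" for \<sigma>
    using maximum_pairing_no_edge[of Y adj \<sigma> w z] fin sym that wz by blast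
  show ?case
  proof (cases "w = z \<or> u = z \<or> u = w")
    case True
    then show ?thesis using step.IH edge by blast
  next
    case False
    obtain \<rho> where \<rho>: "maximum_pairing adj Y \<rho>" "\<rho> w = w" using inessential[OF wz(1)] by blast
    have "\<not> (\<sigma> u = u \<and> \<sigma> z = z)" if m: "maximum_pairing adj Y \<sigma>" for \<sigma>
    proof (rule gallai[OF fin _ u wz(2) wz(1) _ \<rho> _ _ m])
      show "\<not> (\<pi> u = u \<and> \<pi> w = w)" if "maximum_pairing adj Y \<pi>" for \<pi>
        using step.IH False that by blast
      show "\<not> (\<pi> w = w \<and> \<pi> z = z)" if "maximum_pairing adj Y \<pi>" for \<pi>
        using edge that False by blast
      show "adj y x" if "adj x y" for x y using that by (rule sym)
      show "u \<noteq> z" using False by blast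
    qed
    then show ?thesis by blast
  qed
qed simp

text \<open>The hard direction of the Tutte-Berge formula. For a largest \<open>S\<close> whose
  removal raises the deficiency by at least \<open>card S\<close>, every remaining vertex is missed
  by some maximum matching of the rest. Each component then has at most one missed vertex, and a
  component with one has odd size. \<open>U\<close> collects the missed vertices.\<close>

theorem berge_barrier:
  assumes fin: "finite X" and sym: "\<And>x y. adj x y \<Longrightarrow> adj y x"
  shows "\<exists>S U. S \<subseteq> X \<and> U \<subseteq> X - S \<and> deficiency adj X + card S \<le> card U \<and>
    (\<forall>u\<in>U. odd (card ((edges_off adj (X - S))\<^sup>* `` {u}))) \<and>
    (\<forall>u\<in>U. \<forall>v\<in>U. u \<noteq> v \<longrightarrow>
       (edges_off adj (X - S))\<^sup>* `` {u} \<inter> (edges_off adj (X - S))\<^sup>* `` {v} = {})"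
proof -
  define P where "P S \<longleftrightarrow> S \<subseteq> X \<and> deficiency adj X + card S \<le> deficiency adj (X - S)" for S
  have "P {}" by (simp add: P_def)
  moreover have "card S < Suc (card X)" if "P S" for S
    using that fin card_mono[of X S] by (auto simp: P_def less_Suc_eq_le)
  ultimately obtain S where S: "P S" and Smax: "\<And>S'. P S' \<Longrightarrow> card S' \<le> card S"
    using ex_has_greatest_nat[of P "{}" card "Suc (card X)"] by (auto)
  define Y where "Y = X - S"
  define R where "R = edges_off adj Y"
  have finY: "finite Y" and finS: "finite S" using fin S by (auto simp: Y_def P_def intro: finite_subset)
  have inessential: "\<exists>\<sigma>. maximum_pairing adj Y \<sigma> \<and> \<sigma> t = t" if t: "t \<in> Y" for t
  proof (rule ccontr)
    assume no: "\<not> ?thesis"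
    obtain \<tau> where \<tau>: "maximum_pairing adj (Y - {t}) \<tau>" using maximum_pairing_exists by blast
    define \<sigma> where "\<sigma> = \<tau>(t := t)"
    have \<sigma>: "pairing adj Y \<sigma>"
      using \<tau> t unfolding maximum_pairing_def pairing_def \<sigma>_def by auto
    have "unmatched Y \<sigma> = insert t (unmatched (Y - {t}) \<tau>)"
      using t by (auto simp: unmatched_def \<sigma>_def)
    moreover have "t \<notin> unmatched (Y - {t}) \<tau>" "finite (unmatched (Y - {t}) \<tau>)"
      using finY by (auto simp: unmatched_def)
    ultimately have c: "card (unmatched Y \<sigma>) = Suc (deficiency adj (Y - {t}))"
      using \<tau> by (simp add: maximum_pairing_def)
    have "deficiency adj Y \<le> card (unmatched Y \<sigma>)" by (rule deficiency_le[OF \<sigma>])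
    moreover have "deficiency adj Y \<noteq> card (unmatched Y \<sigma>)"
      using no \<sigma> by (auto simp: maximum_pairing_def \<sigma>_def)
    moreover have "even (deficiency adj Y) \<longleftrightarrow> even (card (unmatched Y \<sigma>))"
      using pairing_deficiency_parity[OF finY] pairing_parity[OF finY \<sigma>] by simp
    moreover have "a + 2 \<le> b" if "a \<le> b" "a \<noteq> b" "even a \<longleftrightarrow> even b" for a b :: nat
      using that by presburger
    \<comment> \<open>Leaving \<open>t\<close> unmatched increases the number of missed vertices, by
      parity at least by 2. One of them is \<open>t\<close> itself, so deleting \<open>t\<close>
      raises the deficiency by at least 1 and \<open>S\<close> was not largest.\<close>
    ultimately have "deficiency adj Y + 2 \<le> card (unmatched Y \<sigma>)" by blast
    then have "P (insert t S)"
    proof -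
      have "X - insert t S = Y - {t}" by (auto simp: Y_def)
      moreover have "t \<notin> S" "t \<in> X" using t by (auto simp: Y_def)
      ultimately show ?thesis
        using S c finS \<open>deficiency adj Y + 2 \<le> card (unmatched Y \<sigma>)\<close> by (simp add: P_def Y_def)
    qed
    then show False using Smax[of "insert t S"] t finS by (auto simp: Y_def)
  qed
  obtain \<pi> where \<pi>: "maximum_pairing adj Y \<pi>" using maximum_pairing_exists by blast
  have p: "pairing adj Y \<pi>" using \<pi> by (simp add: maximum_pairing_def)
  define U where "U = unmatched Y \<pi>"
  have RY: "w \<in> Y" if "(u, w) \<in> R\<^sup>*" "u \<in> Y" for u w
    using that by (induction rule: rtrancl_induct) (auto simp: R_def edges_off_def)
  have symR: "(w, u) \<in> R\<^sup>*" if "(u, w) \<in> R\<^sup>*" for u w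
  proof -
    have "sym R" using sym by (auto simp: R_def edges_off_def sym_def)
    then have "sym (R\<^sup>*)" by (rule sym_rtrancl)
    then show ?thesis using that by (rule symD)
  qed
  have conn: "u = w \<or> (\<forall>\<sigma>. maximum_pairing adj Y \<sigma> \<longrightarrow> \<not> (\<sigma> u = u \<and> \<sigma> w = w))"
    if "(u, w) \<in> R\<^sup>*" "u \<in> Y" for u w
  proof (rule connected_never_both_unmatched)
    show "finite Y" by (rule finY)
    show "adj y x" if "adj x y" for x y using that by (rule sym)
    show "\<exists>\<sigma>. maximum_pairing adj Y \<sigma> \<and> \<sigma> t = t" if "t \<in> Y" for t
      using that by (rule inessential)
  qed (use that in \<open>simp_all add: R_def\<close>)
  show ?thesis
  proof (rule exI[of _ S], rule exI[of _ U], intro conjI ballI impI)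
    show "S \<subseteq> X" using S by (simp add: P_def)
    show "U \<subseteq> X - S" by (auto simp: U_def unmatched_def Y_def)
    show "deficiency adj X + card S \<le> card U"
      using S \<pi> by (simp add: P_def U_def maximum_pairing_def Y_def)
    show "(edges_off adj (X - S))\<^sup>* `` {u} \<inter> (edges_off adj (X - S))\<^sup>* `` {v} = {}"
      if uv: "u \<in> U" "v \<in> U" "u \<noteq> v" for u v
    proof (rule ccontr)
      assume "\<not> ?thesis"
      then obtain w where "(u, w) \<in> R\<^sup>*" "(v, w) \<in> R\<^sup>*" unfolding R_def Y_def by blast
      then have "(u, v) \<in> R\<^sup>*" using symR[of v w] by (auto intro: rtrancl_trans)
      then show False using conn[of u v] uv \<pi> by (auto simp: U_def unmatched_def)
    qed
    show "odd (card ((edges_off adj (X - S))\<^sup>* `` {u}))" if u: "u \<in> U" for u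
    proof -
      define K where "K = R\<^sup>* `` {u}"
      have uY: "u \<in> Y" "\<pi> u = u" using u by (auto simp: U_def unmatched_def)
      have KY: "K \<subseteq> Y" using RY uY by (auto simp: K_def)
      have "even (card (K - {u}))"
      proof (rule even_card_involution[where \<pi> = \<pi>])
        show "finite (K - {u})" using KY finY by (auto intro: finite_subset)
        fix x assume x: "x \<in> K - {u}"
        then have xY: "x \<in> Y" using KY by auto
        have nf: "\<pi> x \<noteq> x" using conn[of u x] x uY \<pi> by (auto simp: K_def)
        have px: "\<pi> x \<in> Y" "\<pi> (\<pi> x) = x" "adj x (\<pi> x)" using p xY nf by (auto simp: pairing_def)
        then have "(x, \<pi> x) \<in> R" using xY by (auto simp: R_def edges_off_def)
        then have "\<pi> x \<in> K" using x by (auto simp: K_def intro: rtrancl_into_rtrancl)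
        moreover have "\<pi> x \<noteq> u" using px(2) uY nf by metis
        ultimately show "\<pi> x \<in> K - {u} \<and> \<pi> (\<pi> x) = x \<and> \<pi> x \<noteq> x" using px nf by auto
      qed
      moreover have "u \<in> K" by (simp add: K_def)
      moreover have "finite K" using KY finY by (rule finite_subset)
      ultimately have "odd (card K)" by (metis card_Suc_Diff1 even_Suc)
      then show ?thesis by (simp add: K_def R_def Y_def)
    qed
  qed
qed

section \<open>A matching that meets all triangles\<close>

text \<open>\<open>no_four\<close> forbids four pairwise adjacent edges of any shape: besides
  bounding the degrees by 3 it yields \<open>triangle_no_digon\<close>, on which the counts at
  triangles rest.\<close>

locale subcubic =
  fixes E :: "'e set" and en :: "'e \<Rightarrow> 'v set"
  assumes fin: "finite E" and two: "\<And>e. e \<in> E \<Longrightarrow> card (en e) = 2"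
    and no_four: "\<And>S. S \<subseteq> E \<Longrightarrow> card S = 4 \<Longrightarrow> \<exists>e\<in>S. \<exists>f\<in>S. e \<noteq> f \<and> en e \<inter> en f = {}"
begin

definition star :: "'v \<Rightarrow> 'e set" where "star v = {e \<in> E. v \<in> en e}"

definition boundary :: "'v set \<Rightarrow> 'e set" where "boundary K = {e \<in> E. card (en e \<inter> K) = 1}"

text \<open>Recorded as a vertex set, since \<open>triangle_no_digon\<close> makes its three edges
  unique.\<close>

definition triangle :: "'v set \<Rightarrow> bool" where
  "triangle T \<longleftrightarrow> (\<exists>a b c. T = {a, b, c} \<and> a \<noteq> b \<and> b \<noteq> c \<and> a \<noteq> c \<and>
     {a, b} \<in> en ` E \<and> {b, c} \<in> en ` E \<and> {a, c} \<in> en ` E)"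

section \<open>Degrees, cuts and triangles\<close>

lemma fin_star [simp]: "finite (star v)" and fin_boundary [simp]: "finite (boundary K)"
  using fin by (auto simp: star_def boundary_def)

lemma finite_ends: "e \<in> E \<Longrightarrow> finite (en e)"
  using two[of e] by (metis card.infinite zero_neq_numeral)

lemma degree_le: "card (star v) \<le> 3"
proof (rule ccontr)
  assume "\<not> ?thesis"
  then obtain S where "S \<subseteq> star v" "card S = 4"
    using obtain_subset_with_card_n[of 4 "star v"] by auto
  then show False using no_four[of S] by (auto simp: star_def)
qed

lemma degree_less_4: "card S \<noteq> 4" if "S \<subseteq> star v"
  using that degree_le[of v] card_mono[of "star v" S] by auto

lemma ends_pair:
  assumes "e \<in> E" "v \<in> en e"
  obtains w where "en e = {v, w}" "w \<noteq> v"
proof -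
  obtain x y where "en e = {x, y}" "x \<noteq> y" using two[OF assms(1)] by (auto simp: card_2_iff)
  then show ?thesis using that[of x] that[of y] assms(2) by (auto simp: insert_commute)
qed

lemma boundary_singleton: "boundary {v} = star v"
proof -
  have "card (en e \<inter> {v}) = 1 \<longleftrightarrow> v \<in> en e" for e by (cases "v \<in> en e") auto
  then show ?thesis by (simp add: boundary_def star_def)
qed

text \<open>Edges with both ends in \<open>K\<close> contribute 2 to the sum. In this form the
  parity of a cut is additive over disjoint sets.\<close>

lemma boundary_parity: "even (card (boundary K)) \<longleftrightarrow> even (\<Sum>e\<in>E. card (en e \<inter> K))"
proof -
  have "odd (card (en e \<inter> K)) \<longleftrightarrow> card (en e \<inter> K) = 1" if "e \<in> E" for e
  proof -
    have "card (en e \<inter> K) \<le> 2"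
      using two[OF that] card_mono[of "en e" "en e \<inter> K"] finite_ends[OF that] by simp
    then have "card (en e \<inter> K) \<in> {0, 1, 2}" by auto
    then show ?thesis by auto
  qed
  then have "boundary K = {e \<in> E. odd (card (en e \<inter> K))}" by (auto simp: boundary_def)
  then show ?thesis using even_sum_iff[OF fin, of "\<lambda>e. card (en e \<inter> K)"] by simp
qed

lemma boundary_Union_parity:
  assumes "finite \<K>" "pairwise disjnt \<K>"
  shows "even (card (boundary (\<Union>\<K>))) \<longleftrightarrow> even (\<Sum>A\<in>\<K>. card (boundary A))"
proof -
  have e: "card (en e \<inter> \<Union>\<K>) = (\<Sum>A\<in>\<K>. card (en e \<inter> A))" if "e \<in> E" for e
  proof -
    have "en e \<inter> \<Union>\<K> = (\<Union>A\<in>\<K>. en e \<inter> A)" by auto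
    moreover have "card (\<Union>A\<in>\<K>. en e \<inter> A) = (\<Sum>A\<in>\<K>. card (en e \<inter> A))"
      using assms finite_ends[OF that]
      by (intro card_UN_disjoint) (auto simp: pairwise_def disjnt_def)
    ultimately show ?thesis by simp
  qed
  have "(\<Sum>e\<in>E. card (en e \<inter> \<Union>\<K>)) = (\<Sum>A\<in>\<K>. \<Sum>e\<in>E. card (en e \<inter> A))"
    by (simp add: e) (rule sum.swap)
  then have "even (card (boundary (\<Union>\<K>))) \<longleftrightarrow> even (\<Sum>A\<in>\<K>. \<Sum>e\<in>E. card (en e \<inter> A))"
    by (simp add: boundary_parity)
  also have "\<dots> \<longleftrightarrow> even (\<Sum>A\<in>\<K>. card (boundary A))"
    using assms(1) by (induction \<K> rule: finite_induct) (auto simp: boundary_parity)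
  finally show ?thesis .
qed

lemma triangle_no_digon:
  assumes T: "triangle T" and e: "e \<in> E" "f \<in> E" "en e = en f" "en e \<subseteq> T"
  shows "e = f"
proof (rule ccontr)
  assume ne: "e \<noteq> f"
  obtain a b c where T3: "T = {a, b, c}" "a \<noteq> b" "b \<noteq> c" "a \<noteq> c" and
    E3: "{a, b} \<in> en ` E" "{b, c} \<in> en ` E" "{a, c} \<in> en ` E"
    using T unfolding triangle_def by blast
  have *: False if xyz: "en e = {x, y}" "x \<noteq> y" "y \<noteq> z" "x \<noteq> z" "{y, z} \<in> en ` E" "{x, z} \<in> en ` E" for x y z
  proof -
    obtain g where g: "g \<in> E" "en g = {y, z}" using xyz(5) by (metis imageE)
    obtain h where h: "h \<in> E" "en h = {x, z}" using xyz(6) by (metis imageE)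
    note gh = g h
    have c: "card {e, f, g, h} = 4"
    proof -
      have "e \<noteq> g" "e \<noteq> h" "g \<noteq> h" using xyz gh by (auto simp: doubleton_eq_iff)
      moreover have "f \<noteq> g" "f \<noteq> h" using xyz gh e(3) by (auto simp: doubleton_eq_iff)
      ultimately show ?thesis using ne by simp
    qed
    have i: "\<forall>u\<in>{e, f, g, h}. \<forall>v\<in>{e, f, g, h}. en u \<inter> en v \<noteq> {}"
      using xyz(1) e(3) gh by simp
    have "{e, f, g, h} \<subseteq> E" using e(1,2) gh(1,3) by simp
    from no_four[OF this c] show False using i by metis
  qed
  obtain x y where xy: "en e = {x, y}" "x \<noteq> y" using two[OF e(1)] by (auto simp: card_2_iff)
  then have "{x, y} \<subseteq> {a, b, c}" using e(4) T3 by simp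
  then have "{x, y} = {a, b} \<or> {x, y} = {b, c} \<or> {x, y} = {a, c}" using xy(2) by blast
  then show False
  proof (elim disjE)
    assume "{x, y} = {a, b}" then show False using *[of a b c] xy T3 E3 by simp
  next
    assume "{x, y} = {b, c}" then show False using *[of b c a] xy T3 E3 by (simp add: insert_commute)
  next
    assume "{x, y} = {a, c}" then show False using *[of a c b] xy T3 E3 by (simp add: insert_commute)
  qed
qed

text \<open>By \<open>triangle_no_digon\<close> exactly two edges at \<open>v\<close> run inside the
  triangle. Since degrees are at most 3, at most one leaves, so a contracted triangle behaves like a
  vertex of degree at most 3.\<close>

lemma triangle_vertex:
  assumes T: "triangle T" "v \<in> T"
  shows "card {e \<in> E. v \<in> en e \<and> en e \<subseteq> T} = 2"
    "card (star v) = 2 + card {e \<in> boundary T. v \<in> en e}"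
proof -
  obtain b c where bc: "T = {v, b, c}" "v \<noteq> b" "b \<noteq> c" "v \<noteq> c"
    "{v, b} \<in> en ` E" "{b, c} \<in> en ` E" "{v, c} \<in> en ` E"
  proof -
    obtain a b c where abc: "T = {a, b, c}" "a \<noteq> b" "b \<noteq> c" "a \<noteq> c"
      "{a, b} \<in> en ` E" "{b, c} \<in> en ` E" "{a, c} \<in> en ` E"
      using T(1) unfolding triangle_def by blast
    then have "v = a \<or> v = b \<or> v = c" using T(2) by blast
    then show thesis
    proof (elim disjE)
      assume "v = a" then show thesis using that[of b c] abc by simp
    next
      assume "v = b" then show thesis using that[of a c] abc by (simp add: insert_commute)
    next
      assume "v = c" then show thesis using that[of a b] abc by (simp add: insert_commute)
    qed
  qed
  obtain e where e: "e \<in> E" "en e = {v, b}" using bc(5) by (metis imageE)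
  obtain f where f: "f \<in> E" "en f = {v, c}" using bc(7) by (metis imageE)
  note ef = e f
  have "{e \<in> E. v \<in> en e \<and> en e \<subseteq> T} = {e, f}"
  proof
    show "{e, f} \<subseteq> {e \<in> E. v \<in> en e \<and> en e \<subseteq> T}" using ef bc by auto
    show "{e \<in> E. v \<in> en e \<and> en e \<subseteq> T} \<subseteq> {e, f}"
    proof
      fix g assume "g \<in> {e \<in> E. v \<in> en e \<and> en e \<subseteq> T}"
      then have g: "g \<in> E" "v \<in> en g" "en g \<subseteq> T" by auto
      obtain w where "en g = {v, w}" "w \<noteq> v" using ends_pair[OF g(1,2)] .
      then have "en g = en e \<or> en g = en f" using g(3) bc(1) ef by auto
      then show "g \<in> {e, f}"
        using triangle_no_digon[OF T(1) g(1) ef(1) _ g(3)] triangle_no_digon[OF T(1) g(1) ef(3) _ g(3)] by auto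
    qed
  qed
  moreover have "e \<noteq> f" using ef bc by (auto simp: doubleton_eq_iff)
  ultimately show inner: "card {e \<in> E. v \<in> en e \<and> en e \<subseteq> T} = 2" by simp
  have "card (en g \<inter> T) = 1 \<longleftrightarrow> \<not> en g \<subseteq> T" if g: "g \<in> star v" for g
  proof -
    obtain w where w: "en g = {v, w}" "w \<noteq> v" using g ends_pair[of g v] by (auto simp: star_def)
    show ?thesis
    proof (cases "w \<in> T")
      case True
      then have "en g \<inter> T = {v, w}" using w T(2) by auto
      then show ?thesis using w True T(2) by simp
    next
      case False
      then have "en g \<inter> T = {v}" using w T(2) by auto
      then show ?thesis using w False by simp
    qed
  qed
  then have "star v = {e \<in> E. v \<in> en e \<and> en e \<subseteq> T} \<union> {e \<in> boundary T. v \<in> en e}"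
    "{e \<in> E. v \<in> en e \<and> en e \<subseteq> T} \<inter> {e \<in> boundary T. v \<in> en e} = {}"
    by (auto simp: star_def boundary_def)
  then show "card (star v) = 2 + card {e \<in> boundary T. v \<in> en e}"
    using inner fin by (simp add: card_Un_disjoint)
qed

lemma card_boundary_triangle:
  assumes "triangle T"
  shows "card (boundary T) = (\<Sum>v\<in>T. card {e \<in> boundary T. v \<in> en e})"
proof -
  have finT: "finite T" using assms by (auto simp: triangle_def)
  have "boundary T = (\<Union>v\<in>T. {e \<in> boundary T. v \<in> en e})"
  proof -
    have "\<exists>v\<in>T. v \<in> en e" if "e \<in> boundary T" for e
    proof -
      have "en e \<inter> T \<noteq> {}" using that by (auto simp: boundary_def)
      then show ?thesis by blast
    qed
    then show ?thesis by auto
  qed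
  also have "card \<dots> = (\<Sum>v\<in>T. card {e \<in> boundary T. v \<in> en e})"
  proof (rule card_UN_disjoint)
    show "\<forall>i\<in>T. \<forall>j\<in>T. i \<noteq> j \<longrightarrow> {e \<in> boundary T. i \<in> en e} \<inter> {e \<in> boundary T. j \<in> en e} = {}"
    proof (intro ballI impI)
      fix i j assume ij: "i \<in> T" "j \<in> T" "i \<noteq> j"
      have False if e: "e \<in> boundary T" "i \<in> en e" "j \<in> en e" for e
      proof -
        have "{i, j} \<subseteq> en e \<inter> T" using e ij by auto
        moreover have "finite (en e \<inter> T)" using finT by simp
        ultimately have "card {i, j} \<le> card (en e \<inter> T)" using card_mono by blast
        then show False using e ij by (simp add: boundary_def)
      qed
      then show "{e \<in> boundary T. i \<in> en e} \<inter> {e \<in> boundary T. j \<in> en e} = {}" by blast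
    qed
  qed (use finT in auto)
  finally show ?thesis .
qed

lemma triangle_boundary:
  assumes "triangle T"
  shows "card (boundary T) \<le> 3" "(\<And>v. v \<in> T \<Longrightarrow> card (star v) = 3) \<Longrightarrow> card (boundary T) = 3"
proof -
  have T3: "card T = 3" using assms by (auto simp: triangle_def)
  have le: "card {e \<in> boundary T. v \<in> en e} \<le> 1" if "v \<in> T" for v
    using triangle_vertex(2)[OF assms that] degree_le[of v] by simp
  show "card (boundary T) \<le> 3"
    using sum_bounded_above[of T "\<lambda>v. card {e \<in> boundary T. v \<in> en e}" 1] le T3
    by (simp add: card_boundary_triangle[OF assms])
  show "card (boundary T) = 3" if "\<And>v. v \<in> T \<Longrightarrow> card (star v) = 3"
  proof -
    have "card {e \<in> boundary T. v \<in> en e} = 1" if "v \<in> T" for v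
      using triangle_vertex(2)[OF assms that] \<open>\<And>v. v \<in> T \<Longrightarrow> card (star v) = 3\<close>[OF that] by simp
    then show ?thesis by (simp add: card_boundary_triangle[OF assms] T3)
  qed
qed

end

locale uncut = subcubic +
  assumes uncut: "\<And>K. card (boundary K) \<noteq> 1"
begin

section \<open>Contracting isolated triangles\<close>

definition vertices :: "'b set" where "vertices = \<Union>(en ` E)"

text \<open>Only triangles disjoint from all others are contracted. Two overlapping triangles share
  an edge, and any matching that covers the vertices of degree 3 already contains an edge of
  each.\<close>

definition isolated :: "'b set set" where
  "isolated = {T. triangle T \<and> (\<forall>T'. triangle T' \<longrightarrow> T' \<inter> T \<noteq> {} \<longrightarrow> T' = T)}"

definition blocks :: "'b set set" where
  "blocks = isolated \<union> (\<lambda>v. {v}) ` (vertices - \<Union>isolated)"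

lemma triangle_subset: "triangle T \<Longrightarrow> T \<subseteq> vertices"
  unfolding triangle_def vertices_def by (elim exE conjE) (auto 4 4 dest: equalityD1)

lemma finite_vertices: "finite vertices"
  unfolding vertices_def using fin finite_ends by auto

lemma finite_blocks: "finite blocks"
proof -
  have "blocks \<subseteq> Pow vertices"
    using triangle_subset by (auto simp: blocks_def isolated_def)
  then show ?thesis using finite_vertices by (meson finite_Pow_iff finite_subset)
qed

lemma blocks_disjoint:
  assumes "A \<in> blocks" "B \<in> blocks" "x \<in> A" "x \<in> B"
  shows "A = B"
proof -
  have "A = B" if "A \<in> isolated" "B \<in> isolated"
    using that assms(3,4) unfolding isolated_def by blast
  then show ?thesis using assms by (auto simp: blocks_def)
qed

lemma blocks_cover: "x \<in> vertices \<Longrightarrow> \<exists>A\<in>blocks. x \<in> A"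
  by (auto simp: blocks_def)

lemma empty_notin_blocks: "{} \<notin> blocks"
  by (auto simp: blocks_def isolated_def triangle_def)

lemma boundary_block: "A \<in> blocks \<Longrightarrow> card (boundary A) \<le> 3"
  using triangle_boundary(1) degree_le by (auto simp: blocks_def isolated_def boundary_singleton)

definition linked :: "'b set \<Rightarrow> 'b set \<Rightarrow> bool" where
  "linked A B \<longleftrightarrow> (\<exists>e\<in>E. en e \<inter> A \<noteq> {} \<and> en e \<inter> B \<noteq> {})"

text \<open>Blocks that need not be matched form a clique, and the empty set serves as an additional such
  block where the parity requires one.\<close>

definition block_adj :: "'b set \<Rightarrow> 'b set \<Rightarrow> bool" where
  "block_adj A B \<longleftrightarrow> A \<noteq> B \<and>
     (linked A B \<or> card (boundary A) \<noteq> 3 \<and> card (boundary B) \<noteq> 3)"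

lemma block_adj_sym: "block_adj A B \<Longrightarrow> block_adj B A"
  by (auto simp: block_adj_def linked_def)

definition even_blocks :: "'b set set" where
  "even_blocks = (if even (card blocks) then blocks else insert {} blocks)"

lemma even_blocks:
  "even (card even_blocks)" "finite even_blocks" "blocks \<subseteq> even_blocks"
  "A \<in> even_blocks \<Longrightarrow> A \<in> blocks \<or> A = {}"
  using finite_blocks empty_notin_blocks by (auto simp: even_blocks_def split: if_splits)

lemma even_blocks_disjoint:
  assumes "A \<in> even_blocks" "B \<in> even_blocks" "x \<in> A" "x \<in> B"
  shows "A = B"
  using assms even_blocks(4) blocks_disjoint by blast

lemma even_blocks_boundary: "A \<in> even_blocks \<Longrightarrow> card (boundary A) \<le> 3"
  using even_blocks(4)[of A] boundary_block by (auto simp: boundary_def)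

text \<open>Here the absence of single-edge cuts enters: an odd number of odd cuts adds up to an odd
  cut, and an odd number other than 1 is at least 3.\<close>

lemma three_le_boundary:
  assumes "finite \<K>" "\<K> \<subseteq> even_blocks" "odd (card \<K>)" "\<And>A. A \<in> \<K> \<Longrightarrow> card (boundary A) = 3"
  shows "3 \<le> card (boundary (\<Union>\<K>))"
proof -
  have "pairwise disjnt \<K>"
    using assms(2) even_blocks_disjoint unfolding pairwise_def disjnt_def by blast
  then have "even (card (boundary (\<Union>\<K>))) \<longleftrightarrow> even (\<Sum>A\<in>\<K>. card (boundary A))"
    by (rule boundary_Union_parity[OF assms(1)])
  also have "(\<Sum>A\<in>\<K>. card (boundary A)) = 3 * card \<K>" using assms(4) by simp
  finally have "odd (card (boundary (\<Union>\<K>)))" using assms(3) by simp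
  moreover have "card (boundary (\<Union>\<K>)) \<noteq> 1" by (rule uncut)
  moreover have "3 \<le> n" if "odd n" "n \<noteq> 1" for n :: nat using that by presburger
  ultimately show ?thesis by metis
qed

lemma boundary_ends:
  assumes "e \<in> boundary K"
  obtains x y where "en e = {x, y}" "x \<in> K" "y \<notin> K" "e \<in> E"
proof -
  obtain x where x: "en e \<inter> K = {x}" and e: "e \<in> E"
    using assms by (auto simp: boundary_def card_1_singleton_iff)
  then obtain y where "en e = {x, y}" "y \<noteq> x" using ends_pair[of e x] by auto
  then show ?thesis using that[of x y] x e by auto
qed

text \<open>Otherwise the deficiency is at least 2 by parity, and the barrier \<open>S\<close>
  leaves at least \<open>card S + 2\<close> odd components. Those made of blocks with boundary 3
  send at least three edges each into \<open>S\<close>, whose blocks accept at most three each, so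
  there are at most \<open>card S\<close> of them. All other blocks are pairwise adjacent and hence
  account for at most one further component.\<close>

lemma perfect_block_pairing: "deficiency block_adj even_blocks = 0"
proof (rule ccontr)
  assume ne: "deficiency block_adj even_blocks \<noteq> 0"
  have "even (deficiency block_adj even_blocks)"
    using pairing_deficiency_parity[OF even_blocks(2), of block_adj] even_blocks(1) by simp
  moreover have "2 \<le> n" if "even n" "n \<noteq> 0" for n :: nat using that by presburger
  ultimately have ge: "2 \<le> deficiency block_adj even_blocks" using ne by blast
  have "\<exists>S U. S \<subseteq> even_blocks \<and> U \<subseteq> even_blocks - S \<and>
      deficiency block_adj even_blocks + card S \<le> card U \<and>
      (\<forall>u\<in>U. odd (card ((edges_off block_adj (even_blocks - S))\<^sup>* `` {u}))) \<and>
      (\<forall>u\<in>U. \<forall>v\<in>U. u \<noteq> v \<longrightarrow> (edges_off block_adj (even_blocks - S))\<^sup>* `` {u} \<inter>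
         (edges_off block_adj (even_blocks - S))\<^sup>* `` {v} = {})"
    using even_blocks(2) block_adj_sym by (rule berge_barrier)
  then obtain S U where S: "S \<subseteq> even_blocks" and U: "U \<subseteq> even_blocks - S"
    and card: "deficiency block_adj even_blocks + card S \<le> card U"
    and odd: "\<forall>u\<in>U. odd (card ((edges_off block_adj (even_blocks - S))\<^sup>* `` {u}))"
    and disj: "\<forall>u\<in>U. \<forall>v\<in>U. u \<noteq> v \<longrightarrow> (edges_off block_adj (even_blocks - S))\<^sup>* `` {u} \<inter>
         (edges_off block_adj (even_blocks - S))\<^sup>* `` {v} = {}"
    by (elim exE conjE) (rule that)
  define R where "R = edges_off block_adj (even_blocks - S)"
  define K where "K u = R\<^sup>* `` {u}" for u
  have K_sub: "K u \<subseteq> even_blocks - S" if "u \<in> U" for u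
  proof
    fix A assume "A \<in> K u"
    then have "(u, A) \<in> R\<^sup>*" by (simp add: K_def)
    then show "A \<in> even_blocks - S"
      using that U by (induction rule: rtrancl_induct) (auto simp: R_def edges_off_def)
  qed
  have K_closed: "B \<in> K u" if "A \<in> K u" "block_adj A B" "B \<in> even_blocks - S" "u \<in> U" for A B u
  proof -
    have "(A, B) \<in> R" using that K_sub by (auto simp: R_def edges_off_def)
    then show ?thesis using that(1) by (auto simp: K_def intro: rtrancl_into_rtrancl)
  qed
  have K_disj: "u = v" if "A \<in> K u" "A \<in> K v" "u \<in> U" "v \<in> U" for A u v
    using disj that unfolding K_def R_def by blast
  have finU: "finite U" using U even_blocks(2) by (meson finite_Diff finite_subset)
  have finS: "finite S" using S even_blocks(2) by (rule finite_subset)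
  define U1 where "U1 = {u \<in> U. \<exists>A\<in>K u. card (boundary A) \<noteq> 3}"
  have "card U1 \<le> 1"
  proof -
    have "u = v" if u: "u \<in> U1" and v: "v \<in> U1" for u v
    proof -
      obtain A where A: "A \<in> K u" "card (boundary A) \<noteq> 3" "u \<in> U" using u by (auto simp: U1_def)
      obtain B where B: "B \<in> K v" "card (boundary B) \<noteq> 3" "v \<in> U" using v by (auto simp: U1_def)
      show ?thesis
      proof (cases "A = B")
        case True
        then show ?thesis using K_disj A B by blast
      next
        case False
        then have "B \<in> K u" using K_closed[OF A(1) _ _ A(3)] A B K_sub by (auto simp: block_adj_def)
        then show ?thesis using K_disj A B by blast
      qed
    qed
    moreover have "finite U1" using finU by (simp add: U1_def)
    ultimately show ?thesis by (auto simp: card_le_Suc0_iff_eq)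
  qed
  define W where "W u = boundary (\<Union>(K u))" for u
  \<comment> \<open>A cut edge of a component leads to a block outside it, and an adjacent block
    outside \<open>S\<close> would belong to the component.\<close>
  have edge: "\<exists>A\<in>K u. \<exists>B\<in>S. \<exists>x\<in>A. \<exists>y\<in>B. en e = {x, y} \<and> e \<in> boundary B"
    if u: "u \<in> U" and e: "e \<in> W u" for u e
  proof -
    obtain x y where xy: "en e = {x, y}" "x \<in> \<Union>(K u)" "y \<notin> \<Union>(K u)" "e \<in> E"
      using e boundary_ends unfolding W_def by blast
    then obtain A where A: "A \<in> K u" "x \<in> A" by blast
    have "y \<in> vertices" using xy by (auto simp: vertices_def)
    then obtain B where B: "B \<in> blocks" "y \<in> B" using blocks_cover by blast
    have "A \<noteq> B" "B \<notin> K u" using xy A B by auto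
    moreover have "linked A B" using xy A B by (auto simp: linked_def)
    ultimately have "B \<in> S"
      using K_closed[OF A(1) _ _ u, of B] B even_blocks(3) by (auto simp: block_adj_def)
    moreover have "x \<notin> B"
      using even_blocks_disjoint[of A B x] A B even_blocks(3) K_sub[OF u] \<open>A \<noteq> B\<close> by blast
    then have "en e \<inter> B = {y}" using xy B by auto
    then have "e \<in> boundary B" using xy by (simp add: boundary_def)
    ultimately show ?thesis using A B xy by blast
  qed
  have "3 * card (U - U1) \<le> (\<Sum>u\<in>U - U1. card (W u))"
  proof -
    have "3 \<le> card (W u)" if "u \<in> U - U1" for u
      unfolding W_def
    proof (rule three_le_boundary)
      show "finite (K u)" using K_sub[of u] that even_blocks(2) by (meson DiffD1 finite_Diff finite_subset)
      show "K u \<subseteq> even_blocks" using K_sub[of u] that by auto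
      show "odd (card (K u))" using odd that by (simp add: K_def R_def)
      show "card (boundary A) = 3" if "A \<in> K u" for A
        using that \<open>u \<in> U - U1\<close> by (auto simp: U1_def)
    qed
    then show ?thesis using sum_bounded_below[of "U - U1" 3 "\<lambda>u. card (W u)"] by simp
  qed
  also have "\<dots> = card (\<Union>u\<in>U - U1. W u)"
  proof (rule card_UN_disjoint[symmetric])
    show "\<forall>i\<in>U - U1. \<forall>j\<in>U - U1. i \<noteq> j \<longrightarrow> W i \<inter> W j = {}"
    proof (intro ballI impI)
      fix u v assume uv: "u \<in> U - U1" "v \<in> U - U1" "u \<noteq> v"
      have False if e: "e \<in> W u" "e \<in> W v" for e
      proof -
        obtain A B x y where 1: "A \<in> K u" "B \<in> S" "x \<in> A" "y \<in> B" "en e = {x, y}"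
          using edge[of u e] uv e by blast
        obtain A' B' x' y' where 2: "A' \<in> K v" "B' \<in> S" "x' \<in> A'" "y' \<in> B'" "en e = {x', y'}"
          using edge[of v e] uv e by blast
        have blk: "A \<in> even_blocks - S" "A' \<in> even_blocks - S" using K_sub uv 1 2 by blast+
        have "x = x' \<or> x = y'" using 1(5) 2(5) by auto
        then show False
        proof
          assume "x = x'"
          then have "A = A'" using even_blocks_disjoint[of A A' x] blk 1 2 by blast
          then show False using K_disj 1 2 uv by blast
        next
          assume "x = y'"
          then have "A = B'" using even_blocks_disjoint[of A B' x] blk 1 2 S by blast
          then show False using blk 2 by blast
        qed
      qed
      then show "W u \<inter> W v = {}" by blast
    qed
  qed (use finU in \<open>auto simp: W_def\<close>)
  also have "\<dots> \<le> card (\<Union>B\<in>S. boundary B)"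
    using edge finS by (intro card_mono) (auto, blast)
  also have "\<dots> \<le> (\<Sum>B\<in>S. card (boundary B))" by (rule card_UN_le[OF finS])
  also have "\<dots> \<le> 3 * card S"
  proof -
    have "card (boundary B) \<le> 3" if "B \<in> S" for B using even_blocks_boundary S that by blast
    then show ?thesis using sum_bounded_above[of S "\<lambda>B. card (boundary B)" 3] by simp
  qed
  finally have "card (U - U1) \<le> card S" by simp
  moreover have "card U \<le> card (U - U1) + card U1"
    using diff_card_le_card_Diff[of U1 U] finU by (simp add: U1_def)
  ultimately show False using card ge \<open>card U1 \<le> 1\<close> by simp
qed

text \<open>The defining condition is symmetric, so that both partners of a pair of blocks select
  the same edge.\<close>

definition chosen :: "'b set \<Rightarrow> 'b set \<Rightarrow> 'a" where
  "chosen A B = (SOME e. e \<in> E \<and> en e \<inter> A \<noteq> {} \<and> en e \<inter> B \<noteq> {})"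

lemma chosen_commute: "chosen A B = chosen B A"
  unfolding chosen_def by (rule arg_cong[where f = Eps]) auto

lemma chosen:
  assumes "A \<in> blocks" "B \<in> blocks" "A \<noteq> B" "linked A B"
  obtains x y where "chosen A B \<in> E" "en (chosen A B) = {x, y}" "x \<in> A" "y \<in> B"
proof -
  have "\<exists>e. e \<in> E \<and> en e \<inter> A \<noteq> {} \<and> en e \<inter> B \<noteq> {}"
    using assms(4) by (auto simp: linked_def)
  then have e: "chosen A B \<in> E \<and> en (chosen A B) \<inter> A \<noteq> {} \<and> en (chosen A B) \<inter> B \<noteq> {}"
    unfolding chosen_def by (rule someI_ex)
  then obtain x y where xy: "x \<in> en (chosen A B)" "x \<in> A" "y \<in> en (chosen A B)" "y \<in> B" by blast
  then have "x \<noteq> y" using blocks_disjoint assms by blast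
  moreover obtain w where "en (chosen A B) = {x, w}" using ends_pair e xy(1) by metis
  ultimately have "en (chosen A B) = {x, y}" using xy by auto
  then show ?thesis using that e xy by blast
qed

lemma isolated_inner_edge:
  assumes T: "triangle T" and w: "w \<in> T"
  shows "\<exists>e\<in>E. en e = T - {w}"
proof -
  obtain a b c where abc: "T = {a, b, c}" "a \<noteq> b" "b \<noteq> c" "a \<noteq> c"
    "{a, b} \<in> en ` E" "{b, c} \<in> en ` E" "{a, c} \<in> en ` E"
    using T unfolding triangle_def by blast
  then consider "w = a" "T - {w} = {b, c}" | "w = b" "T - {w} = {a, c}" | "w = c" "T - {w} = {a, b}"
    using w by blast
  then have "T - {w} \<in> en ` E" using abc by cases simp_all
  then show ?thesis by (metis imageE)
qed

text \<open>Two triangles sharing only the vertex \<open>v\<close> would give it degree 4, so they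
  share an edge \<open>vp\<close>.\<close>

lemma overlapping_triangles:
  assumes T: "triangle T" "triangle T'" "T \<noteq> T'" "v \<in> T" "v \<in> T'"
  obtains p q s where "T = {v, p, q}" "T' = {v, p, s}" "v \<noteq> p" "v \<noteq> q" "p \<noteq> q" "s \<notin> T"
proof -
  note result = that
  have rep: "\<exists>p q. T = {v, p, q} \<and> v \<noteq> p \<and> v \<noteq> q \<and> p \<noteq> q \<and> {v, p} \<in> en ` E \<and> {v, q} \<in> en ` E"
    if t: "triangle T" "v \<in> T" for T
  proof -
    obtain a b c where abc: "T = {a, b, c}" "a \<noteq> b" "b \<noteq> c" "a \<noteq> c"
      "{a, b} \<in> en ` E" "{b, c} \<in> en ` E" "{a, c} \<in> en ` E"
      using t(1) unfolding triangle_def by blast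
    then consider "v = a" | "v = b" | "v = c" using t(2) by blast
    then show ?thesis
    proof cases
      case 1 then show ?thesis using abc by blast
    next
      case 2 then show ?thesis using abc by (intro exI[of _ a] exI[of _ c]) (simp add: insert_commute)
    next
      case 3 then show ?thesis using abc by (intro exI[of _ a] exI[of _ b]) (simp add: insert_commute)
    qed
  qed
  obtain p q where pq: "T = {v, p, q}" "v \<noteq> p" "v \<noteq> q" "p \<noteq> q" "{v, p} \<in> en ` E" "{v, q} \<in> en ` E"
    using rep[OF T(1,4)] by blast
  obtain r s where rs: "T' = {v, r, s}" "v \<noteq> r" "v \<noteq> s" "r \<noteq> s" "{v, r} \<in> en ` E" "{v, s} \<in> en ` E"
    using rep[OF T(2,5)] by blast
  have "{p, q} \<inter> {r, s} \<noteq> {}"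
  proof
    assume d: "{p, q} \<inter> {r, s} = {}"
    obtain e1 where e1: "e1 \<in> E" "en e1 = {v, p}" using pq by (metis imageE)
    obtain e2 where e2: "e2 \<in> E" "en e2 = {v, q}" using pq by (metis imageE)
    obtain e3 where e3: "e3 \<in> E" "en e3 = {v, r}" using rs by (metis imageE)
    obtain e4 where e4: "e4 \<in> E" "en e4 = {v, s}" using rs by (metis imageE)
    have ne: "e1 \<noteq> e2" "e1 \<noteq> e3" "e1 \<noteq> e4" "e2 \<noteq> e3" "e2 \<noteq> e4" "e3 \<noteq> e4"
    proof -
      have "e \<noteq> f" if "en e = {v, x}" "en f = {v, y}" "x \<noteq> y" for e f x y
        using that by (metis doubleton_eq_iff)
      moreover have "p \<noteq> r" "p \<noteq> s" "q \<noteq> r" "q \<noteq> s" using d by auto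
      ultimately show "e1 \<noteq> e2" "e1 \<noteq> e3" "e1 \<noteq> e4" "e2 \<noteq> e3" "e2 \<noteq> e4" "e3 \<noteq> e4"
        using e1(2) e2(2) e3(2) e4(2) pq(4) rs(4) by blast+
    qed
    have "card {e1, e2, e3, e4} = 4" using ne by simp
    moreover have "{e1, e2, e3, e4} \<subseteq> star v" using e1 e2 e3 e4 by (auto simp: star_def)
    ultimately show False using degree_less_4[of "{e1, e2, e3, e4}" v] by simp
  qed
  then consider "p = r" | "p = s" | "q = r" | "q = s" by blast
  moreover have that2: thesis if abc: "T = {v, a, b}" "T' = {v, a, c}" "v \<noteq> a" "v \<noteq> b" "a \<noteq> b" "v \<noteq> c" "a \<noteq> c" for a b c
  proof -
    have "c \<noteq> b" using abc(1,2) T(3) by blast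
    then show thesis using result[OF abc(1-5)] abc by simp
  qed
  ultimately show thesis
  proof cases
    case 1
    with that2[of p q s] pq rs show thesis by simp
  next
    case 2
    with that2[of p q r] pq rs show thesis by (simp add: insert_commute)
  next
    case 3
    with that2[of q p s] pq rs show thesis by (simp add: insert_commute)
  next
    case 4
    with that2[of q p r] pq rs show thesis by (simp add: insert_commute)
  qed
qed

text \<open>Pairs of blocks are realised by edges whenever one partner must be matched; this covers
  every vertex of degree 3 outside the isolated triangles. The selected edges meet an isolated
  triangle in at most one vertex \<open>w\<close>, so the edge opposite \<open>w\<close> can be
  added inside.\<close>

theorem triangle_hitting_matching:
  obtains M where "M \<subseteq> E" "\<And>e f. e \<in> M \<Longrightarrow> f \<in> M \<Longrightarrow> e \<noteq> f \<Longrightarrow> en e \<inter> en f = {}"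
    "\<And>v. card (star v) = 3 \<Longrightarrow> \<exists>e\<in>M. v \<in> en e"
    "\<And>T. triangle T \<Longrightarrow> \<exists>e\<in>M. en e \<subseteq> T"
proof -
  obtain \<pi> where "maximum_pairing block_adj even_blocks \<pi>" using maximum_pairing_exists by blast
  then have p: "pairing block_adj even_blocks \<pi>" and "card (unmatched even_blocks \<pi>) = 0"
    by (auto simp: maximum_pairing_def perfect_block_pairing)
  then have nofix: "\<pi> A \<noteq> A" if "A \<in> even_blocks" for A
    using that even_blocks(2) by (auto simp: unmatched_def)
  have \<pi>: "\<pi> A \<in> even_blocks" "\<pi> (\<pi> A) = A" "block_adj A (\<pi> A)" if "A \<in> even_blocks" for A
    using p nofix[OF that] that by (auto simp: pairing_def)
  define must where "must = {A \<in> blocks. card (boundary A) = 3}"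
  have must: "A \<in> blocks" "\<pi> A \<in> blocks" "\<pi> A \<noteq> A" "linked A (\<pi> A)" "\<pi> (\<pi> A) = A" if "A \<in> must" for A
  proof -
    show A: "A \<in> blocks" using that by (simp add: must_def)
    then have AX: "A \<in> even_blocks" using even_blocks(3) by blast
    show "\<pi> A \<noteq> A" by (rule nofix[OF AX])
    show l: "linked A (\<pi> A)" using \<pi>(3)[OF AX] that by (auto simp: block_adj_def must_def)
    show "\<pi> (\<pi> A) = A" by (rule \<pi>(2)[OF AX])
    show "\<pi> A \<in> blocks" using \<pi>(1)[OF AX] even_blocks(4) l by (auto simp: linked_def)
  qed
  define pick where "pick A = chosen A (\<pi> A)" for A
  have pick: "\<exists>x y. pick A \<in> E \<and> en (pick A) = {x, y} \<and> x \<in> A \<and> y \<in> \<pi> A" if "A \<in> must" for A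
    using chosen[of A "\<pi> A"] must[OF that] unfolding pick_def by metis
  define M0 where "M0 = pick ` must"
  have pick_eq: "pick A = pick B" if h: "A \<in> must" "B \<in> must" "x \<in> en (pick A)" "x \<in> C" "C \<in> blocks"
    "z \<in> en (pick B)" "z \<in> C" for A B C x z
  proof -
    obtain a b where ab: "en (pick A) = {a, b}" "a \<in> A" "b \<in> \<pi> A" using pick h(1) by blast
    obtain c d where cd: "en (pick B) = {c, d}" "c \<in> B" "d \<in> \<pi> B" using pick h(2) by blast
    have "x = a \<or> x = b" using h(3) ab(1) by simp
    then have "C = A \<or> C = \<pi> A"
      using blocks_disjoint[OF h(5) must(1)[OF h(1)] h(4)] blocks_disjoint[OF h(5) must(2)[OF h(1)] h(4)] ab
      by blast
    moreover have "z = c \<or> z = d" using h(6) cd(1) by simp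
    then have "C = B \<or> C = \<pi> B"
      using blocks_disjoint[OF h(5) must(1)[OF h(2)] h(7)] blocks_disjoint[OF h(5) must(2)[OF h(2)] h(7)] cd
      by blast
    ultimately have "B = A \<or> B = \<pi> A" using must(5) h(1,2) by metis
    then show ?thesis
    proof
      assume "B = \<pi> A"
      then show ?thesis using must(5)[OF h(1)] chosen_commute by (simp add: pick_def)
    qed simp
  qed
  \<comment> \<open>\<open>w\<close> is the vertex that the inner edge may leave out: no selected
    edge meets the triangle elsewhere, and \<open>w\<close> is covered already or has degree below
    3.\<close>
  define special where "special T w \<longleftrightarrow> w \<in> T \<and> (\<forall>e\<in>M0. en e \<inter> T \<subseteq> {w}) \<and>
      ((\<exists>e\<in>M0. w \<in> en e) \<or> card (star w) \<noteq> 3)" for T w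
  have special: "\<exists>w. special T w" if T: "T \<in> isolated" for T
  proof (cases "\<exists>e\<in>M0. en e \<inter> T \<noteq> {}")
    case True
    then obtain A w where A: "A \<in> must" "w \<in> en (pick A)" "w \<in> T" by (auto simp: M0_def)
    have TB: "T \<in> blocks" using T by (simp add: blocks_def)
    have "en (pick B) \<inter> T \<subseteq> {w}" if B: "B \<in> must" for B
    proof
      fix z assume z: "z \<in> en (pick B) \<inter> T"
      then have eq: "pick A = pick B" using pick_eq[OF A(1) B A(2,3) TB] by blast
      obtain x y where xy: "en (pick B) = {x, y}" "x \<in> B" "y \<in> \<pi> B" using pick[OF B] by blast
      have "x \<notin> T \<or> y \<notin> T"
        using blocks_disjoint[OF TB must(1)[OF B]] blocks_disjoint[OF TB must(2)[OF B]] xy must(3)[OF B] by blast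
      then show "z \<in> {w}" using z A xy eq by auto
    qed
    then have "special T w" using A by (auto simp: special_def M0_def)
    then show ?thesis by blast
  next
    case False
    have tri: "triangle T" using T by (simp add: isolated_def)
    have "T \<notin> must" using False pick by (fastforce simp: M0_def)
    then have "card (boundary T) \<noteq> 3" using T by (simp add: must_def blocks_def)
    then obtain w where "w \<in> T" "card (star w) \<noteq> 3" using triangle_boundary(2)[OF tri] by blast
    then have "special T w" using False by (auto simp: special_def)
    then show ?thesis by blast
  qed
  then obtain w where w: "\<And>T. T \<in> isolated \<Longrightarrow> special T (w T)" by metis
  have "\<forall>T\<in>isolated. \<exists>e\<in>E. en e = T - {w T}"
    using isolated_inner_edge w by (auto simp: isolated_def special_def)
  then obtain i where i: "\<And>T. T \<in> isolated \<Longrightarrow> i T \<in> E \<and> en (i T) = T - {w T}" by metis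
  define M where "M = M0 \<union> i ` isolated"
  have ME: "M \<subseteq> E" using pick i by (auto simp: M_def M0_def)
  have M00: "en e \<inter> en f = {}" if ef: "e \<in> M0" "f \<in> M0" "e \<noteq> f" for e f
  proof -
    obtain A B where AB: "A \<in> must" "B \<in> must" "e = pick A" "f = pick B" using ef by (auto simp: M0_def)
    have False if x: "x \<in> en e" "x \<in> en f" for x
    proof -
      have "x \<in> vertices" using x(1) ef(1) ME by (auto simp: vertices_def M_def)
      then obtain C where "C \<in> blocks" "x \<in> C" using blocks_cover by blast
      then show False using pick_eq[OF AB(1,2)] AB x ef(3) by blast
    qed
    then show ?thesis by blast
  qed
  have M01: "en e \<inter> en (i T) = {}" if "e \<in> M0" "T \<in> isolated" for e T
    using w[OF that(2)] i[OF that(2)] that(1) by (auto simp: special_def)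
  have M11: "en (i T) \<inter> en (i T') = {}" if "T \<in> isolated" "T' \<in> isolated" "i T \<noteq> i T'" for T T'
  proof -
    have "T \<noteq> T'" using that(3) by blast
    then have "T \<inter> T' = {}" using that(1,2) unfolding isolated_def by blast
    then show ?thesis using i that by blast
  qed
  have matching: "en e \<inter> en f = {}" if ef: "e \<in> M" "f \<in> M" "e \<noteq> f" for e f
  proof -
    consider "e \<in> M0" "f \<in> M0" | T where "e \<in> M0" "T \<in> isolated" "f = i T"
      | T where "f \<in> M0" "T \<in> isolated" "e = i T"
      | T T' where "T \<in> isolated" "T' \<in> isolated" "e = i T" "f = i T'"
      using ef(1,2) unfolding M_def by blast
    then show ?thesis
    proof cases
      case 1 then show ?thesis using M00 ef(3) by blast
    next
      case 2 then show ?thesis using M01 by blast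
    next
      case 3 then show ?thesis using M01 by blast
    next
      case 4 then show ?thesis using M11 ef(3) by blast
    qed
  qed
  have cover: "\<exists>e\<in>M. v \<in> en e" if v: "card (star v) = 3" for v
  proof -
    have "star v \<noteq> {}" using v by auto
    then have "v \<in> vertices" by (auto simp: vertices_def star_def)
    then obtain A where A: "A \<in> blocks" "v \<in> A" using blocks_cover by blast
    show ?thesis
    proof (cases "A \<in> isolated")
      case True
      show ?thesis
      proof (cases "v = w A")
        case True
        then have "\<exists>e\<in>M0. v \<in> en e" using w[OF \<open>A \<in> isolated\<close>] v by (auto simp: special_def)
        then show ?thesis by (auto simp: M_def)
      next
        case False
        then have "v \<in> en (i A)" using i[OF True] A by blast
        then show ?thesis using True by (auto simp: M_def)
      qed
    next
      case False
      then have "A = {v}" using A by (auto simp: blocks_def)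
      then have "A \<in> must" using A v by (simp add: must_def boundary_singleton)
      then obtain x y where "en (pick A) = {x, y}" "x \<in> A" using pick by blast
      then have "v \<in> en (pick A)" using \<open>A = {v}\<close> by simp
      then show ?thesis using \<open>A \<in> must\<close> by (auto simp: M_def M0_def)
    qed
  qed
  have hits: "\<exists>e\<in>M. en e \<subseteq> T" if T: "triangle T" for T
  proof (cases "T \<in> isolated")
    case True
    then show ?thesis using i by (auto simp: M_def)
  next
    case False
    then obtain T' v where T': "triangle T'" "T \<noteq> T'" "v \<in> T" "v \<in> T'"
      using T unfolding isolated_def by blast
    then obtain p q s where pqs: "T = {v, p, q}" "T' = {v, p, s}" "v \<noteq> p" "v \<noteq> q" "p \<noteq> q" "s \<notin> T"
      using overlapping_triangles[OF T T'(1)] by metis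
    \<comment> \<open>If no matching edge lies in \<open>T\<close>, then both ends of the common
      edge \<open>vp\<close> must be covered by their third edge, which leads to \<open>s\<close>;
      these two matching edges would meet at \<open>s\<close>.\<close>
    have touch: "\<exists>e\<in>M. u \<in> en e \<and> en e \<subseteq> T \<or> (\<exists>e\<in>M. en e = {u, s})" if u: "u \<in> {v, p}" for u
    proof -
      have uT: "u \<in> T" "u \<in> T'" using u pqs by auto
      have "{u, s} \<in> en ` E"
      proof -
        define z where "z = (if u = v then p else v)"
        have "T' - {z} = {u, s}" "z \<in> T'" using pqs u by (auto simp: z_def)
        then show ?thesis using isolated_inner_edge[OF T'(1), of z] by auto
      qed
      then obtain g where g: "g \<in> E" "en g = {u, s}" by (metis imageE)
      have gb: "g \<in> {e \<in> boundary T. u \<in> en e}"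
      proof -
        have "en g \<inter> T = {u}" using g pqs uT by auto
        then show ?thesis using g by (simp add: boundary_def)
      qed
      have fb: "finite {e \<in> boundary T. u \<in> en e}" by simp
      have "0 < card {e \<in> boundary T. u \<in> en e}" using gb fb card_gt_0_iff by blast
      then have c: "card (star u) = 3" "card {e \<in> boundary T. u \<in> en e} = 1"
        using triangle_vertex(2)[OF T uT(1)] degree_le[of u] by auto
      obtain e where e: "e \<in> M" "u \<in> en e" using cover[OF c(1)] by blast
      show ?thesis
      proof (cases "en e \<subseteq> T")
        case False
        obtain w where w: "en e = {u, w}" using ends_pair[of e u] e ME by blast
        then have "en e \<inter> T = {u}" using False uT by auto
        then have "e \<in> {e \<in> boundary T. u \<in> en e}" using e ME by (auto simp: boundary_def)
        then have "e = g" using gb c(2) by (metis card_1_singletonE singletonD)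
        then show ?thesis using e g by blast
      qed (use e in blast)
    qed
    show ?thesis
    proof (rule ccontr)
      assume no: "\<not> ?thesis"
      obtain e1 where e1: "e1 \<in> M" "en e1 = {v, s}" using touch[of v] no by blast
      obtain e2 where e2: "e2 \<in> M" "en e2 = {p, s}" using touch[of p] no by blast
      have "e1 \<noteq> e2" using e1 e2 pqs by (auto simp: doubleton_eq_iff)
      then show False using matching[OF e1(1) e2(1)] e1 e2 by blast
    qed
  qed
  show thesis using that[OF ME matching cover hits] .
qed

end

section \<open>Colouring paths and cycles\<close>

text \<open>The induced path or cycle traced by a list; the ends of a path are allowed to be adjacent.\<close>

definition ring :: "('a \<Rightarrow> 'a \<Rightarrow> bool) \<Rightarrow> 'a list \<Rightarrow> bool" where
  "ring R xs \<longleftrightarrow> xs \<noteq> [] \<and> distinct xs \<and> (\<forall>i. Suc i < length xs \<longrightarrow> R (xs ! i) (xs ! Suc i)) \<and>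
     (\<forall>i j. i < j \<longrightarrow> j < length xs \<longrightarrow> R (xs ! i) (xs ! j) \<longrightarrow> j = Suc i \<or> i = 0 \<and> Suc j = length xs)"

text \<open>Take a longest path. Its inner vertices have used up both neighbours, and an outside
  neighbour of an end would prolong it. So it fills a component, and its only further adjacency can
  be between its ends.\<close>

lemma ring_component:
  assumes fin: "finite X" and ne: "X \<noteq> {}" and sym: "\<And>x y. R x y \<Longrightarrow> R y x"
    and deg: "\<And>x. x \<in> X \<Longrightarrow> card {y \<in> X. R x y} \<le> 2"
  shows "\<exists>xs. ring R xs \<and> set xs \<subseteq> X \<and> (\<forall>x\<in>set xs. \<forall>y\<in>X. R x y \<longrightarrow> y \<in> set xs)"
proof -
  define P where "P xs \<longleftrightarrow> xs \<noteq> [] \<and> distinct xs \<and> set xs \<subseteq> X \<and>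
     (\<forall>i. Suc i < length xs \<longrightarrow> R (xs ! i) (xs ! Suc i))" for xs
  obtain a where "a \<in> X" using ne by blast
  then have "P [a]" by (simp add: P_def)
  moreover have "length xs < Suc (card X)" if "P xs" for xs
    using that fin by (metis P_def card_mono distinct_card less_Suc_eq_le)
  ultimately obtain xs where xs: "P xs" and max: "\<And>ys. P ys \<Longrightarrow> length ys \<le> length xs"
    using ex_has_greatest_nat[of P "[a]" length "Suc (card X)"] by auto
  define n where "n = length xs"
  have n: "0 < n" and dist: "distinct xs" and sub: "set xs \<subseteq> X"
    and path: "\<And>i. Suc i < n \<Longrightarrow> R (xs ! i) (xs ! Suc i)"
    using xs by (auto simp: P_def n_def)
  have inX: "xs ! i \<in> X" if "i < n" for i using sub that nth_mem n_def by blast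
  have inner: "y = xs ! (i - 1) \<or> y = xs ! Suc i"
    if i: "0 < i" "Suc i < n" and y: "y \<in> X" "R (xs ! i) y" for i y
  proof -
    have "{xs ! (i - 1), xs ! Suc i} \<subseteq> {y \<in> X. R (xs ! i) y}"
      using path[of "i - 1"] path[of i] i inX[of "i - 1"] inX[of "Suc i"] sym by auto
    moreover have "card {xs ! (i - 1), xs ! Suc i} = 2"
      using i dist by (simp add: n_def nth_eq_iff_index_eq)
    moreover have "finite {y \<in> X. R (xs ! i) y}" using fin by simp
    ultimately have "{xs ! (i - 1), xs ! Suc i} = {y \<in> X. R (xs ! i) y}"
      using deg[OF inX[of i]] i by (intro card_seteq) auto
    then show ?thesis using y by blast
  qed
  have closed: "y \<in> set xs" if x: "x \<in> set xs" and y: "y \<in> X" "R x y" for x y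
  proof (rule ccontr)
    assume out: "y \<notin> set xs"
    obtain i where i: "x = xs ! i" "i < n" using x by (metis in_set_conv_nth n_def)
    consider "i = 0" | "Suc i = n" | "0 < i" "Suc i < n" using i(2) by linarith
    then show False
    proof cases
      case 1
      have "P (y # xs)"
        unfolding P_def
      proof (intro conjI allI impI)
        fix j assume j: "Suc j < length (y # xs)"
        show "R ((y # xs) ! j) ((y # xs) ! Suc j)"
          using 1 i y sym path[of "j - 1"] j by (cases j) (auto simp: n_def)
      qed (use out dist sub y in auto)
      then show False using max by fastforce
    next
      case 2
      have "P (xs @ [y])"
        unfolding P_def
      proof (intro conjI allI impI)
        fix j assume j: "Suc j < length (xs @ [y])"
        show "R ((xs @ [y]) ! j) ((xs @ [y]) ! Suc j)"
        proof (cases "Suc j = n")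
          case True
          then have "j = i" using 2 by simp
          then show ?thesis using 2 i y by (simp add: nth_append n_def)
        next
          case False
          then show ?thesis using path[of j] j by (simp add: nth_append n_def)
        qed
      qed (use out dist sub y in auto)
      then show False using max by fastforce
    next
      case 3
      then have "y = xs ! (i - 1) \<or> y = xs ! Suc i" using inner y i by blast
      then show False using out 3 by (auto simp: n_def)
    qed
  qed
  have "ring R xs"
    unfolding ring_def
  proof (intro conjI allI impI)
    fix i j assume ij: "i < j" "j < length xs" "R (xs ! i) (xs ! j)"
    show "j = Suc i \<or> i = 0 \<and> Suc j = length xs"
    proof (cases "i = 0")
      case True
      show ?thesis
      proof (cases "Suc j = n")
        case False
        then have "xs ! i = xs ! (j - 1) \<or> xs ! i = xs ! Suc j"
          using ij sym inX[of i] by (intro inner) (auto simp: n_def)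
        moreover have "Suc j < length xs" using False ij by (simp add: n_def)
        ultimately have "j - 1 = i \<or> Suc j = i"
          using ij nth_eq_iff_index_eq[OF dist, of i "j - 1"] nth_eq_iff_index_eq[OF dist, of i "Suc j"] by auto
        then show ?thesis using ij by auto
      qed (use True n_def in auto)
    next
      case False
      then have "xs ! j = xs ! (i - 1) \<or> xs ! j = xs ! Suc i"
        using ij inX[of j] by (intro inner) (auto simp: n_def)
      then show ?thesis using dist ij False by (auto simp: n_def nth_eq_iff_index_eq)
    qed
  qed (use n dist path n_def in auto)
  then show ?thesis using sub closed by blast
qed

lemma ring_decomposition:
  assumes "finite X" and sym: "\<And>x y. R x y \<Longrightarrow> R y x"
    and "\<And>x. x \<in> X \<Longrightarrow> card {y \<in> X. R x y} \<le> 2"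
  shows "\<exists>\<D>. finite \<D> \<and> (\<forall>xs\<in>\<D>. ring R xs) \<and> \<Union>(set ` \<D>) = X \<and>
     (\<forall>xs\<in>\<D>. \<forall>ys\<in>\<D>. xs \<noteq> ys \<longrightarrow> (\<forall>x\<in>set xs. \<forall>y\<in>set ys. x \<noteq> y \<and> \<not> R x y))"
  using assms(1,3)
proof (induction "card X" arbitrary: X rule: less_induct)
  case less
  show ?case
  proof (cases "X = {}")
    case False
    obtain xs where xs: "ring R xs" "set xs \<subseteq> X" "\<And>x y. x \<in> set xs \<Longrightarrow> y \<in> X \<Longrightarrow> R x y \<Longrightarrow> y \<in> set xs"
      using ring_component[of X R] less.prems False sym by blast
    define Y where "Y = X - set xs"
    obtain x where "x \<in> set xs" using xs(1) by (cases xs) (auto simp: ring_def)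
    then have "x \<in> X" "x \<notin> Y" using xs(2) by (auto simp: Y_def)
    then have "Y \<subset> X" by (auto simp: Y_def)
    then have cardY: "card Y < card X" using less.prems(1) by (simp add: psubset_card_mono)
    have finY: "finite Y" using less.prems(1) by (simp add: Y_def)
    have degY: "card {y \<in> Y. R x y} \<le> 2" if "x \<in> Y" for x
    proof -
      have "card {y \<in> Y. R x y} \<le> card {y \<in> X. R x y}"
        using less.prems(1) by (intro card_mono) (auto simp: Y_def)
      then show ?thesis using less.prems(2)[of x] that by (simp add: Y_def)
    qed
    obtain \<D> where \<D>: "finite \<D>" "\<forall>xs\<in>\<D>. ring R xs" "\<Union>(set ` \<D>) = Y"
      "\<forall>xs\<in>\<D>. \<forall>ys\<in>\<D>. xs \<noteq> ys \<longrightarrow> (\<forall>x\<in>set xs. \<forall>y\<in>set ys. x \<noteq> y \<and> \<not> R x y)"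
      by (rule exE[OF less.hyps[OF cardY finY degY]]) (assumption, elim conjE, rule that)
    have cross: "x \<noteq> y \<and> \<not> R x y \<and> \<not> R y x" if "x \<in> set xs" "ys \<in> \<D>" "y \<in> set ys" for x y ys
    proof -
      have "y \<in> Y" using that \<D>(3) by blast
      then show ?thesis using xs(3)[OF that(1), of y] that(1) sym by (auto simp: Y_def)
    qed
    show ?thesis
    proof (intro exI[of _ "insert xs \<D>"] conjI)
      show "\<Union>(set ` insert xs \<D>) = X" using \<D>(3) xs(2) by (auto simp: Y_def)
      show "\<forall>a\<in>insert xs \<D>. \<forall>b\<in>insert xs \<D>. a \<noteq> b \<longrightarrow> (\<forall>x\<in>set a. \<forall>y\<in>set b. x \<noteq> y \<and> \<not> R x y)"
      proof (intro ballI impI)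
        fix a b x y
        assume h: "a \<in> insert xs \<D>" "b \<in> insert xs \<D>" "a \<noteq> b" "x \<in> set a" "y \<in> set b"
        consider "a = xs" "b \<in> \<D>" | "b = xs" "a \<in> \<D>" | "a \<in> \<D>" "b \<in> \<D>" using h by blast
        then show "x \<noteq> y \<and> \<not> R x y" using h cross \<D>(4) by cases blast+
      qed
    qed (use \<D> xs in auto)
  qed (intro exI[of _ "{}"], simp)
qed

lemma far_minus: "far (- x) (- y) \<longleftrightarrow> far x y"
  using far_commute[of y x] by (simp add: far_def)

text \<open>The alternating colours 4 and 7 would clash once around an odd cycle. The window has room for
  the detour 4, 9, 6, 3, 7, since 9 is far from 1 while 3 is far from 0 and \<open>- 1\<close>; the case \<open>s = - 1\<close> is its negation.\<close>

definition window_color :: "int \<Rightarrow> int" where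
  "window_color k = (if k = 1 then 9 else if k = 2 then 6 else if k = 3 then 3
     else if k = 0 \<or> odd k then 4 else 7)"

text \<open>\<open>lab i\<close> is the colour of the matching edge at the vertex between
  \<open>\<epsilon> i\<close> and \<open>\<epsilon> (i + 1)\<close>. For \<open>s = 1\<close>,
  counting from the window, vertices 0 and 1 touch the colour 9, vertices 2 and 3 the colour 3. As
  \<open>n\<close> is odd, the last index \<open>n - 1\<close> is even and carries 7, which fits the
  4 at index 0.\<close>

lemma odd_ring_coloring:
  fixes \<epsilon> :: "int \<Rightarrow> 'e" and lab :: "int \<Rightarrow> int"
  assumes n: "odd n" "5 \<le> n" and inj: "\<And>i j. \<epsilon> i = \<epsilon> j \<longleftrightarrow> n dvd i - j"
    and lab: "\<And>i. lab i \<in> {- 1, 0, 1}" and per: "\<And>i j. n dvd i - j \<Longrightarrow> lab i = lab j"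
    and s: "s = 1 \<or> s = - 1"
    and win: "lab p = s" "lab (p + 1) = s" "lab (p + 2) \<noteq> s" "lab (p + 3) \<noteq> s"
  shows "\<exists>c. \<forall>i. far (c (\<epsilon> i)) (c (\<epsilon> (i + 1))) \<and> far (c (\<epsilon> i)) (lab i) \<and> far (c (\<epsilon> (i + 1))) (lab i)"
proof -
  \<comment> \<open>Any index of an edge will do, since two of them differ by a multiple of
    \<open>n\<close> and the colour depends only on the residue.\<close>
  define idx where "idx e = (SOME i. \<epsilon> i = e)" for e
  have idx: "n dvd idx (\<epsilon> i) - i" for i
    using someI_ex[of "\<lambda>j. \<epsilon> j = \<epsilon> i"] inj unfolding idx_def by blast
  define c where "c e = s * window_color ((idx e - p) mod n)" for e
  have c: "c (\<epsilon> i) = s * window_color ((i - p) mod n)" for i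
  proof -
    have "n dvd (idx (\<epsilon> i) - p) - (i - p)" using idx[of i] by simp
    then have "(idx (\<epsilon> i) - p) mod n = (i - p) mod n" by (simp only: mod_eq_dvd_iff)
    then show ?thesis by (simp add: c_def)
  qed
  have farS: "far (s * x) (s * y) \<longleftrightarrow> far x y" for x y using s far_minus by auto
  show ?thesis
  proof (intro exI[of _ c] allI)
    fix i
    define k where "k = (i - p) mod n"
    have k: "0 \<le> k" "k < n" using n by (auto simp: k_def)
    have k1: "(i + 1 - p) mod n = (if k = n - 1 then 0 else k + 1)"
    proof -
      have "(i + 1 - p) mod n = ((i - p) + 1) mod n" by (simp add: algebra_simps)
      also have "\<dots> = (k + 1) mod n" unfolding k_def by (simp only: mod_add_left_eq)
      finally have "(i + 1 - p) mod n = (k + 1) mod n" .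
      then show ?thesis using k by (auto simp: mod_pos_pos_trivial)
    qed
    define l where "l = s * lab i"
    have labi: "lab i = s * l" using s by (auto simp: l_def)
    have lk: "lab i = lab (p + k)"
      by (rule per) (simp add: k_def, metis dvd_minus_mod diff_diff_eq)
    have l: "l \<in> {- 1, 0, 1}" using lab[of i] s by (auto simp: l_def)
    have l01: "l = 1" if "k = 0 \<or> k = 1" using that lk win s by (auto simp: l_def)
    have l23: "l \<noteq> 1" if "k = 2 \<or> k = 3" using that lk win s by (auto simp: l_def)
    have "far (window_color k) (window_color (if k = n - 1 then 0 else k + 1)) \<and>
        far (window_color k) l \<and> far (window_color (if k = n - 1 then 0 else k + 1)) l"
    proof -
      consider "k = 0" | "k = 1" | "k = 2" | "k = 3" | "4 \<le> k" "k = n - 1" | "4 \<le> k" "k < n - 1"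
        using k by linarith
      then show ?thesis
      proof cases
        case 1 then show ?thesis using l01 n by (simp add: window_color_def far_def)
      next
        case 2 then show ?thesis using l01 n by (simp add: window_color_def far_def)
      next
        case 3 then show ?thesis using l23 l n by (auto simp: window_color_def far_def)
      next
        case 4 then show ?thesis using l23 l n by (auto simp: window_color_def far_def)
      next
        case 5 then show ?thesis using l n by (auto simp: window_color_def far_def)
      next
        case 6 then show ?thesis using l by (auto simp: window_color_def far_def)
      qed
    qed
    then show "far (c (\<epsilon> i)) (c (\<epsilon> (i + 1))) \<and> far (c (\<epsilon> i)) (lab i) \<and> far (c (\<epsilon> (i + 1))) (lab i)"
      by (simp only: c labi farS k_def[symmetric] k1)
  qed
qed

section \<open>Colouring along a matching\<close>

text \<open>\<open>x\<close> subdivides the edge \<open>ab\<close> of the complete graph on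
  \<open>a, b, c, d\<close>. The argument is the set of joined pairs, so parallel edges are
  identified and further edges are allowed.\<close>

definition subdivided_K4 :: "'v set set \<Rightarrow> bool" where
  "subdivided_K4 \<P> \<longleftrightarrow> (\<exists>a b c d x. distinct [a, b, c, d, x] \<and>
     {{x, a}, {x, b}, {a, c}, {a, d}, {b, c}, {b, d}, {c, d}} \<subseteq> \<P>)"

lemma subdivided_K4I:
  assumes "distinct [a, b, c, d, x]" "{x, a} \<in> \<P>" "{x, b} \<in> \<P>" "{a, c} \<in> \<P>" "{a, d} \<in> \<P>"
    "{b, c} \<in> \<P>" "{b, d} \<in> \<P>" "{c, d} \<in> \<P>"
  shows "subdivided_K4 \<P>"
  unfolding subdivided_K4_def
  by (intro exI[of _ a] exI[of _ b] exI[of _ c] exI[of _ d] exI[of _ x] conjI assms(1))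
    (simp only: insert_subset assms empty_subsetI simp_thms)

locale matched = subcubic +
  fixes M :: "'a set"
  assumes sub: "M \<subseteq> E" and indep: "\<And>e f. e \<in> M \<Longrightarrow> f \<in> M \<Longrightarrow> e \<noteq> f \<Longrightarrow> en e \<inter> en f = {}"
    and cubic: "\<And>v. card (star v) = 3 \<Longrightarrow> \<exists>e\<in>M. v \<in> en e"
    and hits: "\<And>T. triangle T \<Longrightarrow> \<exists>e\<in>M. en e \<subseteq> T"
    and no_K4: "\<not> subdivided_K4 (en ` E)"
begin

section \<open>Edges outside the matching\<close>

definition rest :: "'a set" where "rest = E - M"

definition mate :: "'b \<Rightarrow> 'b" where
  "mate v = (if \<exists>w. w \<noteq> v \<and> {v, w} \<in> en ` M then SOME w. w \<noteq> v \<and> {v, w} \<in> en ` M else v)"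

lemma mate_eq:
  assumes "{v, w} \<in> en ` M" "w \<noteq> v"
  shows "mate v = w"
proof -
  have "w' = w" if w': "w' \<noteq> v" "{v, w'} \<in> en ` M" for w'
  proof -
    obtain e where e: "e \<in> M" "en e = {v, w}" using assms(1) by (metis image_iff)
    obtain f where f: "f \<in> M" "en f = {v, w'}" using w'(2) by (metis image_iff)
    have "e = f" using indep[of e f] e f by auto
    then show ?thesis using w' e f by (auto simp: doubleton_eq_iff)
  qed
  then have "(SOME w'. w' \<noteq> v \<and> {v, w'} \<in> en ` M) = w"
    using assms by (intro some_equality conjI) (assumption+, blast)
  moreover have "mate v = (SOME w'. w' \<noteq> v \<and> {v, w'} \<in> en ` M)"
    unfolding mate_def by (rule if_P) (use assms in blast)
  ultimately show ?thesis by simp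
qed

lemma mate_cases: "mate v = v \<or> mate v \<noteq> v \<and> {v, mate v} \<in> en ` M"
proof (cases "\<exists>w. w \<noteq> v \<and> {v, w} \<in> en ` M")
  case True
  then show ?thesis using mate_eq by auto
next
  case False
  then have "mate v = v" unfolding mate_def by (rule if_not_P)
  then show ?thesis ..
qed

lemma mate_mate: "mate (mate v) = v"
  using mate_cases[of v]
proof
  assume "mate v \<noteq> v \<and> {v, mate v} \<in> en ` M"
  then have "v \<noteq> mate v" "{mate v, v} \<in> en ` M" by (metis, simp add: insert_commute)
  then show ?thesis by (intro mate_eq)
qed simp

text \<open>A vertex of degree 3 loses one edge to the matching, so \<open>rest\<close> has degree
  at most 2 everywhere.\<close>

lemma rest_at_vertex:
  assumes "S \<subseteq> rest" "\<And>e. e \<in> S \<Longrightarrow> v \<in> en e"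
  shows "card S \<le> 2"
proof -
  have S: "S \<subseteq> star v" using assms by (auto simp: rest_def star_def)
  then have le: "card S \<le> card (star v)" by (simp add: card_mono)
  show ?thesis
  proof (cases "card (star v) = 3")
    case True
    then obtain m where m: "m \<in> M" "v \<in> en m" using cubic by blast
    then have "insert m S \<subseteq> star v" "m \<notin> S" using S sub assms(1) by (auto simp: star_def rest_def)
    moreover have "finite S" using S by (meson finite_subset fin_star)
    ultimately have "Suc (card S) \<le> card (star v)" by (metis card_insert_disjoint card_mono fin_star)
    then show ?thesis using True by simp
  next
    case False
    then show ?thesis using le degree_le[of v] by linarith
  qed
qed

lemma rest_three:
  assumes "e \<in> rest" "f \<in> rest" "g \<in> rest" "v \<in> en e" "v \<in> en f" "v \<in> en g"
  shows "e = f \<or> e = g \<or> f = g"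
proof (rule ccontr)
  assume "\<not> ?thesis"
  then have "card {e, f, g} = 3" by auto
  moreover have "card {e, f, g} \<le> 2" by (rule rest_at_vertex[of _ v]) (use assms in auto)
  ultimately show False by simp
qed

lemma rest_degree:
  assumes "e \<in> rest"
  shows "card {f \<in> rest. adjacent en e f} \<le> 2"
proof -
  have finR: "finite rest" using fin by (simp add: rest_def)
  define A where "A v = {f \<in> rest. f \<noteq> e \<and> v \<in> en f}" for v
  have A: "card (A v) \<le> 1" if "v \<in> en e" for v
  proof -
    have "card (insert e (A v)) \<le> 2"
      by (rule rest_at_vertex[of _ v]) (use that assms in \<open>auto simp: A_def\<close>)
    moreover have "finite (A v)" "e \<notin> A v" using finR by (auto simp: A_def)
    ultimately show ?thesis by simp
  qed
  have "card (en e) = 2" using two assms by (simp add: rest_def)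
  then obtain v w where vw: "en e = {v, w}" by (auto simp: card_2_iff)
  have "{f \<in> rest. adjacent en e f} \<subseteq> A v \<union> A w" by (auto simp: adjacent_def A_def vw)
  then have "card {f \<in> rest. adjacent en e f} \<le> card (A v \<union> A w)"
    using finR by (intro card_mono) (auto simp: A_def)
  also have "\<dots> \<le> card (A v) + card (A w)" by (rule card_Un_le)
  finally show ?thesis using A[of v] A[of w] vw by simp
qed

section \<open>Odd cycles and their corners\<close>

definition odd_cycle :: "'a list \<Rightarrow> bool" where
  "odd_cycle xs \<longleftrightarrow> ring (adjacent en) xs \<and> set xs \<subseteq> rest \<and> odd (length xs) \<and>
     adjacent en (xs ! 0) (xs ! (length xs - 1))"

definition cyclic_nth :: "'a list \<Rightarrow> int \<Rightarrow> 'a" where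
  "cyclic_nth xs i = xs ! nat (i mod int (length xs))"

definition corner :: "'a list \<Rightarrow> int \<Rightarrow> 'b" where
  "corner xs i = (SOME v. v \<in> en (cyclic_nth xs i) \<inter> en (cyclic_nth xs (i + 1)))"

context
  fixes xs assumes odd_cycle: "odd_cycle xs"
begin

lemma odd_cycle_length: "odd (int (length xs))" "3 \<le> int (length xs)"
proof -
  have o: "odd (length xs)" using odd_cycle by (simp add: odd_cycle_def)
  then show "odd (int (length xs))" by simp
  have "length xs \<noteq> 1" using odd_cycle by (auto simp: odd_cycle_def adjacent_def)
  then show "3 \<le> int (length xs)" using o by (cases "length xs") auto
qed

lemma cyclic_index_bounds: "0 \<le> i mod int (length xs)" "i mod int (length xs) < int (length xs)"
proof -
  have "0 < int (length xs)" using odd_cycle_length(2) by linarith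
  then show "0 \<le> i mod int (length xs)" "i mod int (length xs) < int (length xs)"
    by (rule pos_mod_sign, rule pos_mod_bound)
qed

lemma cyclic_index: "nat (i mod int (length xs)) < length xs"
proof -
  note cyclic_index_bounds[of i]
  then show ?thesis by linarith
qed

lemma cyclic_nth_eq: "cyclic_nth xs i = cyclic_nth xs j \<longleftrightarrow> int (length xs) dvd i - j"
proof -
  have "distinct xs" using odd_cycle by (simp add: odd_cycle_def ring_def)
  then have "cyclic_nth xs i = cyclic_nth xs j \<longleftrightarrow>
      nat (i mod int (length xs)) = nat (j mod int (length xs))"
    by (simp add: cyclic_nth_def nth_eq_iff_index_eq cyclic_index)
  also have "\<dots> \<longleftrightarrow> i mod int (length xs) = j mod int (length xs)"
    by (rule eq_nat_nat_iff) (rule cyclic_index_bounds)+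
  finally show ?thesis by (simp only: mod_eq_dvd_iff)
qed

lemma cyclic_nth_in: "cyclic_nth xs i \<in> set xs"
  unfolding cyclic_nth_def by (rule nth_mem) (rule cyclic_index)

lemma cyclic_nth_rest: "cyclic_nth xs i \<in> rest"
  using cyclic_nth_in odd_cycle by (auto simp: odd_cycle_def)

lemma cyclic_nth_surj: "e \<in> set xs \<Longrightarrow> \<exists>i. e = cyclic_nth xs i"
proof -
  assume "e \<in> set xs"
  then obtain k where "k < length xs" "e = xs ! k" by (metis in_set_conv_nth)
  then have "e = cyclic_nth xs (int k)" by (simp add: cyclic_nth_def)
  then show ?thesis ..
qed

lemma cyclic_nth_adjacent: "adjacent en (cyclic_nth xs i) (cyclic_nth xs (i + 1))"
proof -
  define n where "n = int (length xs)"
  define k where "k = i mod n"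
  have n: "3 \<le> n" using odd_cycle_length by (simp add: n_def)
  then have k: "0 \<le> k" "k < n" by (auto simp: k_def)
  have i: "(i + 1) mod n = (k + 1) mod n" unfolding k_def by (simp only: mod_add_left_eq)
  show ?thesis
  proof (cases "k + 1 = n")
    case True
    then have "nat k = length xs - 1" "nat ((i + 1) mod n) = 0" using i by (auto simp: n_def)
    then show ?thesis using odd_cycle adjacent_commute[of en]
      by (simp add: cyclic_nth_def odd_cycle_def k_def n_def)
  next
    case False
    then have "(i + 1) mod n = k + 1" using i k by simp
    then have "nat ((i + 1) mod n) = Suc (nat k)" "Suc (nat k) < length xs"
      using k False by (auto simp: n_def)
    then show ?thesis using odd_cycle by (simp add: cyclic_nth_def odd_cycle_def ring_def k_def n_def)
  qed
qed

lemma corner_in: "corner xs i \<in> en (cyclic_nth xs i)" "corner xs i \<in> en (cyclic_nth xs (i + 1))"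
proof -
  have "\<exists>v. v \<in> en (cyclic_nth xs i) \<inter> en (cyclic_nth xs (i + 1))"
    using cyclic_nth_adjacent[of i] by (auto simp: adjacent_def)
  from someI_ex[OF this] show "corner xs i \<in> en (cyclic_nth xs i)" "corner xs i \<in> en (cyclic_nth xs (i + 1))"
    by (simp_all add: corner_def)
qed

lemma not_dvd_small: "\<not> int (length xs) dvd 1" "\<not> int (length xs) dvd 2"
proof -
  have "\<not> int (length xs) dvd k" if "0 < k" "k < 3" for k
    using zdvd_imp_le[of "int (length xs)" k] that odd_cycle_length(2) by linarith
  from this[of 1] this[of 2] show "\<not> int (length xs) dvd 1" "\<not> int (length xs) dvd 2" by linarith+
qed

text \<open>At most two edges of \<open>rest\<close> meet at a vertex, so equal corners force equal
  pairs of consecutive edges; if the pairs matched crosswise, the length would divide 2.\<close>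

lemma corner_eq: "corner xs i = corner xs j \<longleftrightarrow> int (length xs) dvd i - j"
proof
  assume "int (length xs) dvd i - j"
  then have "cyclic_nth xs i = cyclic_nth xs j" "cyclic_nth xs (i + 1) = cyclic_nth xs (j + 1)"
    by (simp_all add: cyclic_nth_eq)
  then show "corner xs i = corner xs j" by (simp add: corner_def)
next
  assume eq: "corner xs i = corner xs j"
  let ?e = "cyclic_nth xs"
  have v: "corner xs i \<in> en (?e i)" "corner xs i \<in> en (?e (i + 1))"
    "corner xs i \<in> en (?e j)" "corner xs i \<in> en (?e (j + 1))"
    using corner_in[of i] corner_in[of j] eq by auto
  have 1: "?e i \<noteq> ?e (i + 1)" "?e j \<noteq> ?e (j + 1)" using not_dvd_small by (auto simp: cyclic_nth_eq)
  have "?e i = ?e j \<or> ?e (i + 1) = ?e j" "?e i = ?e (j + 1) \<or> ?e (i + 1) = ?e (j + 1)"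
    using rest_three[OF _ _ _ v(1,2,3)] rest_three[OF _ _ _ v(1,2,4)] cyclic_nth_rest 1 by auto
  then consider "?e i = ?e j" | "?e (i + 1) = ?e j" "?e i = ?e (j + 1)" using 1 by auto
  then show "int (length xs) dvd i - j"
  proof cases
    case 1
    then show ?thesis by (simp add: cyclic_nth_eq)
  next
    case 2
    then have "int (length xs) dvd (i + 1 - j) - (i - (j + 1))" unfolding cyclic_nth_eq by (rule dvd_diff)
    then show ?thesis using not_dvd_small by simp
  qed
qed

lemma ends_cyclic_nth: "en (cyclic_nth xs (i + 1)) = {corner xs i, corner xs (i + 1)}"
proof -
  have e: "cyclic_nth xs (i + 1) \<in> E" using cyclic_nth_rest by (simp add: rest_def)
  have "corner xs i \<noteq> corner xs (i + 1)" using not_dvd_small by (simp add: corner_eq)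
  moreover have "{corner xs i, corner xs (i + 1)} \<subseteq> en (cyclic_nth xs (i + 1))" using corner_in by auto
  ultimately show ?thesis using two[OF e] finite_ends[OF e] card_seteq by (metis card_2_iff order_refl)
qed

lemma corner_edge: "{corner xs i, corner xs (i + 1)} \<in> en ` E"
proof -
  have "cyclic_nth xs (i + 1) \<in> E" using cyclic_nth_rest by (simp add: rest_def)
  then have "en (cyclic_nth xs (i + 1)) \<in> en ` E" by (rule imageI)
  then show ?thesis by (simp only: ends_cyclic_nth)
qed

text \<open>The matching has an edge inside every triangle. On a cycle of length 3,
  \<open>triangle_no_digon\<close> would identify it with a cycle edge, and these lie outside the
  matching.\<close>

lemma odd_cycle_length_ge_5: "5 \<le> int (length xs)"
proof (rule ccontr)
  assume "\<not> ?thesis"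
  then have n: "int (length xs) = 3"
    using odd_cycle_length by (cases "int (length xs) = 4") auto
  have 3: "corner xs 3 = corner xs 0" using corner_eq[of 3 0] n by simp
  have d: "corner xs 0 \<noteq> corner xs 1" "corner xs 1 \<noteq> corner xs 2" "corner xs 0 \<noteq> corner xs 2"
    by (simp_all add: corner_eq n)
  have e: "en (cyclic_nth xs 1) = {corner xs 0, corner xs 1}" "en (cyclic_nth xs 2) = {corner xs 1, corner xs 2}"
    "en (cyclic_nth xs 3) = {corner xs 2, corner xs 0}"
    using ends_cyclic_nth[of 0] ends_cyclic_nth[of 1] ends_cyclic_nth[of 2] 3 by simp_all
  have T: "triangle {corner xs 0, corner xs 1, corner xs 2}"
    unfolding triangle_def using d corner_edge[of 0] corner_edge[of 1] corner_edge[of 2] 3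
    by (intro exI[of _ "corner xs 0"] exI[of _ "corner xs 1"] exI[of _ "corner xs 2"]) (auto simp: insert_commute)
  then obtain m where m: "m \<in> M" "en m \<subseteq> {corner xs 0, corner xs 1, corner xs 2}" using hits by blast
  obtain v w where vw: "en m = {v, w}" "v \<noteq> w" using two[of m] m sub by (auto simp: card_2_iff)
  have "v \<in> {corner xs 0, corner xs 1, corner xs 2}" "w \<in> {corner xs 0, corner xs 1, corner xs 2}"
    using m(2) vw by auto
  then have "en m = en (cyclic_nth xs 1) \<or> en m = en (cyclic_nth xs 2) \<or> en m = en (cyclic_nth xs 3)"
    unfolding vw(1) e doubleton_eq_iff using vw(2) by auto
  then obtain k where k: "en m = en (cyclic_nth xs k)" by blast
  have "m = cyclic_nth xs k"
    by (rule triangle_no_digon[OF T]) (use m sub k cyclic_nth_rest[of k] in \<open>auto simp: rest_def\<close>)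
  then show False using m cyclic_nth_rest[of k] by (simp add: rest_def)
qed

text \<open>Two matching chords of a pentagon complete a subdivided K4: the vertex on neither chord,
  \<open>u + 4\<close> or \<open>u + 3\<close>, subdivides the edge that would join its two
  neighbours.\<close>

lemma pentagon_chords:
  assumes n: "int (length xs) = 5" and u: "mate (corner xs u) = corner xs (u + 2)"
  shows "mate (corner xs (u + 1)) \<noteq> corner xs (u + 3) \<and> mate (corner xs (u + 1)) \<noteq> corner xs (u + 4)"
proof -
  let ?v = "corner xs"
  have chord: "{?v i, ?v j} \<in> en ` E" if "mate (?v i) = ?v j" "\<not> 5 dvd i - j" for i j
    using mate_cases[of "?v i"] that sub dvd_diff_commute[of 5 i j] by (auto simp: corner_eq n)
  have d: "distinct [?v u, ?v (u + 1), ?v (u + 2), ?v (u + 3), ?v (u + 4)]"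
    by (simp add: corner_eq n)
  have d1: "distinct [?v u, ?v (u + 3), ?v (u + 1), ?v (u + 2), ?v (u + 4)]"
    and d2: "distinct [?v (u + 2), ?v (u + 4), ?v u, ?v (u + 1), ?v (u + 3)]" using d by auto
  have u5: "?v (u + 5) = ?v u" by (simp add: corner_eq n)
  have e: "{?v u, ?v (u + 1)} \<in> en ` E" "{?v (u + 1), ?v (u + 2)} \<in> en ` E" "{?v (u + 2), ?v (u + 3)} \<in> en ` E"
    "{?v (u + 3), ?v (u + 4)} \<in> en ` E" "{?v (u + 4), ?v u} \<in> en ` E"
    using corner_edge[of u] corner_edge[of "u + 1"] corner_edge[of "u + 2"] corner_edge[of "u + 3"]
      corner_edge[of "u + 4"] u5 by (simp_all add: ac_simps)
  have c: "{?v u, ?v (u + 2)} \<in> en ` E" by (rule chord[OF u]) simp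
  have commute: "{w, v} \<in> en ` E" if "{v, w} \<in> en ` E" for v w
    using that by (simp add: insert_commute)
  show ?thesis
  proof (intro conjI notI)
    assume "mate (?v (u + 1)) = ?v (u + 3)"
    then have "{?v (u + 1), ?v (u + 3)} \<in> en ` E" by (rule chord) simp
    then have "subdivided_K4 (en ` E)"
      by (intro subdivided_K4I[of "?v u" "?v (u + 3)" "?v (u + 1)" "?v (u + 2)" "?v (u + 4)"])
        (rule d1, (assumption | rule e c commute[OF e(1)] commute[OF e(2)] commute[OF e(3)] commute[OF e(4)]
          commute[OF e(5)] | (rule commute, assumption))+)
    then show False using no_K4 by simp
  next
    assume "mate (?v (u + 1)) = ?v (u + 4)"
    then have "{?v (u + 1), ?v (u + 4)} \<in> en ` E" by (rule chord) simp
    then have "subdivided_K4 (en ` E)"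
      by (intro subdivided_K4I[of "?v (u + 2)" "?v (u + 4)" "?v u" "?v (u + 1)" "?v (u + 3)"])
        (rule d2, (assumption | rule e c commute[OF c] commute[OF e(1)] commute[OF e(2)] commute[OF e(3)]
          commute[OF e(4)] commute[OF e(5)] | (rule commute, assumption))+)
    then show False using no_K4 by simp
  qed
qed

lemma odd_cycle_coloring:
  assumes lab: "\<And>v. lab v \<in> {- 1, 0, 1 :: int}"
    and d: "d = 1 \<or> d = - 1" and s: "s = 1 \<or> s = - 1"
    and win: "lab (corner xs p) = s" "lab (corner xs (p + d)) = s"
      "lab (corner xs (p + 2 * d)) \<noteq> s" "lab (corner xs (p + 3 * d)) \<noteq> s"
  shows "\<exists>c. (\<forall>e\<in>set xs. \<forall>f\<in>set xs. adjacent en e f \<longrightarrow> far (c e) (c f)) \<and>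
    (\<forall>e\<in>set xs. \<forall>v\<in>en e. far (c e) (lab v))"
proof -
  let ?e = "cyclic_nth xs"
  have "\<exists>c. \<forall>i. far (c (?e i)) (c (?e (i + 1))) \<and> far (c (?e i)) (lab (corner xs i)) \<and>
      far (c (?e (i + 1))) (lab (corner xs i))"
  proof (cases "d = 1")
    case True
    have "lab (corner xs i) = lab (corner xs j)" if "int (length xs) dvd i - j" for i j
      using that corner_eq by metis
    then show ?thesis
      by (rule odd_ring_coloring[OF odd_cycle_length(1) odd_cycle_length_ge_5 cyclic_nth_eq lab _ s, of _ p])
        (use win True in auto)
  next
    case False
    then have d: "d = - 1" using d by simp
    \<comment> \<open>The cycle is read backwards. The corner \<open>- i\<close> lies on the edges
      \<open>1 - i\<close> and \<open>- i\<close>, hence the offset 1 in the edge indices.\<close>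
    have "\<exists>c. \<forall>i. far (c (?e (1 - i))) (c (?e (1 - (i + 1)))) \<and> far (c (?e (1 - i))) (lab (corner xs (- i))) \<and>
      far (c (?e (1 - (i + 1)))) (lab (corner xs (- i)))"
    proof (rule odd_ring_coloring[OF odd_cycle_length(1) odd_cycle_length_ge_5 _ lab _ s, of _ _ "- p"])
      fix i j :: int
      have *: "int (length xs) dvd j - i \<longleftrightarrow> int (length xs) dvd i - j" by (rule dvd_diff_commute)
      show "?e (1 - i) = ?e (1 - j) \<longleftrightarrow> int (length xs) dvd i - j" using * by (simp add: cyclic_nth_eq)
      assume "int (length xs) dvd i - j"
      then have "corner xs (- i) = corner xs (- j)" using * by (simp add: corner_eq)
      then show "lab (corner xs (- i)) = lab (corner xs (- j))" by simp
    qed (use win d in auto)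
    then obtain c where c: "\<And>i. far (c (?e (1 - i))) (c (?e (1 - (i + 1)))) \<and>
      far (c (?e (1 - i))) (lab (corner xs (- i))) \<and> far (c (?e (1 - (i + 1)))) (lab (corner xs (- i)))"
      by blast
    show ?thesis using c[of "- i" for i] far_commute by (intro exI[of _ c]) (auto simp: add.commute)
  qed
  then obtain c where c: "\<And>i. far (c (?e i)) (c (?e (i + 1)))"
    "\<And>i. far (c (?e i)) (lab (corner xs i))" "\<And>i. far (c (?e (i + 1))) (lab (corner xs i))" by blast
  have corners: "en (?e i) = {corner xs (i - 1), corner xs i}" for i using ends_cyclic_nth[of "i - 1"] by simp
  have "far (c e) (c f)" if ef: "e \<in> set xs" "f \<in> set xs" "adjacent en e f" for e f
  proof -
    obtain i j where ij: "e = ?e i" "f = ?e j" using cyclic_nth_surj ef by blast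
    have "corner xs i \<in> en f \<or> corner xs (i - 1) \<in> en f" using ef(3) corners[of i] by (auto simp: adjacent_def ij)
    then have "?e j = ?e (i + 1) \<or> ?e j = ?e (i - 1)"
    proof
      assume "corner xs i \<in> en f"
      then show ?thesis using rest_three[of e f "?e (i + 1)" "corner xs i"] ef(3) corner_in[of i]
          cyclic_nth_rest cyclic_nth_adjacent[of i] by (auto simp: ij adjacent_def)
    next
      assume "corner xs (i - 1) \<in> en f"
      then show ?thesis using rest_three[of e f "?e (i - 1)" "corner xs (i - 1)"] ef(3) corner_in[of "i - 1"]
          cyclic_nth_rest cyclic_nth_adjacent[of "i - 1"] by (auto simp: ij adjacent_def)
    qed
    then show ?thesis
    proof
      assume "?e j = ?e (i + 1)"
      then show ?thesis using c(1)[of i] by (simp add: ij)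
    next
      assume "?e j = ?e (i - 1)"
      then show ?thesis using c(1)[of "i - 1"] far_commute by (simp add: ij)
    qed
  qed
  moreover have "far (c e) (lab v)" if ev: "e \<in> set xs" "v \<in> en e" for e v
  proof -
    obtain i where i: "e = ?e i" using cyclic_nth_surj ev by blast
    then have "v = corner xs (i - 1) \<or> v = corner xs i" using ev corners[of i] by auto
    then show ?thesis using c(2)[of i] c(3)[of "i - 1"] i by auto
  qed
  ultimately show ?thesis by blast
qed

end

end

context matched
begin

text \<open>Alternation by index parity suffices, as 4 and 7 are far from each other and from every
  label. The only wrap-around adjacency joins the two ends of the list, and then the length is even
  because the ring is no odd cycle.\<close>

lemma short_ring_coloring:
  assumes ring: "ring (adjacent en) xs" and sub: "set xs \<subseteq> rest" and no: "\<not> odd_cycle xs"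
    and lab: "\<And>v. lab v \<in> {- 1, 0, 1 :: int}"
  shows "\<exists>c. (\<forall>e\<in>set xs. \<forall>f\<in>set xs. adjacent en e f \<longrightarrow> far (c e) (c f)) \<and>
    (\<forall>e\<in>set xs. \<forall>v\<in>en e. far (c e) (lab v))"
proof -
  define idx where "idx e = (SOME i. i < length xs \<and> xs ! i = e)" for e
  have idx: "idx e < length xs \<and> xs ! idx e = e" if "e \<in> set xs" for e
  proof -
    have "\<exists>i. i < length xs \<and> xs ! i = e" using that by (simp add: in_set_conv_nth)
    from someI_ex[OF this] show ?thesis by (simp only: idx_def)
  qed
  define c where "c e = (if even (idx e) then 4 else 7 :: int)" for e
  have ordered: "far (c e) (c f)"
    if ef: "e \<in> set xs" "f \<in> set xs" "adjacent en e f" "idx e < idx f" for e f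
  proof -
    have "adjacent en (xs ! idx e) (xs ! idx f)" using ef idx by simp
    then have "idx f = Suc (idx e) \<or> idx e = 0 \<and> Suc (idx f) = length xs"
      using ring ef idx unfolding ring_def by blast
    moreover have "even (length xs)" if h: "idx e = 0" "Suc (idx f) = length xs"
    proof -
      have "idx f = length xs - 1" using h by simp
      then have "adjacent en (xs ! 0) (xs ! (length xs - 1))" using ef idx h(1) by metis
      then show ?thesis using no ring sub by (simp add: odd_cycle_def)
    qed
    ultimately have "even (idx e) \<noteq> even (idx f)" by (metis even_Suc even_zero)
    then show ?thesis by (auto simp: c_def far_def)
  qed
  have "far (c e) (c f)" if ef: "e \<in> set xs" "f \<in> set xs" "adjacent en e f" for e f
  proof -
    have "idx e \<noteq> idx f" using ef idx by (metis adjacent_def)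
    then show ?thesis
      using ordered[of e f] ordered[of f e] ef far_commute adjacent_commute[of en] by (cases "idx e < idx f") auto
  qed
  moreover have "far (c e) (lab v)" for e v using lab[of v] by (auto simp: c_def far_def)
  ultimately show ?thesis by blast
qed

theorem far_coloring: "\<exists>c :: 'a \<Rightarrow> int. \<forall>e\<in>E. \<forall>f\<in>E. adjacent en e f \<longrightarrow> far (c e) (c f)"
proof -
  obtain \<D> where \<D>: "finite \<D>" "\<And>xs. xs \<in> \<D> \<Longrightarrow> ring (adjacent en) xs" "\<Union>(set ` \<D>) = rest"
    and apart: "\<And>xs ys x y. xs \<in> \<D> \<Longrightarrow> ys \<in> \<D> \<Longrightarrow> xs \<noteq> ys \<Longrightarrow> x \<in> set xs \<Longrightarrow> y \<in> set ys \<Longrightarrow>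
      x \<noteq> y \<and> \<not> adjacent en x y"
  proof -
    have "finite rest" using fin by (simp add: rest_def)
    moreover have "adjacent en y x" if "adjacent en x y" for x y
      using that adjacent_commute[of en] by simp
    ultimately show thesis
      using ring_decomposition[of rest "adjacent en"] rest_degree that by (metis (no_types, lifting))
  qed
  have in_rest: "set xs \<subseteq> rest" if "xs \<in> \<D>" for xs using \<D>(3) that by blast
  define \<O> where "\<O> = {xs \<in> \<D>. odd_cycle xs}"
  obtain lab where lab: "\<And>v. lab v \<in> {- 1, 0, 1 :: int}" "\<And>v. lab (mate v) = lab v"
    "\<And>xs. xs \<in> \<O> \<Longrightarrow> \<exists>p d s. (d = 1 \<or> d = - 1) \<and> (s = 1 \<or> s = - 1) \<and>
       lab (corner xs p) = s \<and> lab (corner xs (p + d)) = s \<and>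
       lab (corner xs (p + 2 * d)) \<noteq> s \<and> lab (corner xs (p + 3 * d)) \<noteq> s"
  proof (rule cycle_labelling[of \<O> "\<lambda>xs. int (length xs)" corner mate])
    show "finite \<O>" using \<D>(1) by (simp add: \<O>_def)
    show "odd (int (length xs)) \<and> 5 \<le> int (length xs)" if "xs \<in> \<O>" for xs
      using that odd_cycle_length(1) odd_cycle_length_ge_5 by (simp add: \<O>_def)
    show "corner xs i = corner xs j \<longleftrightarrow> int (length xs) dvd i - j" if "xs \<in> \<O>" for xs i j
      using that corner_eq by (simp add: \<O>_def)
    show "xs = ys" if h: "xs \<in> \<O>" "ys \<in> \<O>" "corner xs i = corner ys j" for xs ys i j
    proof (rule ccontr)
      assume ne: "xs \<noteq> ys"
      have o: "odd_cycle xs" "odd_cycle ys" "xs \<in> \<D>" "ys \<in> \<D>" using h by (auto simp: \<O>_def)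
      have "cyclic_nth xs i \<noteq> cyclic_nth ys j \<and> \<not> adjacent en (cyclic_nth xs i) (cyclic_nth ys j)"
        using apart[OF o(3,4) ne cyclic_nth_in[OF o(1)] cyclic_nth_in[OF o(2)]] .
      then show False using corner_in(1)[OF o(1), of i] corner_in(1)[OF o(2), of j] h(3)
        by (auto simp: adjacent_def)
    qed
    show "mate (mate v) = v" for v by (rule mate_mate)
    show "mate (corner xs (u + 1)) \<noteq> corner xs (u + 3) \<and> mate (corner xs (u + 1)) \<noteq> corner xs (u + 4)"
      if "xs \<in> \<O>" "int (length xs) = 5" "mate (corner xs u) = corner xs (u + 2)" for xs u
      using that pentagon_chords by (simp add: \<O>_def)
  qed (rule that)
  have "\<exists>c. (\<forall>e\<in>set xs. \<forall>f\<in>set xs. adjacent en e f \<longrightarrow> far (c e) (c f)) \<and>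
    (\<forall>e\<in>set xs. \<forall>v\<in>en e. far (c e) (lab v))" if xs: "xs \<in> \<D>" for xs
  proof (cases "odd_cycle xs")
    case True
    then have "xs \<in> \<O>" using xs by (simp add: \<O>_def)
    then obtain p d s where "d = 1 \<or> d = - 1" "s = 1 \<or> s = - 1"
       "lab (corner xs p) = s" "lab (corner xs (p + d)) = s"
       "lab (corner xs (p + 2 * d)) \<noteq> s" "lab (corner xs (p + 3 * d)) \<noteq> s"
      using lab(3) by blast
    then show ?thesis by (intro odd_cycle_coloring[OF True lab(1)])
  next
    case False
    then show ?thesis by (intro short_ring_coloring \<D>(2) in_rest lab(1) xs)
  qed
  then obtain C where C: "\<And>xs e f. xs \<in> \<D> \<Longrightarrow> e \<in> set xs \<Longrightarrow> f \<in> set xs \<Longrightarrow> adjacent en e f \<Longrightarrow> far (C xs e) (C xs f)"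
    "\<And>xs e v. xs \<in> \<D> \<Longrightarrow> e \<in> set xs \<Longrightarrow> v \<in> en e \<Longrightarrow> far (C xs e) (lab v)"
    by metis
  define \<rho> where "\<rho> e = (SOME xs. xs \<in> \<D> \<and> e \<in> set xs)" for e
  have \<rho>: "\<rho> e \<in> \<D> \<and> e \<in> set (\<rho> e)" if "e \<in> rest" for e
  proof -
    have "\<exists>xs. xs \<in> \<D> \<and> e \<in> set xs" using that \<D>(3) by blast
    from someI_ex[OF this] show ?thesis by (simp only: \<rho>_def)
  qed
  \<comment> \<open>A matching edge takes the label of an arbitrary end; both ends agree because
    \<open>lab\<close> is invariant under \<open>mate\<close>.\<close>
  define c where "c e = (if e \<in> M then lab (SOME v. v \<in> en e) else C (\<rho> e) e)" for e
  have cM: "c e = lab v" if e: "e \<in> M" "v \<in> en e" for e v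
  proof -
    obtain w where w: "en e = {v, w}" "w \<noteq> v" using ends_pair[of e v] e sub by blast
    have "{v, w} \<in> en ` M" using w(1) e(1) by (metis imageI)
    then have "mate v = w" using w(2) by (rule mate_eq)
    then have "lab w = lab v" using lab(2)[of v] by simp
    moreover have "(SOME v. v \<in> en e) \<in> {v, w}" unfolding w(1)[symmetric] using e(2) by (rule someI)
    ultimately show ?thesis using e(1) by (auto simp: c_def)
  qed
  have cR: "far (c e) (lab v)" if "e \<in> rest" "v \<in> en e" for e v
    using C(2)[of "\<rho> e" e v] \<rho>[of e] that by (simp add: c_def rest_def)
  show ?thesis
  proof (intro exI[of _ c] ballI impI)
    fix e f assume ef: "e \<in> E" "f \<in> E" "adjacent en e f"
    obtain v where v: "v \<in> en e" "v \<in> en f" using ef(3) by (auto simp: adjacent_def)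
    consider "e \<in> M" "f \<in> M" | "e \<in> M" "f \<in> rest" | "e \<in> rest" "f \<in> M" | "e \<in> rest" "f \<in> rest"
      using ef by (auto simp: rest_def)
    then show "far (c e) (c f)"
    proof cases
      case 1
      then show ?thesis using indep[of e f] ef(3) by (auto simp: adjacent_def)
    next
      case 2
      then show ?thesis using cM[of e v] cR[of f v] v far_commute by simp
    next
      case 3
      then show ?thesis using cM[of f v] cR[of e v] v by simp
    next
      case 4
      then have "\<rho> e = \<rho> f" using apart \<rho> ef(3) by blast
      then have "far (C (\<rho> e) e) (C (\<rho> e) f)" using C(1) \<rho> 4 ef(3) by metis
      then show ?thesis using 4 \<open>\<rho> e = \<rho> f\<close> by (simp add: c_def rest_def)
    qed
  qed
qed

end

section \<open>Minimal uncolourable edge sets\<close>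

lemma card_le_2_subset:
  assumes "finite A" "card A \<le> 2"
  obtains x y where "A \<subseteq> {x, y}"
proof -
  consider "card A = 0" | "card A = 1" | "card A = 2" using assms(2) by linarith
  then show thesis
  proof cases
    case 1
    then show thesis using assms(1) that by auto
  next
    case 2
    then show thesis using that by (metis card_1_singletonE insert_absorb2 order_refl)
  next
    case 3
    then show thesis using that by (metis card_2_iff order_refl)
  qed
qed

theorem far_coloring_exists:
  fixes en :: "'e \<Rightarrow> 'v set"
  assumes "subcubic F en" "\<not> subdivided_K4 (en ` F)"
  shows "\<exists>c :: 'e \<Rightarrow> int. \<forall>e\<in>F. \<forall>f\<in>F. adjacent en e f \<longrightarrow> far (c e) (c f)"
  using assms
proof (induction "card F" arbitrary: F rule: less_induct)
  case less
  interpret subcubic F en by (rule less.prems(1))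
  show ?case
  proof (rule ccontr)
    assume none: "\<not> ?thesis"
    have smaller: "\<exists>c :: 'e \<Rightarrow> int. \<forall>e\<in>A. \<forall>f\<in>A. adjacent en e f \<longrightarrow> far (c e) (c f)" if A: "A \<subset> F" for A
    proof (rule less.hyps)
      show "card A < card F" using A fin by (rule psubset_card_mono[rotated])
      have "\<exists>e\<in>S. \<exists>f\<in>S. e \<noteq> f \<and> en e \<inter> en f = {}" if "S \<subseteq> A" "card S = 4" for S
        using that A by (intro no_four) auto
      then show "subcubic A en"
        using A fin two by unfold_locales (auto intro: finite_subset)
      have "en ` A \<subseteq> en ` F" using A by blast
      then show "\<not> subdivided_K4 (en ` A)" using less.prems(2) unfolding subdivided_K4_def by (meson order_trans)
    qed
    \<comment> \<open>In a minimal counterexample every edge has at least three adjacent edges: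
      otherwise a colouring of the other edges extends by \<open>far_from_two\<close>.\<close>
    have many: False if e: "e \<in> F" and le: "card {f \<in> F. adjacent en e f} \<le> 2" for e
    proof -
      obtain x y where xy: "{f \<in> F. adjacent en e f} \<subseteq> {x, y}"
        using le fin by (auto intro: card_le_2_subset[of "{f \<in> F. adjacent en e f}"])
      have "F - {e} \<subset> F" using e by auto
      then obtain c :: "'e \<Rightarrow> int" where
        c: "\<forall>f\<in>F - {e}. \<forall>g\<in>F - {e}. adjacent en f g \<longrightarrow> far (c f) (c g)"
        using smaller by blast
      obtain z where z: "far z (c x)" "far z (c y)" using far_from_two by blast
      have ze: "far z (c f)" if "f \<in> F" "adjacent en e f" for f using that xy z by auto
      have "far ((c(e := z)) f) ((c(e := z)) g)" if fg: "f \<in> F" "g \<in> F" "adjacent en f g" for f g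
      proof -
        have ne: "f \<noteq> g" using fg by (simp add: adjacent_def)
        have "adjacent en g f" using fg(3) adjacent_commute[of en] by simp
        then show ?thesis
          using ne fg c ze[of f] ze[of g] far_commute by (cases "f = e"; cases "g = e") auto
      qed
      then show False using none by blast
    qed
    have "card (boundary K) \<noteq> 1" for K
    proof
      assume "card (boundary K) = 1"
      then obtain e where e: "boundary K = {e}" by (rule card_1_singletonE)
      then have eF: "e \<in> F" and "card (en e \<inter> K) = 1" by (auto simp: boundary_def)
      then obtain v where v: "en e \<inter> K = {v}" by (meson card_1_singletonE)
      then obtain w where w: "en e = {v, w}" "w \<noteq> v" using ends_pair[OF eF, of v] by blast
      then have vw: "v \<in> K" "w \<notin> K" using v by auto
      define A where "A = {f \<in> F. en f \<subseteq> K}"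
      define B where "B = {f \<in> F. en f \<inter> K = {}}"
      have split: "f = e \<or> f \<in> A \<or> f \<in> B" if f: "f \<in> F" for f
      proof (rule ccontr)
        assume h: "\<not> ?thesis"
        then obtain x where x: "x \<in> en f" "x \<in> K" using f by (auto simp: B_def)
        obtain y where y: "en f = {x, y}" "y \<noteq> x" using ends_pair[OF f x(1)] by blast
        then have "en f \<inter> K = {x}" using h x f by (auto simp: A_def)
        then have "f \<in> boundary K" using f by (simp add: boundary_def)
        then show False using e h by simp
      qed
      \<comment> \<open>Were one side of the cut without edges, all edges adjacent to
        \<open>e\<close> would meet it at the same end, where degree 3 leaves room for only two of
        them. So each side together with \<open>e\<close> is a proper subset of \<open>F\<close>, to
        which minimality applies.\<close>
      have few: False if u: "u \<in> en e" "{f \<in> F. adjacent en e f} \<subseteq> star u" for u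
      proof -
        have "insert e {f \<in> F. adjacent en e f} \<subseteq> star u" using u eF by (auto simp: star_def)
        then have "card (insert e {f \<in> F. adjacent en e f}) \<le> 3"
          using degree_le[of u] by (meson card_mono fin_star order_trans)
        moreover have "e \<notin> {f \<in> F. adjacent en e f}" by (simp add: adjacent_def)
        ultimately have "card {f \<in> F. adjacent en e f} \<le> 2" using fin by simp
        then show False by (rule many[OF eF])
      qed
      have "A \<noteq> {}"
      proof
        assume "A = {}"
        then have "{f \<in> F. adjacent en e f} \<subseteq> star w"
          using split vw w by (fastforce simp: adjacent_def star_def B_def)
        then show False using few[of w] w by simp
      qed
      have "B \<noteq> {}"
      proof
        assume "B = {}"
        then have "{f \<in> F. adjacent en e f} \<subseteq> star v"
          using split vw w by (fastforce simp: adjacent_def star_def A_def)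
        then show False using few[of v] w by simp
      qed
      have disj: "A \<inter> B = {}" "e \<notin> A" "e \<notin> B"
      proof -
        have "en f \<noteq> {}" if "f \<in> F" for f using two[OF that] by auto
        then show "A \<inter> B = {}" by (auto simp: A_def B_def)
        show "e \<notin> A" "e \<notin> B" using w vw by (auto simp: A_def B_def)
      qed
      obtain a b where "a \<in> A" "b \<in> B" using \<open>A \<noteq> {}\<close> \<open>B \<noteq> {}\<close> by blast
      moreover have "A \<subseteq> F" "B \<subseteq> F" by (auto simp: A_def B_def)
      ultimately have "insert e A \<subset> F" "insert e B \<subset> F" using disj eF by blast+
      then obtain c d :: "'e \<Rightarrow> int" where
        c: "\<forall>f\<in>insert e A. \<forall>g\<in>insert e A. adjacent en f g \<longrightarrow> far (c f) (c g)" and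
        d: "\<forall>f\<in>insert e B. \<forall>g\<in>insert e B. adjacent en f g \<longrightarrow> far (d f) (d g)"
        using smaller by meson
      define h where "h f = (if f \<in> insert e A then c f else d f + (c e - d e))" for f
      have hA: "h f = c f" if "f \<in> insert e A" for f using that by (simp add: h_def)
      have hB: "h f = d f + (c e - d e)" if "f \<in> insert e B" for f using that disj by (auto simp: h_def)
      have "far (h f) (h g)" if fg: "f \<in> F" "g \<in> F" "adjacent en f g" for f g
      proof -
        have "en f \<inter> en g \<noteq> {}" using fg(3) by (simp add: adjacent_def)
        then have "\<not> (f \<in> A \<and> g \<in> B)" "\<not> (f \<in> B \<and> g \<in> A)" by (auto simp: A_def B_def)
        then consider "f \<in> insert e A" "g \<in> insert e A" | "f \<in> insert e B" "g \<in> insert e B"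
          using split fg by blast
        then show ?thesis
        proof cases
          case 1
          then have "far (c f) (c g)" using c fg(3) by blast
          then show ?thesis using 1 by (simp add: hA)
        next
          case 2
          then have "far (d f) (d g)" using d fg(3) by blast
          then show ?thesis using 2 by (simp add: hB far_shift)
        qed
      qed
      then show False using none by blast
    qed
    then interpret uncut F en by unfold_locales
    obtain M where "M \<subseteq> F" "\<And>e f. e \<in> M \<Longrightarrow> f \<in> M \<Longrightarrow> e \<noteq> f \<Longrightarrow> en e \<inter> en f = {}"
      "\<And>v. card (star v) = 3 \<Longrightarrow> \<exists>e\<in>M. v \<in> en e" "\<And>T. triangle T \<Longrightarrow> \<exists>e\<in>M. en e \<subseteq> T"
      using triangle_hitting_matching by blast
    then interpret matched F en M using less.prems(2) by unfold_locales
    show False using none far_coloring by blast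
  qed
qed

section \<open>Bounds for the circular chromatic index\<close>

lemma circular_chromatic_index_ge_4:
  fixes G :: "('v, 'e) multigraph"
  assumes G: "finite_loopless G" and le: "\<And>p q f. pq_coloring p q (line_graph G) f \<Longrightarrow> 4 * int q \<le> int p"
  shows "4 \<le> circular_chromatic_index G"
  unfolding circular_chromatic_index_def circular_chromatic_number_def
proof (rule cInf_greatest)
  show "{real p / real q |p q. 0 < q \<and> q \<le> p \<and> (\<exists>f. pq_coloring p q (line_graph G) f)} \<noteq> {}"
    by (rule circular_chromatic_number_set(1)[OF finite_loopless_line_graph[OF G]])
next
  fix x assume "x \<in> {real p / real q |p q. 0 < q \<and> q \<le> p \<and> (\<exists>f. pq_coloring p q (line_graph G) f)}"
  then obtain p q f where x: "x = real p / real q" "0 < q" "pq_coloring p q (line_graph G) f" by blast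
  have "real_of_int (4 * int q) \<le> real_of_int (int p)" using le[OF x(3)] by (simp only: of_int_le_iff)
  then show "4 \<le> x" using x(2) by (simp add: x(1) le_divide_eq)
qed

lemma four_adjacent_edges:
  assumes S: "S \<subseteq> edges G" "card S = 4" and adj: "\<And>e f. e \<in> S \<Longrightarrow> f \<in> S \<Longrightarrow> e \<noteq> f \<Longrightarrow> ends G e \<inter> ends G f \<noteq> {}"
    and col: "pq_coloring p q (line_graph G) c"
  shows "4 * int q \<le> int p"
proof -
  obtain e f g h where S4: "S = {e, f, g, h}" "distinct [e, f, g, h]"
    using S(2) by (auto simp: card_Suc_eq numeral_eq_Suc)
  have "int q \<le> \<bar>int (c x) - int (c y)\<bar>" "\<bar>int (c x) - int (c y)\<bar> \<le> int p - int q"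
    if "x \<in> S" "y \<in> S" "x \<noteq> y" for x y
  proof -
    have "adjacent (ends G) x y" "x \<in> edges G" "y \<in> edges G" using adj that S(1) by (auto simp: adjacent_def)
    then show "int q \<le> \<bar>int (c x) - int (c y)\<bar>" "\<bar>int (c x) - int (c y)\<bar> \<le> int p - int q"
      using col[unfolded pq_coloring_line_graph] by blast+
  qed
  then show ?thesis
    using S4 by (intro four_separated[of "int q" "int (c e)" "int (c f)" "int p" "int (c g)" "int (c h)"]) auto
qed

lemma subdivided_K4_edges:
  assumes K: "subdivided_K4 (ends G ` edges G)" and col: "pq_coloring p q (line_graph G) c"
  shows "4 * int q \<le> int p"
proof -
  obtain a b c' d x where dist: "distinct [a, b, c', d, x]" and
    E: "{x, a} \<in> ends G ` edges G" "{x, b} \<in> ends G ` edges G" "{a, c'} \<in> ends G ` edges G"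
    "{a, d} \<in> ends G ` edges G" "{b, c'} \<in> ends G ` edges G" "{b, d} \<in> ends G ` edges G"
    "{c', d} \<in> ends G ` edges G"
    using K unfolding subdivided_K4_def insert_subset by (elim exE conjE) (rule that)
  define edge where "edge P = (SOME e. e \<in> edges G \<and> ends G e = P)" for P
  define z where "z v w = int (c (edge {v, w}))" for v w
  have edge: "edge P \<in> edges G \<and> ends G (edge P) = P" if "P \<in> ends G ` edges G" for P
  proof -
    have "\<exists>e. e \<in> edges G \<and> ends G e = P" using that by auto
    from someI_ex[OF this] show ?thesis by (simp only: edge_def)
  qed
  have range: "0 \<le> z v w \<and> z v w < int p" if "{v, w} \<in> ends G ` edges G" for v w
    using col[unfolded pq_coloring_line_graph] edge[OF that] by (simp add: z_def)
  have sep: "int q \<le> \<bar>z v w - z s t\<bar> \<and> \<bar>z v w - z s t\<bar> \<le> int p - int q"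
    if h: "{v, w} \<in> ends G ` edges G" "{s, t} \<in> ends G ` edges G" "{v, w} \<noteq> {s, t}" "{v, w} \<inter> {s, t} \<noteq> {}" for v w s t
  proof -
    have "adjacent (ends G) (edge {v, w}) (edge {s, t})"
      using edge[OF h(1)] edge[OF h(2)] h(3,4) unfolding adjacent_def by metis
    then show ?thesis
      using col[unfolded pq_coloring_line_graph] edge[OF h(1)] edge[OF h(2)] unfolding z_def by blast
  qed
  show ?thesis
  proof (rule subdivided_K4_separated[of "z x a" "z x b" "z a c'" "z a d" "z b c'" "z b d" "z c' d"])
    show "\<forall>y\<in>{z x a, z x b, z a c', z a d, z b c', z b d, z c' d}. 0 \<le> y \<and> y < int p"
      using range E by blast
    have "int q \<le> \<bar>fst y - snd y\<bar> \<and> \<bar>fst y - snd y\<bar> \<le> int p - int q"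
      if "y \<in> {(z x a, z x b), (z x a, z a c'), (z x a, z a d), (z a c', z a d), (z x b, z b c'), (z x b, z b d),
        (z b c', z b d), (z a c', z b c'), (z a c', z c' d), (z b c', z c' d), (z a d, z b d), (z a d, z c' d),
        (z b d, z c' d)}" for y
      using that by (elim insertE emptyE; hypsubst; unfold fst_conv snd_conv; intro sep E; use dist in \<open>auto simp: doubleton_eq_iff\<close>)
    then show "\<forall>(u, v)\<in>{(z x a, z x b), (z x a, z a c'), (z x a, z a d), (z a c', z a d), (z x b, z b c'), (z x b, z b d),
        (z b c', z b d), (z a c', z b c'), (z a c', z c' d), (z b c', z c' d), (z a d, z b d), (z a d, z c' d),
        (z b d, z c' d)}. int q \<le> \<bar>u - v\<bar> \<and> \<bar>u - v\<bar> \<le> int p - int q"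
      unfolding case_prod_unfold by blast
  qed
qed

theorem corollary1p6:
  fixes G :: "('v, 'e) multigraph"
  assumes "finite_loopless G"
  shows "\<not> (11 / 3 < circular_chromatic_index G \<and> circular_chromatic_index G < 4)"
proof (cases "subcubic (edges G) (ends G) \<and> \<not> subdivided_K4 (ends G ` edges G)")
  case False
  have "4 \<le> circular_chromatic_index G"
  proof (cases "subdivided_K4 (ends G ` edges G)")
    case True
    show ?thesis by (rule circular_chromatic_index_ge_4[OF assms]) (rule subdivided_K4_edges[OF True])
  next
    case no_K4: False
    then have "\<not> subcubic (edges G) (ends G)" using False by simp
    then obtain S where S: "S \<subseteq> edges G" "card S = 4"
      "\<And>e f. e \<in> S \<Longrightarrow> f \<in> S \<Longrightarrow> e \<noteq> f \<Longrightarrow> ends G e \<inter> ends G f \<noteq> {}"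
      using assms unfolding subcubic_def finite_loopless_def by blast
    show ?thesis by (rule circular_chromatic_index_ge_4[OF assms]) (rule four_adjacent_edges[OF S])
  qed
  then show ?thesis by simp
next
  case True
  then obtain c :: "'e \<Rightarrow> int" where
    c: "\<forall>e\<in>edges G. \<forall>f\<in>edges G. adjacent (ends G) e f \<longrightarrow> far (c e) (c f)"
    using far_coloring_exists by blast
  have "pq_coloring 11 3 (line_graph G) (\<lambda>e. nat (c e mod 11))"
    unfolding pq_coloring_line_graph
  proof (intro conjI ballI impI)
    show "nat (c e mod 11) < 11" for e by (simp add: nat_less_iff)
    fix e f assume "e \<in> edges G" "f \<in> edges G" "adjacent (ends G) e f"
    then have "3 \<le> \<bar>c e mod 11 - c f mod 11\<bar> \<and> \<bar>c e mod 11 - c f mod 11\<bar> \<le> 8"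
      using c by (intro far_residues) blast
    then show "int 3 \<le> \<bar>int (nat (c e mod 11)) - int (nat (c f mod 11))\<bar>"
      "\<bar>int (nat (c e mod 11)) - int (nat (c f mod 11))\<bar> \<le> int 11 - int 3"
      by simp_all
  qed
  then have "real 11 / real 3 \<in> {real p / real q |p q. 0 < q \<and> q \<le> p \<and> (\<exists>f. pq_coloring p q (line_graph G) f)}"
    by (intro CollectI exI[of _ 11] exI[of _ 3]) auto
  then have "circular_chromatic_index G \<le> real 11 / real 3"
    unfolding circular_chromatic_index_def circular_chromatic_number_def
    by (rule cInf_lower) (rule circular_chromatic_number_set(2)[OF finite_loopless_line_graph[OF assms]])
  then show ?thesis by simp
qed

end
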